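(* There exists an absolute constant $C>0$ (independent of $d$ and $\Omega$) such that for every $d\ge1$, every bounded convex domain $\Omega\subset\mathbb{R}^d$, every $v\in H^2(\Omega)$ and $j\in\{0,1\}$, $$\inf_{p\in\mathbb{P}_1(\Omega)}|v-p|_{H^j(\Omega)}\le C\,\operatorname{diam}(\Omega)^{2-j}\,|v|_{H^2(\Omega)} .$$
   Context: $\mathbb{P}_1(\Omega)$ is the space of affine functions (polynomials of degree at most one) on $\Omega$. $|v|_{H^0(\Omega)}=\|v\|_{L^2(\Omega)}$, $|v|_{H^1(\Omega)}=\|\nabla v\|_{L^2(\Omega)}$, $|v|_{H^2(\Omega)}^2=\sum_{i,j=1}^d\|\partial_i\partial_jv\|_{L^2(\Omega)}^2$. *)

theory Defs
  imports "HOL-Analysis.Analysis"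
begin

(* The constant of the theorem must not depend on the dimension d, so d has to be a value and
   not a type. A point of R^d is a function in {..<d} ->E UNIV. This set is both the
   topspace of the product topology and the space of the product measure used here. *)

definition euclid :: "nat \<Rightarrow> (nat \<Rightarrow> real) topology" where
  "euclid d = product_topology (\<lambda>_. euclideanreal) {..<d}"

definition leb :: "nat \<Rightarrow> (nat \<Rightarrow> real) measure" where
  "leb d = completion (Pi\<^sub>M {..<d} (\<lambda>_. lborel))"

definition leb_on :: "nat \<Rightarrow> (nat \<Rightarrow> real) set \<Rightarrow> (nat \<Rightarrow> real) measure" where
  "leb_on d \<Omega> = restrict_space (leb d) \<Omega>"

definition edist :: "nat \<Rightarrow> (nat \<Rightarrow> real) \<Rightarrow> (nat \<Rightarrow> real) \<Rightarrow> real" where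
  "edist d x y = L2_set (\<lambda>i. x i - y i) {..<d}"

definition ebounded :: "nat \<Rightarrow> (nat \<Rightarrow> real) set \<Rightarrow> bool" where
  "ebounded d S \<longleftrightarrow> (\<exists>x\<in>topspace (euclid d). \<exists>r. \<forall>y\<in>S. edist d x y \<le> r)"

definition ediameter :: "nat \<Rightarrow> (nat \<Rightarrow> real) set \<Rightarrow> real" where
  "ediameter d S = (if S = {} then 0 else SUP (x, y)\<in>S \<times> S. edist d x y)"

definition econvex :: "nat \<Rightarrow> (nat \<Rightarrow> real) set \<Rightarrow> bool" where
  "econvex d S \<longleftrightarrow>
     (\<forall>x\<in>S. \<forall>y\<in>S. \<forall>t\<in>{0..1}. (\<lambda>i\<in>{..<d}. (1 - t) * x i + t * y i) \<in> S)"

(* Connectedness, part of being a domain, follows from convexity. *)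
definition bounded_convex_domain :: "nat \<Rightarrow> (nat \<Rightarrow> real) set \<Rightarrow> bool" where
  "bounded_convex_domain d \<Omega> \<longleftrightarrow>
     openin (euclid d) \<Omega> \<and> \<Omega> \<noteq> {} \<and> ebounded d \<Omega> \<and> econvex d \<Omega>"


definition pderiv_at :: "nat \<Rightarrow> ((nat \<Rightarrow> real) \<Rightarrow> real) \<Rightarrow> (nat \<Rightarrow> real) \<Rightarrow> real" where
  "pderiv_at i \<phi> x = deriv (\<lambda>t. \<phi> (x(i := t))) (x i)"

primrec C_k :: "nat \<Rightarrow> nat \<Rightarrow> ((nat \<Rightarrow> real) \<Rightarrow> real) \<Rightarrow> bool" where
  "C_k d 0 \<phi> \<longleftrightarrow> continuous_map (euclid d) euclideanreal \<phi>"
| "C_k d (Suc k) \<phi> \<longleftrightarrow> continuous_map (euclid d) euclideanreal \<phi> \<and>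
     (\<forall>i<d. (\<forall>x\<in>topspace (euclid d). (\<lambda>t. \<phi> (x(i := t))) differentiable at (x i)) \<and>
            C_k d k (pderiv_at i \<phi>))"

definition test_function :: "nat \<Rightarrow> (nat \<Rightarrow> real) set \<Rightarrow> ((nat \<Rightarrow> real) \<Rightarrow> real) \<Rightarrow> bool" where
  "test_function d \<Omega> \<phi> \<longleftrightarrow> (\<forall>k. C_k d k \<phi>) \<and>
     (let K = euclid d closure_of {x \<in> topspace (euclid d). \<phi> x \<noteq> 0}
      in compactin (euclid d) K \<and> K \<subseteq> \<Omega>)"


definition locally_integrable :: "nat \<Rightarrow> (nat \<Rightarrow> real) set \<Rightarrow> ((nat \<Rightarrow> real) \<Rightarrow> real) \<Rightarrow> bool" where
  "locally_integrable d \<Omega> v \<longleftrightarrow>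
     (\<forall>K. compactin (euclid d) K \<and> K \<subseteq> \<Omega> \<longrightarrow> set_integrable (leb_on d \<Omega>) K v)"

definition has_weak_pderiv ::
  "nat \<Rightarrow> (nat \<Rightarrow> real) set \<Rightarrow> nat \<Rightarrow> ((nat \<Rightarrow> real) \<Rightarrow> real) \<Rightarrow> ((nat \<Rightarrow> real) \<Rightarrow> real) \<Rightarrow> bool" where
  "has_weak_pderiv d \<Omega> i v g \<longleftrightarrow> locally_integrable d \<Omega> v \<and> locally_integrable d \<Omega> g \<and>
     (\<forall>\<phi>. test_function d \<Omega> \<phi> \<longrightarrow>
        (LINT x|leb_on d \<Omega>. v x * pderiv_at i \<phi> x) = - (LINT x|leb_on d \<Omega>. g x * \<phi> x))"

(* A choice of representative; weak derivatives are unique up to null sets. *)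
definition weak_pderiv ::
  "nat \<Rightarrow> (nat \<Rightarrow> real) set \<Rightarrow> nat \<Rightarrow> ((nat \<Rightarrow> real) \<Rightarrow> real) \<Rightarrow> (nat \<Rightarrow> real) \<Rightarrow> real" where
  "weak_pderiv d \<Omega> i v = (SOME g. has_weak_pderiv d \<Omega> i v g)"

definition L2_space :: "nat \<Rightarrow> (nat \<Rightarrow> real) set \<Rightarrow> ((nat \<Rightarrow> real) \<Rightarrow> real) set" where
  "L2_space d \<Omega> = {v \<in> borel_measurable (leb_on d \<Omega>). integrable (leb_on d \<Omega>) (\<lambda>x. (v x)\<^sup>2)}"

definition L2_norm :: "nat \<Rightarrow> (nat \<Rightarrow> real) set \<Rightarrow> ((nat \<Rightarrow> real) \<Rightarrow> real) \<Rightarrow> real" where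
  "L2_norm d \<Omega> v = sqrt (LINT x|leb_on d \<Omega>. (v x)\<^sup>2)"

(* H^k: functions (not classes) whose iterated weak derivatives up to order k exist in L^2. *)
primrec sobolev_H :: "nat \<Rightarrow> (nat \<Rightarrow> real) set \<Rightarrow> nat \<Rightarrow> ((nat \<Rightarrow> real) \<Rightarrow> real) set" where
  "sobolev_H d \<Omega> 0 = L2_space d \<Omega>"
| "sobolev_H d \<Omega> (Suc k) = {v \<in> L2_space d \<Omega>.
     \<forall>i<d. (\<exists>g. has_weak_pderiv d \<Omega> i v g) \<and> weak_pderiv d \<Omega> i v \<in> sobolev_H d \<Omega> k}"

(* The square of |v|_{H^k}: the sum over all i_1, ..., i_k < d of the squared L^2 norm of the
   iterated weak derivative of v in the directions i_1, ..., i_k. *)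
primrec H_seminorm_sq ::
  "nat \<Rightarrow> (nat \<Rightarrow> real) set \<Rightarrow> nat \<Rightarrow> ((nat \<Rightarrow> real) \<Rightarrow> real) \<Rightarrow> real" where
  "H_seminorm_sq d \<Omega> 0 v = (L2_norm d \<Omega> v)\<^sup>2"
| "H_seminorm_sq d \<Omega> (Suc k) v = (\<Sum>i<d. H_seminorm_sq d \<Omega> k (weak_pderiv d \<Omega> i v))"

definition H_seminorm ::
  "nat \<Rightarrow> (nat \<Rightarrow> real) set \<Rightarrow> nat \<Rightarrow> ((nat \<Rightarrow> real) \<Rightarrow> real) \<Rightarrow> real" where
  "H_seminorm d \<Omega> k v = sqrt (H_seminorm_sq d \<Omega> k v)"

lemma L2_norm_nonneg: "L2_norm d \<Omega> v \<ge> 0"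
  by (simp add: L2_norm_def)

lemma H_seminorm_0: "H_seminorm d \<Omega> 0 v = L2_norm d \<Omega> v"
  by (simp add: H_seminorm_def L2_norm_nonneg)

lemma H_seminorm_1:
  assumes "v \<in> sobolev_H d \<Omega> 1"
  shows "H_seminorm d \<Omega> 1 v = L2_norm d \<Omega> (\<lambda>x. L2_set (\<lambda>i. weak_pderiv d \<Omega> i v x) {..<d})"
proof -
  have "integrable (leb_on d \<Omega>) (\<lambda>x. (weak_pderiv d \<Omega> i v x)\<^sup>2)" if "i < d" for i
    using assms that by (simp add: L2_space_def)
  then show ?thesis
    by (simp add: H_seminorm_def L2_norm_def L2_set_def sum_nonneg Bochner_Integration.integral_sum)
qed

lemma H_seminorm_2:
  "(H_seminorm d \<Omega> 2 v)\<^sup>2 =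
     (\<Sum>i<d. \<Sum>j<d. (L2_norm d \<Omega> (weak_pderiv d \<Omega> i (weak_pderiv d \<Omega> j v)))\<^sup>2)"
  by (subst sum.swap) (simp add: H_seminorm_def numeral_2_eq_2 sum_nonneg)

definition P1 :: "nat \<Rightarrow> ((nat \<Rightarrow> real) \<Rightarrow> real) set" where
  "P1 d = {p. \<exists>a b. p = (\<lambda>x. b + (\<Sum>i<d. a i * x i))}"

end

(* The weight w = exp (- |x - c|^2 / (2 R^2)), R = diam, lies between exp (-1/2) and 1 on the domain, so a
   Poincare inequality for w gives one for Lebesgue measure with an absolute constant.  For w it is obtained
   from the Prekopa-Leindler inequality, whose constant does not depend on the dimension: the potential of w is
   uniformly convex, so the inequality applies to exp (t f) w, w and exp (t f / 2 + t^2 q |grad f|^2 / 8) w for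
   q > R^2 and small t, and comparing the terms of order t^2 bounds the variance of f by R^2 times the Dirichlet
   integral.  Mollification extends this to weakly differentiable functions.  Applied to the partial derivatives
   of v it yields the linear coefficients of p, and applied to v minus its linear part the constant one. *)

theory Submission
  imports Defs
begin

text \<open>Lebesgue measure on a convex set is log-concave, but not uniformly so: at a midpoint
  nothing is gained, and nothing can absorb the first order term of a function. The Gaussian factor
  supplies the gain |x - y|^2 / (4 R^2), while its width R keeps it above 1/2 on the domain. One use
  of the resulting inequality costs 2 R^2 in squared norms; for j = 0 it is used twice, which gives
  (2 R^2)^2 and hence C = 2. A weak derivative can be tested only with kernels supported in the
  domain, so a mollified function has controlled derivatives only at points whose kernel cube lies
  inside. These points again form a convex set of no larger diameter; the smooth inequality holds
  there with the same constant, and Fatou's lemma recovers the whole domain. Bounds on the kernel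
  depend on the dimension and on its radius, but they affect only error terms that vanish as t tends
  to 0. Fubini, mollification and Prekopa-Leindler use the uncompleted product measure
  \<open>lebP d\<close>; the completed measure of the statement is reached through Borel
  representatives.\<close>

abbreviation lebP :: "nat \<Rightarrow> (nat \<Rightarrow> real) measure" where
  "lebP d \<equiv> Pi\<^sub>M {..<d} (\<lambda>_. lborel)"

abbreviation cube :: "nat \<Rightarrow> (nat \<Rightarrow> real) \<Rightarrow> real \<Rightarrow> (nat \<Rightarrow> real) set" where
  "cube d x r \<equiv> PiE {..<d} (\<lambda>j. {x j - r..x j + r})"

abbreviation open_cube :: "nat \<Rightarrow> (nat \<Rightarrow> real) \<Rightarrow> real \<Rightarrow> (nat \<Rightarrow> real) set" where
  "open_cube d x r \<equiv> PiE {..<d} (\<lambda>j. {x j - r<..<x j + r})"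

abbreviation sqdist :: "nat \<Rightarrow> (nat \<Rightarrow> real) \<Rightarrow> (nat \<Rightarrow> real) \<Rightarrow> real" where
  "sqdist d x y \<equiv> (\<Sum>i<d. (x i - y i)\<^sup>2)"

lemma topspace_euclid: "topspace (euclid d) = extensional {..<d}"
  by (auto simp: euclid_def PiE_def)

section \<open>The Prekopa--Leindler inequality\<close>

lemma emeasure_lborel_affine_vimage:
  fixes A :: "real set"
  assumes [measurable]: "A \<in> sets borel" and "c \<noteq> 0"
  shows "emeasure lborel A = ennreal \<bar>c\<bar> * emeasure lborel {x. t + c * x \<in> A}"
proof -
  have [measurable]: "{x. t + c * x \<in> A} \<in> sets borel" by measurable
  have "emeasure lborel A = (\<integral>\<^sup>+x. indicator A x \<partial>lborel)" by simp
  also have "\<dots> = \<bar>c\<bar> * (\<integral>\<^sup>+x. indicator A (t + c * x) \<partial>lborel)"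
    by (rule nn_integral_real_affine) (use assms in auto)
  also have "(\<integral>\<^sup>+x. indicator A (t + c * x) \<partial>lborel) = (\<integral>\<^sup>+x. indicator {x. t + c * x \<in> A} x \<partial>lborel)"
    by (rule nn_integral_cong) (auto simp: indicator_def)
  also have "\<dots> = emeasure lborel {x. t + c * x \<in> A}"
    by (rule nn_integral_indicator) simp
  finally show ?thesis .
qed

text \<open>Inner regularity, with the compact sets required to contain a prescribed point. The
  point keeps them nonempty, without which the Brunn-Minkowski inequality fails.\<close>

lemma emeasure_lborel_le_compact:
  fixes A :: "real set"
  assumes A: "A \<in> sets borel" and a: "a \<in> A"
    and le: "\<And>K. compact K \<Longrightarrow> K \<subseteq> A \<Longrightarrow> a \<in> K \<Longrightarrow> emeasure lborel K \<le> c"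
  shows "emeasure lborel A \<le> c"
proof (rule ennreal_le_epsilon)
  fix e :: real assume "e > 0" and "c < top"
  have "A \<in> sets lebesgue" using A by simp
  then obtain T where T: "closed T" "T \<subseteq> A" "A - T \<in> lmeasurable" "emeasure lebesgue (A - T) < ennreal e"
    using sets_lebesgue_inner_closed[OF _ \<open>e > 0\<close>] by blast
  \<comment> \<open>Truncating the closed set \<open>T\<close> makes it compact, and adding
    \<open>a\<close> meets the restriction on the test sets in \<open>le\<close>.\<close>
  define K where "K = (\<lambda>n::nat. insert a (T \<inter> {- real n .. real n}))"
  have cK: "compact (K n)" for n
    unfolding K_def using T(1) by (intro compact_insert closed_Int_compact) auto
  have [measurable]: "K n \<in> sets borel" for n using cK by (simp add: compact_imp_closed)
  have "incseq K" unfolding K_def by (auto simp: incseq_def)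
  then have "(SUP n. emeasure lborel (K n)) = emeasure lborel (\<Union>n. K n)"
    by (intro SUP_emeasure_incseq) auto
  moreover have "T \<subseteq> (\<Union>n. K n)"
  proof
    fix x assume "x \<in> T"
    obtain n :: nat where "\<bar>x\<bar> \<le> n" using real_arch_simple by blast
    then have "x \<in> {- real n .. real n}" by auto
    with \<open>x \<in> T\<close> show "x \<in> (\<Union>n. K n)" unfolding K_def by blast
  qed
  moreover have [measurable]: "T \<in> sets borel" using T(1) by simp
  have "emeasure lborel T \<le> emeasure lborel (\<Union>n. K n)"
    by (rule emeasure_mono[OF \<open>T \<subseteq> (\<Union>n. K n)\<close>]) simp
  moreover have "(SUP n. emeasure lborel (K n)) \<le> c"
    by (rule SUP_least, rule le) (use cK T a in \<open>auto simp: K_def\<close>)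
  ultimately have "emeasure lborel T \<le> c" by simp
  moreover have "emeasure lborel A \<le> emeasure lborel T + emeasure lborel (A - T)"
  proof -
    have "emeasure lborel A = emeasure lborel (T \<union> (A - T))" using T(2) by (simp add: Un_absorb1)
    also have "\<dots> \<le> emeasure lborel T + emeasure lborel (A - T)"
      by (rule emeasure_subadditive) (use A in auto)
    finally show ?thesis .
  qed
  moreover have "emeasure lborel (A - T) \<le> ennreal e"
    using T(4) A by (simp add: emeasure_completion)
  ultimately show "emeasure lborel A \<le> c + ennreal e"
    by (meson add_mono order_trans)
qed

text \<open>On the line two translates suffice: K shifted by min L and L shifted by max K both lie
  in the sum set and meet in at most one point, so their measures add up.\<close>

lemma brunn_minkowski_compact_real:
  fixes K L C :: "real set"
  assumes "compact K" "compact L" "K \<noteq> {}" "L \<noteq> {}" and [measurable]: "C \<in> sets borel"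
    and mid: "\<And>x y. x \<in> K \<Longrightarrow> y \<in> L \<Longrightarrow> (x + y) / 2 \<in> C"
  shows "emeasure lborel K + emeasure lborel L \<le> 2 * emeasure lborel C"
proof -
  have [measurable]: "K \<in> sets borel" "L \<in> sets borel"
    using assms by (auto simp: compact_imp_closed)
  obtain a where a: "a \<in> K" "\<And>x. x \<in> K \<Longrightarrow> x \<le> a"
    using compact_attains_sup[of K] assms by blast
  obtain b where b: "b \<in> L" "\<And>x. x \<in> L \<Longrightarrow> b \<le> x"
    using compact_attains_inf[of L] assms by blast
  \<comment> \<open>\<open>K1\<close> is (K + b) / 2 and \<open>L1\<close> is (L + a) / 2 with a =
    max K and b = min L. The first lies to the left of (a + b) / 2 and the second to the right of
    it.\<close>
  define K1 where "K1 = {x. - b + 2 * x \<in> K}"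
  define L1 where "L1 = {x. - a + 2 * x \<in> L}"
  have [measurable]: "K1 \<in> sets borel" "L1 \<in> sets borel"
    unfolding K1_def L1_def by measurable
  have K1: "emeasure lborel K = 2 * emeasure lborel K1"
    unfolding K1_def using emeasure_lborel_affine_vimage[of K 2 "-b"] by simp
  have L1: "emeasure lborel L = 2 * emeasure lborel L1"
    unfolding L1_def using emeasure_lborel_affine_vimage[of L 2 "-a"] by simp
  have "x \<in> C" if "x \<in> K1" for x
    using mid[OF _ b(1), of "- b + 2 * x"] that by (simp add: K1_def)
  moreover have "x \<in> C" if "x \<in> L1" for x
    using mid[OF a(1), of "- a + 2 * x"] that by (simp add: L1_def)
  ultimately have sub: "K1 \<union> (L1 - {(a + b) / 2}) \<subseteq> C" by auto
  have disj: "K1 \<inter> (L1 - {(a + b) / 2}) = {}"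
  proof -
    have False if "x \<in> K1" "x \<in> L1" "x \<noteq> (a + b) / 2" for x
      using a(2)[of "- b + 2 * x"] b(2)[of "- a + 2 * x"] that by (simp add: K1_def L1_def field_simps)
    then show ?thesis by blast
  qed
  have "emeasure lborel K1 + emeasure lborel L1 = emeasure lborel K1 + emeasure lborel (L1 - {(a + b) / 2})"
    by (subst emeasure_Diff_null_set) (auto intro: finite_imp_null_set_lborel)
  also have "\<dots> = emeasure lborel (K1 \<union> (L1 - {(a + b) / 2}))"
    by (rule plus_emeasure) (use disj in auto)
  also have "\<dots> \<le> emeasure lborel C"
    by (rule emeasure_mono[OF sub]) simp
  finally show ?thesis
    unfolding K1 L1 by (metis distrib_left mult_left_mono zero_le)
qed

text \<open>Compact approximation from inside, of A with a compact part of B held fixed and then of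
  B. Holding one set fixed means subtracting its measure, which is legitimate only if it is finite;
  hence the separate case of an infinite measure of C.\<close>

lemma brunn_minkowski_real:
  fixes A B C :: "real set"
  assumes A: "A \<in> sets borel" "A \<noteq> {}" and B: "B \<in> sets borel" "B \<noteq> {}" and C: "C \<in> sets borel"
    and mid: "\<And>x y. x \<in> A \<Longrightarrow> y \<in> B \<Longrightarrow> (x + y) / 2 \<in> C"
  shows "emeasure lborel A + emeasure lborel B \<le> 2 * emeasure lborel C"
proof -
  obtain a b where ab: "a \<in> A" "b \<in> B" using A B by blast
  have 1: "emeasure lborel K + emeasure lborel L \<le> 2 * emeasure lborel C"
    if "compact K" "K \<subseteq> A" "a \<in> K" "compact L" "L \<subseteq> B" "b \<in> L" for K L
    using that by (intro brunn_minkowski_compact_real C mid) auto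
  show ?thesis
  proof (cases "emeasure lborel C = top")
    case True then show ?thesis by (simp add: ennreal_mult_top)
  next
    case False
    let ?c = "2 * emeasure lborel C"
    have fin: "?c \<noteq> top" using False by (simp add: ennreal_mult_eq_top_iff)
    have 2: "emeasure lborel A \<le> ?c - emeasure lborel L"
      if "compact L" "L \<subseteq> B" "b \<in> L" for L
    proof (rule emeasure_lborel_le_compact[OF A(1) ab(1)])
      fix K assume K: "compact K" "K \<subseteq> A" "a \<in> K"
      then show "emeasure lborel K \<le> ?c - emeasure lborel L"
        using 1[OF K that] compact_imp_closed[OF K(1)] emeasure_compact_finite[OF \<open>compact L\<close>]
        by (simp add: ennreal_le_minus_iff)
    qed
    have 3: "emeasure lborel A + emeasure lborel L \<le> ?c"
      if L: "compact L" "L \<subseteq> B" "b \<in> L" for L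
    proof -
      have "emeasure lborel L \<le> emeasure lborel {a} + emeasure lborel L" by simp
      also have "\<dots> \<le> ?c" by (rule 1) (use L ab in auto)
      finally have "emeasure lborel L \<le> ?c" .
      then show ?thesis using 2[OF L]
        by (metis add.commute add_left_mono add_diff_inverse_ennreal)
    qed
    show ?thesis
    proof -
      \<comment> \<open>The case of a one-point compact subset of B already bounds the measure of A,
        so that it can be subtracted in its turn.\<close>
      have Af: "emeasure lborel A \<noteq> top" using 2[of "{b}"] ab fin by (auto simp: top_unique)
      have "emeasure lborel B \<le> ?c - emeasure lborel A"
        by (rule emeasure_lborel_le_compact[OF B(1) ab(2)])
           (use 3 Af in \<open>simp add: ennreal_le_minus_iff add.commute\<close>)
      moreover have "emeasure lborel A \<le> ?c" using 2[of "{b}"] ab by auto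
      ultimately show ?thesis
        by (metis add_left_mono add_diff_inverse_ennreal)
    qed
  qed
qed

text \<open>Tonelli, after writing f x as the length of the set of levels t with 0 < t < f x. The
  restriction to positive t matters because \<open>ennreal\<close> sends every negative t to 0, so
  all negative levels would count.\<close>

lemma nn_integral_layer_cake:
  assumes "sigma_finite_measure M" and [measurable]: "f \<in> borel_measurable M"
  shows "(\<integral>\<^sup>+x. f x \<partial>M) = (\<integral>\<^sup>+t. indicator {0<..} t * emeasure M {x \<in> space M. ennreal t < f x} \<partial>lborel)"
proof -
  interpret sigma_finite_measure M by fact
  interpret pair_sigma_finite M lborel ..
  have pt: "(\<integral>\<^sup>+t. indicator {0<..} t * indicator {t. ennreal t < y} t \<partial>lborel) = y" for y :: ennreal
  proof -
    have "(\<integral>\<^sup>+t. indicator {0<..} t * indicator {t. ennreal t < y} t \<partial>lborel) = (\<integral>\<^sup>+t. indicator {t. 0 < t \<and> ennreal t < y} t \<partial>lborel)"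
      by (rule nn_integral_cong) (auto simp: indicator_def)
    also have "\<dots> = emeasure lborel {t. 0 < t \<and> ennreal t < y}"
      by (rule nn_integral_indicator) measurable
    also have "\<dots> = y"
    proof (cases y)
      case (real r)
      then have "{t. 0 < t \<and> ennreal t < y} = {0<..<r}" by (auto simp: ennreal_less_iff)
      with real show ?thesis by simp
    next
      case top
      then have "{t. 0 < t \<and> ennreal t < y} = {0<..}" by auto
      moreover have "emeasure lborel {0::real<..} = top"
      proof (rule ccontr)
        assume "emeasure lborel {0::real<..} \<noteq> top"
        then obtain r where r: "emeasure lborel {0::real<..} = ennreal r" "r \<ge> 0" by (cases "emeasure lborel {0::real<..}") auto
        have "emeasure lborel {0<..<r+1} \<le> emeasure lborel {0::real<..}" by (rule emeasure_mono) auto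
        then show False using r by (simp add: ennreal_le_iff)
      qed
      ultimately show ?thesis using top by simp
    qed
    finally show ?thesis .
  qed
  have "(\<integral>\<^sup>+x. f x \<partial>M) = (\<integral>\<^sup>+x. (\<integral>\<^sup>+t. indicator {0<..} t * indicator {t. ennreal t < f x} t \<partial>lborel) \<partial>M)"
    by (simp add: pt)
  also have "\<dots> = (\<integral>\<^sup>+t. (\<integral>\<^sup>+x. indicator {0<..} t * indicator {t. ennreal t < f x} t \<partial>M) \<partial>lborel)"
  proof (rule Fubini'[symmetric])
    have [measurable]: "Measurable.pred (M \<Otimes>\<^sub>M lborel) (\<lambda>(x, t). ennreal t < f x)" by measurable
    have "(\<lambda>(x, t). indicator {0<..} t * indicator {t. ennreal t < f x} t :: ennreal) = (\<lambda>p. indicator {p. 0 < snd p \<and> ennreal (snd p) < f (fst p)} p)"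
      by (auto simp: indicator_def fun_eq_iff)
    moreover have "(\<lambda>p. indicator {p. 0 < snd p \<and> ennreal (snd p) < f (fst p)} p :: ennreal) \<in> borel_measurable (M \<Otimes>\<^sub>M lborel)"
      by measurable
    ultimately show "(\<lambda>(x, t). indicator {0<..} t * indicator {t. ennreal t < f x} t :: ennreal) \<in> borel_measurable (M \<Otimes>\<^sub>M lborel)"
      by simp
  qed
  also have "\<dots> = (\<integral>\<^sup>+t. indicator {0<..} t * emeasure M {x \<in> space M. ennreal t < f x} \<partial>lborel)"
  proof (rule nn_integral_cong)
    fix t
    have "(\<integral>\<^sup>+x. indicator {0<..} t * indicator {t. ennreal t < f x} t \<partial>M) = (\<integral>\<^sup>+x. indicator {0<..} t * indicator {x \<in> space M. ennreal t < f x} x \<partial>M)"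
      by (rule nn_integral_cong) (auto simp: indicator_def)
    also have "\<dots> = indicator {0<..} t * emeasure M {x \<in> space M. ennreal t < f x}"
      by (subst nn_integral_cmult_indicator) auto
    finally show "(\<integral>\<^sup>+x. indicator {0<..} t * indicator {t. ennreal t < f x} t \<partial>M) = indicator {0<..} t * emeasure M {x \<in> space M. ennreal t < f x}" .
  qed
  finally show ?thesis .
qed

text \<open>The arithmetic-geometric mean inequality. It turns the additive inequality that
  Brunn-Minkowski gives for normalized functions into the multiplicative one.\<close>

lemma ennreal_mult_le_power2:
  fixes a b c :: ennreal
  assumes "a + b \<le> 2 * c"
  shows "a * b \<le> c\<^sup>2"
proof (cases "c = top")
  case False
  then obtain r where r: "c = ennreal r" "r \<ge> 0" by (cases c) auto
  have "a + b \<noteq> top" using assms r by (auto simp: top_unique ennreal_mult_eq_top_iff)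
  then obtain x y where xy: "a = ennreal x" "x \<ge> 0" "b = ennreal y" "y \<ge> 0"
    by (cases a; cases b) auto
  have "ennreal (x + y) \<le> ennreal (2 * r)" using assms xy r by (simp add: ennreal_mult)
  then have *: "x + y \<le> 2 * r" using r by (simp add: ennreal_le_iff)
  have "x * y \<le> r\<^sup>2"
  proof -
    have "4 * (x * y) = (x + y)\<^sup>2 - (x - y)\<^sup>2" by (simp add: power2_eq_square algebra_simps)
    also have "\<dots> \<le> (x + y)\<^sup>2" by simp
    also have "\<dots> \<le> (2 * r)\<^sup>2" using * xy by (intro power_mono) auto
    finally show ?thesis by (simp add: power_mult_distrib)
  qed
  then show ?thesis using xy r by (simp add: ennreal_mult[symmetric] ennreal_power ennreal_le_iff)
qed simp

lemma ennreal_power2_less_mult: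
  fixes x y :: ennreal
  assumes "ennreal t < x" "ennreal t < y" "t \<ge> 0"
  shows "(ennreal t)\<^sup>2 < x * y"
proof -
  have pos: "0 < x" "0 < y" using assms by (meson le_less_trans zero_le)+
  show ?thesis
  proof (cases "x = top \<or> y = top")
    case True
    then show ?thesis using pos \<open>t \<ge> 0\<close>
      by (auto simp: ennreal_mult_top ennreal_top_mult ennreal_power)
  next
    case False
    then obtain a b where "x = ennreal a" "a \<ge> 0" "y = ennreal b" "b \<ge> 0" by (cases x; cases y) auto
    with assms show ?thesis
      by (simp add: ennreal_less_iff ennreal_power ennreal_mult[symmetric] power2_eq_square mult_strict_mono')
  qed
qed

text \<open>When both suprema are 1, the superlevel sets of the three functions satisfy the hypothesis of
  the Brunn--Minkowski inequality at every level below 1.\<close>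

lemma prekopa_leindler_real_normalized:
  fixes f g h :: "real \<Rightarrow> ennreal"
  assumes [measurable]: "f \<in> borel_measurable borel" "g \<in> borel_measurable borel" "h \<in> borel_measurable borel"
    and f: "(SUP x. f x) = 1" and g: "(SUP x. g x) = 1"
    and le: "\<And>x y. f x * g y \<le> (h ((x + y) / 2))\<^sup>2"
  shows "(\<integral>\<^sup>+x. f x \<partial>lborel) * (\<integral>\<^sup>+x. g x \<partial>lborel) \<le> (\<integral>\<^sup>+x. h x \<partial>lborel)\<^sup>2"
proof (rule ennreal_mult_le_power2)
  have *: "indicator {0<..} t * emeasure lborel {x. ennreal t < f x} + indicator {0<..} t * emeasure lborel {x. ennreal t < g x}
      \<le> 2 * (indicator {0<..} t * emeasure lborel {x. ennreal t < h x})" for t :: real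
  proof (cases "0 < t")
    case t0: True
    show ?thesis
    proof (cases "t < 1")
      case True
      then have t1: "ennreal t < 1" using t0 ennreal_less_iff[of t 1] by simp
      have "{x. ennreal t < f x} \<noteq> {}" using t1 unfolding f[symmetric] less_SUP_iff by auto
      moreover have "{x. ennreal t < g x} \<noteq> {}" using t1 unfolding g[symmetric] less_SUP_iff by auto
      moreover have "ennreal t < h ((x + y) / 2)" if "ennreal t < f x" "ennreal t < g y" for x y
      proof (rule ccontr)
        assume "\<not> ?thesis"
        then have "h ((x + y) / 2) \<le> ennreal t" by simp
        then have "(h ((x + y) / 2))\<^sup>2 \<le> (ennreal t)\<^sup>2" by (intro power_mono) auto
        also have "\<dots> < f x * g y" by (rule ennreal_power2_less_mult[OF that]) (use t0 in simp)
        finally show False using le[of x y] by simp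
      qed
      ultimately have "emeasure lborel {x. ennreal t < f x} + emeasure lborel {x. ennreal t < g x} \<le> 2 * emeasure lborel {x. ennreal t < h x}"
        by (intro brunn_minkowski_real) auto
      then show ?thesis using t0 by simp
    next
      case False
      \<comment> \<open>From level 1 on both superlevel sets are empty. Since the suprema agree
        there is no level at which exactly one of them is empty, the situation that Brunn-Minkowski
        does not cover.\<close>
      have "f x \<le> ennreal t" for x
        by (rule order_trans[OF SUP_upper[of x UNIV f]]) (use f False in \<open>auto simp: ennreal_leI ennreal_1[symmetric] simp del: ennreal_1\<close>)
      moreover have "g x \<le> ennreal t" for x
        by (rule order_trans[OF SUP_upper[of x UNIV g]]) (use g False in \<open>auto simp: ennreal_leI ennreal_1[symmetric] simp del: ennreal_1\<close>)
      ultimately have "{x. ennreal t < f x} = {}" "{x. ennreal t < g x} = {}" by (auto simp: not_less[symmetric])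
      then show ?thesis by simp
    qed
  qed simp
  have lc: "(\<integral>\<^sup>+x. u x \<partial>lborel) = (\<integral>\<^sup>+t. indicator {0<..} t * emeasure lborel {x. ennreal t < u x} \<partial>lborel)"
    if "u \<in> borel_measurable borel" for u :: "real \<Rightarrow> ennreal"
    using nn_integral_layer_cake[of lborel u] that by (simp add: sigma_finite_lborel)
  have m [measurable]: "(\<lambda>t. emeasure lborel {x. ennreal t < u x}) \<in> borel_measurable borel"
    if [measurable]: "u \<in> borel_measurable borel" for u :: "real \<Rightarrow> ennreal"
  proof -
    have "{p \<in> space (lborel \<Otimes>\<^sub>M lborel). ennreal (fst p) < u (snd p)} \<in> sets (lborel \<Otimes>\<^sub>M lborel)" by measurable
    then have "{p. ennreal (fst p) < u (snd p)} \<in> sets (lborel \<Otimes>\<^sub>M lborel)" by (simp add: space_pair_measure)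
    then have "(\<lambda>t. emeasure lborel (Pair t -` {p. ennreal (fst p) < u (snd p)})) \<in> borel_measurable lborel"
      by (rule lborel.measurable_emeasure_Pair)
    then show ?thesis by (simp add: vimage_def)
  qed
  show "(\<integral>\<^sup>+x. f x \<partial>lborel) + (\<integral>\<^sup>+x. g x \<partial>lborel) \<le> 2 * (\<integral>\<^sup>+x. h x \<partial>lborel)"
    unfolding lc[OF assms(1)] lc[OF assms(2)] lc[OF assms(3)]
    by (subst nn_integral_add[symmetric], measurable, subst nn_integral_cmult[symmetric], measurable, rule nn_integral_mono, rule *)
qed

text \<open>Hypothesis and conclusion are homogeneous: dividing f and g by their suprema and h by
  the geometric mean of the two reduces to the normalized case.\<close>

lemma prekopa_leindler_real_bounded:
  fixes f g h :: "real \<Rightarrow> ennreal"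
  assumes [measurable]: "f \<in> borel_measurable borel" "g \<in> borel_measurable borel" "h \<in> borel_measurable borel"
    and f: "(SUP x. f x) \<noteq> top" and g: "(SUP x. g x) \<noteq> top"
    and le: "\<And>x y. f x * g y \<le> (h ((x + y) / 2))\<^sup>2"
  shows "(\<integral>\<^sup>+x. f x \<partial>lborel) * (\<integral>\<^sup>+x. g x \<partial>lborel) \<le> (\<integral>\<^sup>+x. h x \<partial>lborel)\<^sup>2"
proof (cases "(SUP x. f x) = 0 \<or> (SUP x. g x) = 0")
  case True
  then have "(\<forall>x. f x = 0) \<or> (\<forall>x. g x = 0)"
    by (metis SUP_upper UNIV_I le_zero_eq)
  then show ?thesis by (auto simp: zero_le)
next
  case False
  obtain a where a: "(SUP x. f x) = ennreal a" "a > 0"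
    using f False by (cases "SUP x. f x") (auto simp: less_le)
  obtain b where b: "(SUP x. g x) = ennreal b" "b > 0"
    using g False by (cases "SUP x. g x") (auto simp: less_le)
  \<comment> \<open>The geometric mean, because h enters squared against the product of f and
    g.\<close>
  define c where "c = sqrt (a * b)"
  have c: "c > 0" "c\<^sup>2 = a * b" using a b by (auto simp: c_def)
  have cc: "ennreal (1/c)^2 = ennreal (1/a) * ennreal (1/b)"
    using a b c by (simp add: ennreal_power power_divide ennreal_mult[symmetric])
  have "(\<integral>\<^sup>+x. ennreal (1/a) * f x \<partial>lborel) * (\<integral>\<^sup>+x. ennreal (1/b) * g x \<partial>lborel) \<le> (\<integral>\<^sup>+x. ennreal (1/c) * h x \<partial>lborel)\<^sup>2"
  proof (rule prekopa_leindler_real_normalized)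
    show "(SUP x. ennreal (1/a) * f x) = 1"
      using a by (simp add: SUP_mult_left_ennreal[symmetric] ennreal_mult[symmetric])
    show "(SUP x. ennreal (1/b) * g x) = 1"
      using b by (simp add: SUP_mult_left_ennreal[symmetric] ennreal_mult[symmetric])
    fix x y
    have "ennreal (1/a) * f x * (ennreal (1/b) * g y) = ennreal (1/c)^2 * (f x * g y)"
      by (simp add: cc ac_simps)
    also have "\<dots> \<le> ennreal (1/c)^2 * (h ((x + y) / 2))\<^sup>2" by (intro mult_left_mono le) auto
    finally show "ennreal (1/a) * f x * (ennreal (1/b) * g y) \<le> (ennreal (1/c) * h ((x + y) / 2))\<^sup>2"
      by (simp add: power_mult_distrib)
  qed auto
  moreover have cm: "(\<integral>\<^sup>+x. ennreal k * u x \<partial>lborel) = ennreal k * (\<integral>\<^sup>+x. u x \<partial>lborel)"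
    if "u \<in> borel_measurable borel" for k :: real and u :: "real \<Rightarrow> ennreal"
    using that by (intro nn_integral_cmult) simp
  ultimately have "(ennreal (1/a) * (\<integral>\<^sup>+x. f x \<partial>lborel)) * (ennreal (1/b) * (\<integral>\<^sup>+x. g x \<partial>lborel)) \<le> (ennreal (1/c) * (\<integral>\<^sup>+x. h x \<partial>lborel))\<^sup>2"
    by (simp only: cm assms(1-3))
  then have *: "ennreal (1/c)^2 * ((\<integral>\<^sup>+x. f x \<partial>lborel) * (\<integral>\<^sup>+x. g x \<partial>lborel)) \<le> ennreal (1/c)^2 * (\<integral>\<^sup>+x. h x \<partial>lborel)\<^sup>2"
    unfolding power_mult_distrib cc by (simp add: ac_simps)
  have "ennreal (1/c)^2 \<noteq> 0" "ennreal (1/c)^2 \<noteq> top" using c by (auto simp: ennreal_power)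
  then show ?thesis using * by (simp add: ennreal_mult_le_mult_iff)
qed

text \<open>Cutting f and g off at a finite height only lowers the left side of the hypothesis;
  monotone convergence then removes the two cut-offs independently.\<close>

lemma prekopa_leindler_real:
  fixes f g h :: "real \<Rightarrow> ennreal"
  assumes [measurable]: "f \<in> borel_measurable borel" "g \<in> borel_measurable borel" "h \<in> borel_measurable borel"
    and le: "\<And>x y. f x * g y \<le> (h ((x + y) / 2))\<^sup>2"
  shows "(\<integral>\<^sup>+x. f x \<partial>lborel) * (\<integral>\<^sup>+x. g x \<partial>lborel) \<le> (\<integral>\<^sup>+x. h x \<partial>lborel)\<^sup>2"
proof -
  have tr: "(\<integral>\<^sup>+x. u x \<partial>lborel) = (SUP n::nat. \<integral>\<^sup>+x. min (u x) (of_nat n) \<partial>lborel)"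
    if [measurable]: "u \<in> borel_measurable borel" for u :: "real \<Rightarrow> ennreal"
  proof (subst nn_integral_monotone_convergence_SUP[symmetric])
    show "incseq (\<lambda>n x. min (u x) (of_nat n))"
      by (intro incseq_SucI le_funI min.mono order_refl of_nat_mono) simp
    have "(SUP n::nat. min (u x) (of_nat n)) = u x" for x
      by (simp add: inf_min[symmetric] inf_SUP[symmetric] ennreal_SUP_of_nat_eq_top)
    then show "integral\<^sup>N lborel u = (\<integral>\<^sup>+x. (SUP n::nat. min (u x) (of_nat n)) \<partial>lborel)" by simp
  qed simp
  have le_nm: "(\<integral>\<^sup>+x. min (f x) (of_nat n) \<partial>lborel) * (\<integral>\<^sup>+x. min (g x) (of_nat m) \<partial>lborel) \<le> (\<integral>\<^sup>+x. h x \<partial>lborel)\<^sup>2"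
    for n m :: nat
  proof (rule prekopa_leindler_real_bounded)
    have "(SUP x. min (u x) (of_nat n)) \<le> (of_nat n :: ennreal)" for u :: "real \<Rightarrow> ennreal" and n
      by (rule SUP_least) simp
    then show "(SUP x. min (f x) (of_nat n)) \<noteq> top" "(SUP x. min (g x) (of_nat m)) \<noteq> top"
      by (metis neq_top_trans ennreal_of_nat_neq_top)+
    fix x y
    have "min (f x) (of_nat n) * min (g y) (of_nat m) \<le> f x * g y" by (intro mult_mono) auto
    then show "min (f x) (of_nat n) * min (g y) (of_nat m) \<le> (h ((x + y) / 2))\<^sup>2"
      using le by (rule order_trans)
  qed auto
  show ?thesis
    unfolding tr[OF assms(1)] tr[OF assms(2)]
    by (subst SUP_mult_right_ennreal, rule SUP_least, subst SUP_mult_left_ennreal, rule SUP_least, rule le_nm)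
qed

text \<open>The hypothesis passes to the marginals: for fixed remaining coordinates it is the hypothesis
  of the one-dimensional inequality for the last coordinate.\<close>

lemma prekopa_leindler_PiM:
  fixes f g h :: "('i \<Rightarrow> real) \<Rightarrow> ennreal"
  assumes "finite I"
    and "f \<in> borel_measurable (Pi\<^sub>M I (\<lambda>_. lborel))" "g \<in> borel_measurable (Pi\<^sub>M I (\<lambda>_. lborel))"
      "h \<in> borel_measurable (Pi\<^sub>M I (\<lambda>_. lborel))"
    and "\<And>x y. x \<in> extensional I \<Longrightarrow> y \<in> extensional I \<Longrightarrow> f x * g y \<le> (h (\<lambda>i\<in>I. (x i + y i) / 2))\<^sup>2"
  shows "(\<integral>\<^sup>+x. f x \<partial>Pi\<^sub>M I (\<lambda>_. lborel)) * (\<integral>\<^sup>+x. g x \<partial>Pi\<^sub>M I (\<lambda>_. lborel))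
    \<le> (\<integral>\<^sup>+x. h x \<partial>Pi\<^sub>M I (\<lambda>_. lborel))\<^sup>2"
  using assms
proof (induction I arbitrary: f g h rule: finite_induct)
  interpret product_sigma_finite "\<lambda>_::'i. lborel :: real measure" ..
  case empty
  \<comment> \<open>The product over no coordinates has one point, and the claim is the hypothesis
    at this point.\<close>
  have "(\<lambda>i\<in>{}. (u i + v i) / 2) = (\<lambda>_. undefined)" for u v :: "'i \<Rightarrow> real" by auto
  then show ?case using empty.prems(4)[of "\<lambda>_. undefined" "\<lambda>_. undefined"]
    by (simp add: nn_integral_empty)
next
  interpret product_sigma_finite "\<lambda>_::'i. lborel :: real measure" ..
  case (insert i I)
  note [simp] = insert.hyps and [measurable] = insert.prems(1-3)
  have ins: "(\<integral>\<^sup>+x. u x \<partial>Pi\<^sub>M (insert i I) (\<lambda>_. lborel)) = (\<integral>\<^sup>+x. \<integral>\<^sup>+t. u (x(i := t)) \<partial>lborel \<partial>Pi\<^sub>M I (\<lambda>_. lborel))"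
    if "u \<in> borel_measurable (Pi\<^sub>M (insert i I) (\<lambda>_. lborel))" for u :: "('i \<Rightarrow> real) \<Rightarrow> ennreal"
    using that by (intro product_nn_integral_insert) auto
  have meas [measurable]: "(\<lambda>p. u ((fst p)(i := snd p))) \<in> borel_measurable (Pi\<^sub>M I (\<lambda>_. lborel) \<Otimes>\<^sub>M lborel)"
    if "u \<in> borel_measurable (Pi\<^sub>M (insert i I) (\<lambda>_. lborel))" for u :: "('i \<Rightarrow> real) \<Rightarrow> ennreal"
    using measurable_compose[OF measurable_add_dim that] by (simp add: case_prod_unfold)
  have marg: "(\<lambda>x. \<integral>\<^sup>+t. u (x(i := t)) \<partial>lborel) \<in> borel_measurable (Pi\<^sub>M I (\<lambda>_. lborel))"
    if "u \<in> borel_measurable (Pi\<^sub>M (insert i I) (\<lambda>_. lborel))" for u :: "('i \<Rightarrow> real) \<Rightarrow> ennreal"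
    using lborel.borel_measurable_nn_integral[of "\<lambda>x t. u (x(i := t))"] meas[OF that] by (simp add: case_prod_unfold)
  have sec [measurable]: "(\<lambda>t. u (x(i := t))) \<in> borel_measurable borel"
    if "x \<in> extensional I" "u \<in> borel_measurable (Pi\<^sub>M (insert i I) (\<lambda>_. lborel))" for u :: "('i \<Rightarrow> real) \<Rightarrow> ennreal" and x
    using measurable_compose[OF measurable_Pair1' meas[OF that(2)], of x] that(1)
    by (simp add: space_PiM PiE_def)
  show ?case unfolding ins[OF insert.prems(1)] ins[OF insert.prems(2)] ins[OF insert.prems(3)]
  proof (rule insert.IH)
    fix x y :: "'i \<Rightarrow> real" assume x: "x \<in> extensional I" and y: "y \<in> extensional I"
    let ?m = "\<lambda>i\<in>I. (x i + y i) / 2"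
    show "(\<integral>\<^sup>+t. f (x(i := t)) \<partial>lborel) * (\<integral>\<^sup>+t. g (y(i := t)) \<partial>lborel) \<le> (\<integral>\<^sup>+t. h (?m(i := t)) \<partial>lborel)\<^sup>2"
    proof (rule prekopa_leindler_real)
      fix s t :: real
      have "x(i := s) \<in> extensional (insert i I)" "y(i := t) \<in> extensional (insert i I)"
        using x y by (auto simp: extensional_def)
      from insert.prems(4)[OF this]
      have "f (x(i := s)) * g (y(i := t)) \<le> (h (\<lambda>j\<in>insert i I. ((x(i := s)) j + (y(i := t)) j) / 2))\<^sup>2" .
      also have "(\<lambda>j\<in>insert i I. ((x(i := s)) j + (y(i := t)) j) / 2) = ?m(i := (s + t) / 2)"
        by (auto simp: fun_eq_iff)
      finally show "f (x(i := s)) * g (y(i := t)) \<le> (h (?m(i := (s + t) / 2)))\<^sup>2" .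
    qed (fact sec[OF x insert.prems(1)] sec[OF y insert.prems(2)] sec[OF restrict_extensional insert.prems(3)])+
  qed (fact marg[OF insert.prems(1)] marg[OF insert.prems(2)] marg[OF insert.prems(3)])+
qed

section \<open>A dimension-free Poincare inequality for smooth functions\<close>

text \<open>The Lagrange remainder is exp t / 6 * s^3 with |t| at most 1, and exp 1 is at most 3;
  the factor 1 in front of the cubic term is generous.\<close>

lemma exp_cubic_bounds:
  fixes s :: real assumes "\<bar>s\<bar> \<le> 1"
  shows "1 + s + s\<^sup>2 / 2 - \<bar>s\<bar>^3 \<le> exp s" "exp s \<le> 1 + s + s\<^sup>2 / 2 + \<bar>s\<bar>^3"
proof -
  obtain t where t: "\<bar>t\<bar> \<le> \<bar>s\<bar>" "exp s = (\<Sum>m<3. (s ^ m) / fact m) + exp t / fact 3 * s ^ 3"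
    using Maclaurin_exp_le[of s 3] by blast
  have "exp t \<le> exp 1" using t assms by simp
  also have "\<dots> \<le> 3" by (rule exp_le)
  finally have "exp t / fact 3 \<le> 1" by (simp add: fact_numeral)
  then have "\<bar>exp t / fact 3 * s ^ 3\<bar> \<le> 1 * \<bar>s\<bar>^3"
    unfolding abs_mult power_abs by (intro mult_right_mono) auto
  then show "1 + s + s\<^sup>2 / 2 - \<bar>s\<bar>^3 \<le> exp s" "exp s \<le> 1 + s + s\<^sup>2 / 2 + \<bar>s\<bar>^3"
    using t(2) by (auto simp: eval_nat_numeral abs_le_iff)
qed

text \<open>Second order expansion at \<open>\<epsilon> = 0\<close> of a functional inequality: the zeroth and first order
  terms agree on both sides.\<close>

lemma variance_le_of_exp_integral_le:
  fixes f T :: "'a \<Rightarrow> real"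
  assumes "finite_measure M" and [measurable]: "f \<in> borel_measurable M" "T \<in> borel_measurable M"
    and fB: "\<And>x. x \<in> space M \<Longrightarrow> \<bar>f x\<bar> \<le> B" and TB: "\<And>x. x \<in> space M \<Longrightarrow> \<bar>T x\<bar> \<le> B"
    and mean: "(LINT x|M. f x) = 0"
    and ev: "\<forall>\<^sub>F \<epsilon> in at_right 0. (LINT x|M. exp (\<epsilon> * f x)) * measure M (space M)
               \<le> (LINT x|M. exp (\<epsilon> * f x / 2 + \<epsilon>\<^sup>2 * T x))\<^sup>2"
  shows "(LINT x|M. (f x)\<^sup>2) \<le> 8 * (LINT x|M. T x)"
proof -
  interpret finite_measure M by fact
  define m a t where "m = measure M (space M)" and "a = (LINT x|M. (f x)\<^sup>2)" and "t = (LINT x|M. T x)"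
  \<comment> \<open>A bound of at least 1 allows all error terms to be majorized by multiples of
    \<open>B'^3\<close>.\<close>
  define B' where "B' = max B 1"
  have B': "B' \<ge> 1" "\<And>x. x \<in> space M \<Longrightarrow> \<bar>f x\<bar> \<le> B'" "\<And>x. x \<in> space M \<Longrightarrow> \<bar>T x\<bar> \<le> B'"
    using fB TB by (force simp: B'_def)+
  have int_bd: "integrable M u" if "u \<in> borel_measurable M" "\<And>x. x \<in> space M \<Longrightarrow> \<bar>u x\<bar> \<le> c" for u :: "'a \<Rightarrow> real" and c
    by (rule integrable_const_bound[of _ c]) (use that in auto)
  have [simp]: "integrable M f" "integrable M T" by (rule int_bd[of _ B']; use B' in auto)+
  have f2: "\<bar>(f x)\<^sup>2\<bar> \<le> B'\<^sup>2" if "x \<in> space M" for x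
    using B'(2)[OF that] by (simp add: abs_le_square_iff[symmetric])
  have [simp]: "integrable M (\<lambda>x. (f x)\<^sup>2)" by (rule int_bd[of _ "B'\<^sup>2"]) (use f2 in auto)
  have m0: "m \<ge> 0" by (simp add: m_def)
  \<comment> \<open>Both sides expanded to second order with explicit cubic errors. The a / 8 comes
    from (f / 2)^2 / 2. The 10 has room for 8, from the cubic remainder with exponent at most 2 *
    \<open>\<epsilon>\<close> * \<open>B'\<close>, and for 1, from the mixed and quartic terms of
    half the square.\<close>
  have key: "(m + \<epsilon>\<^sup>2 * a / 2 - \<epsilon>^3 * (B'^3 * m)) * m
      \<le> (m + \<epsilon>\<^sup>2 * (a / 8 + t) + \<epsilon>^3 * (10 * B'^3 * m))\<^sup>2"
    if \<epsilon>: "0 < \<epsilon>" "\<epsilon> * (2 * B') \<le> 1"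
      and le: "(LINT x|M. exp (\<epsilon> * f x)) * measure M (space M) \<le> (LINT x|M. exp (\<epsilon> * f x / 2 + \<epsilon>\<^sup>2 * T x))\<^sup>2" for \<epsilon>
  proof -
    have \<epsilon>1: "\<epsilon> \<le> 1" using \<epsilon> B'(1) by (smt (verit) mult_le_cancel_left1)
    let ?s = "\<lambda>x. \<epsilon> * f x / 2 + \<epsilon>\<^sup>2 * T x"
    have s1: "\<bar>\<epsilon> * f x\<bar> \<le> \<epsilon> * B'" "\<bar>?s x\<bar> \<le> \<epsilon> * (2 * B')" if x: "x \<in> space M" for x
    proof -
      show 1: "\<bar>\<epsilon> * f x\<bar> \<le> \<epsilon> * B'" using B'(2)[OF x] \<epsilon> by (simp add: abs_mult)
      have "\<bar>\<epsilon>\<^sup>2 * T x\<bar> \<le> \<epsilon> * B'"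
      proof -
        have "\<bar>\<epsilon>\<^sup>2 * T x\<bar> = \<epsilon> * (\<epsilon> * \<bar>T x\<bar>)" using \<epsilon> by (simp add: abs_mult power2_eq_square)
        also have "\<dots> \<le> \<epsilon> * (1 * B')" using \<epsilon> \<epsilon>1 B'(3)[OF x] by (intro mult_left_mono mult_mono) auto
        finally show ?thesis by simp
      qed
      with 1 show "\<bar>?s x\<bar> \<le> \<epsilon> * (2 * B')" by linarith
    qed
    have lo: "1 + \<epsilon> * f x + \<epsilon>\<^sup>2 / 2 * (f x)\<^sup>2 - \<epsilon>^3 * B'^3 \<le> exp (\<epsilon> * f x)" if x: "x \<in> space M" for x
    proof -
      have "\<bar>\<epsilon> * f x\<bar> \<le> 1" using s1(1)[OF x] \<epsilon> B'(1) by (smt (verit) mult_left_mono)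
      moreover have "\<bar>\<epsilon> * f x\<bar>^3 \<le> (\<epsilon> * B')^3" by (rule power_mono[OF s1(1)[OF x]]) simp
      ultimately show ?thesis using exp_cubic_bounds(1)[of "\<epsilon> * f x"] by (simp add: power_mult_distrib)
    qed
    have ab: "a * b \<le> B' * B'" if "\<bar>a\<bar> \<le> B'" "\<bar>b\<bar> \<le> B'" for a b :: real
      using abs_ge_self[of "a * b"] mult_mono[OF that] B'(1) by (simp add: abs_mult)
    have hi: "exp (?s x) \<le> 1 + \<epsilon> / 2 * f x + \<epsilon>\<^sup>2 * T x + \<epsilon>\<^sup>2 / 8 * (f x)\<^sup>2 + \<epsilon>^3 * (10 * B'^3)" if x: "x \<in> space M" for x
    proof -
      have 1: "\<bar>?s x\<bar> \<le> 1" using s1(2)[OF x] \<epsilon> by simp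
      have 2: "\<bar>?s x\<bar>^3 \<le> (\<epsilon> * (2 * B'))^3" by (rule power_mono[OF s1(2)[OF x]]) simp
      have "(?s x)\<^sup>2 = \<epsilon>\<^sup>2 / 4 * (f x)\<^sup>2 + \<epsilon>^3 * (f x * T x) + \<epsilon>^3 * (\<epsilon> * (T x * T x))"
        by (simp add: power2_eq_square power3_eq_cube algebra_simps)
      moreover have "f x * T x \<le> B' * B'"
        by (rule ab) (use B'(2,3)[OF x] in auto)
      moreover have "\<epsilon> * (T x * T x) \<le> 1 * (B' * B')"
        using B'(3)[OF x] \<epsilon> \<epsilon>1 ab by (intro mult_mono[of \<epsilon> 1]) auto
      moreover have "B' * B' \<le> B'^3"
        using B'(1) by (simp add: power3_eq_cube mult_le_cancel_left1)
      ultimately have "\<epsilon>^3 * (f x * T x) \<le> \<epsilon>^3 * B'^3" "\<epsilon>^3 * (\<epsilon> * (T x * T x)) \<le> \<epsilon>^3 * B'^3"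
          and "(?s x)\<^sup>2 = \<epsilon>\<^sup>2 / 4 * (f x)\<^sup>2 + \<epsilon>^3 * (f x * T x) + \<epsilon>^3 * (\<epsilon> * (T x * T x))"
        using \<epsilon> by (simp_all add: mult_left_mono)
      then have "(?s x)\<^sup>2 \<le> \<epsilon>\<^sup>2 / 4 * (f x)\<^sup>2 + \<epsilon>^3 * B'^3 + \<epsilon>^3 * B'^3" by linarith
      moreover have "0 \<le> \<epsilon>^3 * B'^3" using \<epsilon>(1) B'(1) by simp
      moreover have "(\<epsilon> * (2 * B'))^3 = 8 * (\<epsilon>^3 * B'^3)" by (simp add: power_mult_distrib)
      ultimately show ?thesis using exp_cubic_bounds(2)[OF 1] 2 by (simp add: field_simps)
    qed
    have le1: "\<epsilon> * f x \<le> 1" "?s x \<le> 1" if x: "x \<in> space M" for x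
    proof -
      have "0 \<le> \<epsilon> * B'" "\<epsilon> * (2 * B') = 2 * (\<epsilon> * B')" using \<epsilon> B'(1) by auto
      then show "\<epsilon> * f x \<le> 1" "?s x \<le> 1" using s1[OF x] \<epsilon>(2) by linarith+
    qed
    have ie: "integrable M (\<lambda>x. exp (\<epsilon> * f x))"
      by (rule int_bd[of _ "exp 1"]) (use le1 in auto)
    have ie': "integrable M (\<lambda>x. exp (?s x))"
      by (rule int_bd[of _ "exp 1"]) (use le1 in auto)
    have "m + \<epsilon>\<^sup>2 * a / 2 - \<epsilon>^3 * (B'^3 * m) = (LINT x|M. 1 + \<epsilon> * f x + \<epsilon>\<^sup>2 / 2 * (f x)\<^sup>2 - \<epsilon>^3 * B'^3)"
      by (simp add: mean m_def a_def algebra_simps)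
    also have "\<dots> \<le> (LINT x|M. exp (\<epsilon> * f x))"
      by (rule integral_mono) (use ie lo in auto)
    finally have L: "(m + \<epsilon>\<^sup>2 * a / 2 - \<epsilon>^3 * (B'^3 * m)) * m \<le> (LINT x|M. exp (\<epsilon> * f x)) * m"
      using m0 by (rule mult_right_mono)
    have "(LINT x|M. exp (?s x)) \<le> (LINT x|M. 1 + \<epsilon> / 2 * f x + \<epsilon>\<^sup>2 * T x + \<epsilon>\<^sup>2 / 8 * (f x)\<^sup>2 + \<epsilon>^3 * (10 * B'^3))"
      by (rule integral_mono) (use ie' hi in auto)
    also have "\<dots> = m + \<epsilon>\<^sup>2 * (a / 8 + t) + \<epsilon>^3 * (10 * B'^3 * m)"
      by (simp add: mean m_def a_def t_def algebra_simps)
    finally have "(LINT x|M. exp (?s x))\<^sup>2 \<le> (m + \<epsilon>\<^sup>2 * (a / 8 + t) + \<epsilon>^3 * (10 * B'^3 * m))\<^sup>2"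
      by (rule power_mono) (simp add: integral_nonneg_AE)
    with L le show ?thesis by (simp add: m_def)
  qed
  define c where "c = B'^3 * m"
  have "\<forall>\<^sub>F \<epsilon> in at_right 0. m * a / 2 - \<epsilon> * c * m
      \<le> 2 * m * (a / 8 + t + \<epsilon> * (10 * c)) + \<epsilon>\<^sup>2 * (a / 8 + t + \<epsilon> * (10 * c))\<^sup>2"
  proof -
    have "\<forall>\<^sub>F \<epsilon> in at_right 0. 0 < \<epsilon> \<and> \<epsilon> < 1 / (2 * B')"
      using B'(1) by (intro eventually_conj eventually_at_right_less) (auto simp: eventually_at_right[of 0 1] intro!: exI[of _ "1 / (2 * B')"])
    then show ?thesis using ev
    proof eventually_elim
      case (elim \<epsilon>)
      then have \<epsilon>: "0 < \<epsilon>" "\<epsilon> * (2 * B') \<le> 1" using B'(1) by (auto simp: field_simps)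
      have "(m + \<epsilon>\<^sup>2 * a / 2 - \<epsilon>^3 * c) * m \<le> (m + \<epsilon>\<^sup>2 * (a / 8 + t) + \<epsilon>^3 * (10 * c))\<^sup>2"
        using key[OF \<epsilon> elim(2)] by (simp add: c_def mult.assoc)
      then have "\<epsilon>\<^sup>2 * (m * a / 2 - \<epsilon> * c * m)
          \<le> \<epsilon>\<^sup>2 * (2 * m * (a / 8 + t + \<epsilon> * (10 * c)) + \<epsilon>\<^sup>2 * (a / 8 + t + \<epsilon> * (10 * c))\<^sup>2)"
        by (simp add: power2_eq_square power3_eq_cube algebra_simps)
      then show ?case using \<epsilon> by (simp add: mult_le_cancel_left_pos)
    qed
  qed
  \<comment> \<open>After cancelling m^2 and dividing by the square of \<open>\<epsilon>\<close>,
    the limit gives m a / 2 <= 2 m (a / 8 + t), that is m (a - 8 t) <= 0.\<close>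
  then have "m * a / 2 - 0 * c * m \<le> 2 * m * (a / 8 + t + 0 * (10 * c)) + 0\<^sup>2 * (a / 8 + t + 0 * (10 * c))\<^sup>2"
    by (rule tendsto_le[rotated -1]) (intro tendsto_intros | simp)+
  then have "m * (a - 8 * t) \<le> 0" by (simp add: algebra_simps)
  \<comment> \<open>With zero total mass the factor m cannot be cancelled, but then every integral
    vanishes.\<close>
  moreover have "a = 0" "t = 0" if "m = 0"
  proof -
    have "AE x in M. False"
      by (rule AE_I'[of "space M"]) (use that in \<open>auto simp: null_sets_def emeasure_eq_measure m_def\<close>)
    then show "a = 0" "t = 0" unfolding a_def t_def by (auto intro: integral_eq_zero_AE)
  qed
  ultimately have "a - 8 * t \<le> 0" using m0 by (cases "m = 0") (auto simp: mult_le_0_iff)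
  then show ?thesis by (simp add: a_def t_def)
qed

text \<open>The Gaussian weight has \<open>2R\<^sup>2\<close>-uniformly convex potential; at a midpoint it gains
  a negative multiple of \<open>|x - y|\<^sup>2\<close>, which absorbs the first order term of the Taylor expansion of \<open>f\<close>.\<close>

lemma gaussian_poincare_convex:
  fixes f :: "(nat \<Rightarrow> real) \<Rightarrow> real" and g :: "nat \<Rightarrow> (nat \<Rightarrow> real) \<Rightarrow> real"
  assumes R: "R > 0" and A [measurable]: "A \<in> sets (lebP d)" and cvx: "econvex d A" and fin: "emeasure (lebP d) A < \<infinity>"
    and [measurable]: "f \<in> borel_measurable (lebP d)" "\<And>i. i < d \<Longrightarrow> g i \<in> borel_measurable (lebP d)"
    and fB: "\<And>x. x \<in> A \<Longrightarrow> \<bar>f x\<bar> \<le> B" and gB: "\<And>x i. x \<in> A \<Longrightarrow> i < d \<Longrightarrow> \<bar>g i x\<bar> \<le> B"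
    and taylor: "\<And>x y. x \<in> A \<Longrightarrow> y \<in> A \<Longrightarrow>
      f y \<le> f x + (\<Sum>i<d. g i x * (y i - x i)) + K * sqdist d y x"
    and mu: "\<mu> = density (lebP d) (\<lambda>x. ennreal (indicator A x * exp (- sqdist d x c / (2 * R\<^sup>2))))"
    and mean: "(LINT x|\<mu>. f x) = 0"
  shows "(LINT x|\<mu>. (f x)\<^sup>2) \<le> R\<^sup>2 * (LINT x|\<mu>. (\<Sum>i<d. (g i x)\<^sup>2))"
proof -
  let ?V = "\<lambda>x. sqdist d x c / (2 * R\<^sup>2)"
  let ?w = "\<lambda>x. ennreal (indicator A x * exp (- sqdist d x c / (2 * R\<^sup>2)))"
  let ?S = "\<lambda>x. \<Sum>i<d. (g i x)\<^sup>2"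
  have Asp: "A \<subseteq> extensional {..<d}" using sets.sets_into_space[OF A] by (auto simp: space_PiM PiE_def)
  have [measurable]: "?V \<in> borel_measurable (lebP d)" by measurable
  have [measurable_cong]: "sets \<mu> = sets (lebP d)" by (simp add: mu)
  have spmu: "space \<mu> = space (lebP d)" by (simp add: mu)
  have wm [measurable]: "?w \<in> borel_measurable (lebP d)" by measurable
  have "emeasure \<mu> (space \<mu>) = (\<integral>\<^sup>+x. ?w x * indicator (space (lebP d)) x \<partial>lebP d)"
    unfolding mu by (subst emeasure_density) auto
  also have "\<dots> \<le> (\<integral>\<^sup>+x. indicator A x \<partial>lebP d)"
    by (intro nn_integral_mono) (auto simp: indicator_def ennreal_le_1 sum_nonneg)
  also have "\<dots> < \<infinity>" using fin by simp
  finally have fm: "finite_measure \<mu>" by (intro finite_measureI) auto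
  interpret finite_measure \<mu> by (rule fm)
  \<comment> \<open>\<open>f\<close> and \<open>g i\<close> are bounded on A only, whereas the
    expansion asks for bounds on the whole space. As \<open>\<mu>\<close> lives on A, cutting off
    changes no integral.\<close>
  define f' where "f' = (\<lambda>x. indicator A x * f x)"
  have [measurable]: "f' \<in> borel_measurable (lebP d)" unfolding f'_def by measurable
  define S where "S = (\<lambda>x. indicator A x * ?S x)"
  have [measurable]: "S \<in> borel_measurable (lebP d)" unfolding S_def by measurable
  have AEA: "AE x in \<mu>. x \<in> A"
    unfolding mu by (subst AE_density[OF wm]) (auto simp: indicator_def)
  have S0: "S x \<ge> 0" for x by (auto simp: S_def indicator_def intro!: sum_nonneg)
  have SB: "S x \<le> d * B\<^sup>2" for x
  proof (cases "x \<in> A")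
    case True
    have "?S x \<le> (\<Sum>i<d. B\<^sup>2)"
      by (intro sum_mono) (use gB[OF True] in \<open>auto simp: abs_le_square_iff[symmetric] intro: order_trans[OF _ abs_ge_self]\<close>)
    then show ?thesis using True by (simp add: S_def)
  qed (simp add: S_def)
  \<comment> \<open>Every q above R^2 leaves the slack 1 / R^2 - 1 / q, which absorbs the Taylor
    error \<open>\<epsilon>\<close> * K once \<open>\<epsilon>\<close> is small. At the end q tends
    to R^2.\<close>
  have "(LINT x|\<mu>. (f' x)\<^sup>2) \<le> q * (LINT x|\<mu>. S x)" if q: "q > R\<^sup>2" for q
  proof -
    have q0: "q > 0" using q by (smt (verit) zero_le_power2)
    have "(LINT x|\<mu>. (f' x)\<^sup>2) \<le> 8 * (LINT x|\<mu>. q / 8 * S x)"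
    proof (rule variance_le_of_exp_integral_le[OF fm, where B = "max B (q / 8 * (d * B\<^sup>2))"])
      show "\<bar>f' x\<bar> \<le> max B (q / 8 * (d * B\<^sup>2))" for x
        using fB[of x] q0 by (cases "x \<in> A") (auto simp: f'_def le_max_iff_disj)
      show "\<bar>q / 8 * S x\<bar> \<le> max B (q / 8 * (d * B\<^sup>2))" for x
        using SB[of x] S0[of x] q0 by (auto simp: abs_mult le_max_iff_disj intro!: mult_left_mono)
      have "(LINT x|\<mu>. f' x) = (LINT x|\<mu>. f x)"
        by (rule integral_cong_AE) (use AEA in \<open>auto simp: f'_def\<close>)
      then show "(LINT x|\<mu>. f' x) = 0" using mean by simp
      have lim: "((\<lambda>\<epsilon>. 1 / R\<^sup>2 - \<epsilon> * K) \<longlongrightarrow> 1 / R\<^sup>2 - 0 * K) (at_right 0)"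
        by (intro tendsto_intros)
      have "1 / q < 1 / R\<^sup>2 - 0 * K" using q R q0 by (simp add: divide_simps)
      from order_tendstoD(1)[OF lim this] have "\<forall>\<^sub>F \<epsilon> in at_right 0. 1 / q < 1 / R\<^sup>2 - \<epsilon> * K" .
      moreover have "\<forall>\<^sub>F \<epsilon> in at_right (0::real). 0 < \<epsilon>" by (rule eventually_at_right_less)
      ultimately show "\<forall>\<^sub>F \<epsilon> in at_right 0. (LINT x|\<mu>. exp (\<epsilon> * f' x)) * measure \<mu> (space \<mu>)
               \<le> (LINT x|\<mu>. exp (\<epsilon> * f' x / 2 + \<epsilon>\<^sup>2 * (q / 8 * S x)))\<^sup>2"
      proof eventually_elim
        case (elim \<epsilon>)
        let ?E = "\<lambda>x. \<epsilon> * f' x / 2 + \<epsilon>\<^sup>2 * (q / 8 * S x)"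
        \<comment> \<open>The logarithm of the Prekopa-Leindler hypothesis, weight included. The
          convexity gain |x - z|^2 / R^2 pays for the term |x - z|^2 / q of Young's inequality and
          for the Taylor error at z.\<close>
        have pt: "\<epsilon> * f' x - ?V x - ?V y \<le> 2 * (?E z - ?V z)"
          if xy: "x \<in> A" "y \<in> A" and z: "z = (\<lambda>i\<in>{..<d}. (x i + y i) / 2)" "z \<in> A" for x y z
        proof -
          have "?V x + ?V y - 2 * ?V z = sqdist d x z / R\<^sup>2"
          proof -
            have "(x i - c i)\<^sup>2 + (y i - c i)\<^sup>2 - 2 * (z i - c i)\<^sup>2 = 2 * (x i - z i)\<^sup>2" if "i < d" for i
              using that by (simp add: z(1) power2_eq_square field_simps)
            then have "sqdist d x c + sqdist d y c - 2 * sqdist d z c = 2 * sqdist d x z"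
              by (simp add: sum_distrib_left sum.distrib[symmetric] sum_subtractf[symmetric])
            then show ?thesis using R by (simp add: field_simps)
          qed
          moreover have "\<epsilon> * f x \<le> \<epsilon> * f z + (\<Sum>i<d. \<epsilon> * (g i z * (x i - z i))) + \<epsilon> * K * sqdist d x z"
            using mult_left_mono[OF taylor[OF z(2) xy(1)], of \<epsilon>] elim by (simp add: algebra_simps sum_distrib_left)
          \<comment> \<open>Young's inequality weighted by q. Its coefficient q / 4 is twice the q /
            8 in \<open>?E\<close>, in accordance with the factor 2 of the midpoint term; the q / 8
            in turn cancels the 8 of the expansion lemma.\<close>
          moreover have "(\<Sum>i<d. \<epsilon> * (g i z * (x i - z i))) \<le> (\<Sum>i<d. \<epsilon>\<^sup>2 * q / 4 * (g i z)\<^sup>2 + 1 / q * (x i - z i)\<^sup>2)"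
          proof (rule sum_mono)
            fix i
            have "0 \<le> (\<epsilon> * q / 2 * g i z - (x i - z i))\<^sup>2 / q" using q0 by simp
            then show "\<epsilon> * (g i z * (x i - z i)) \<le> \<epsilon>\<^sup>2 * q / 4 * (g i z)\<^sup>2 + 1 / q * (x i - z i)\<^sup>2"
              using q0 by (simp add: power2_eq_square field_simps)
          qed
          moreover have "\<dots> = \<epsilon>\<^sup>2 * q / 4 * ?S z + 1 / q * sqdist d x z"
            by (simp add: sum.distrib sum_distrib_left)
          moreover have "1 / q * sqdist d x z \<le> (1 / R\<^sup>2 - \<epsilon> * K) * sqdist d x z"
            using elim by (intro mult_right_mono sum_nonneg) auto
          ultimately have "\<epsilon> * f x - ?V x - ?V y \<le> \<epsilon> * f z + \<epsilon>\<^sup>2 * q / 4 * ?S z - 2 * ?V z"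
            by (simp add: algebra_simps)
          moreover have "f' x = f x" "f' z = f z" "S z = ?S z"
            using xy z(2) by (auto simp: f'_def S_def)
          ultimately show ?thesis by (simp add: ac_simps)
        qed
        \<comment> \<open>The density is carried by the three functions, so that the inequality for
          Lebesgue measure applies. The left side vanishes unless both points lie in A, and then
          convexity puts their midpoint into A.\<close>
        have PL: "(\<integral>\<^sup>+x. ?w x * exp (\<epsilon> * f' x) \<partial>lebP d) * (\<integral>\<^sup>+x. ?w x \<partial>lebP d) \<le> (\<integral>\<^sup>+x. ?w x * exp (?E x) \<partial>lebP d)\<^sup>2"
        proof (rule prekopa_leindler_PiM)
          fix x y :: "nat \<Rightarrow> real"
          let ?z = "\<lambda>i\<in>{..<d}. (x i + y i) / 2"
          show "?w x * exp (\<epsilon> * f' x) * ?w y \<le> (?w ?z * exp (?E ?z))\<^sup>2"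
          proof (cases "x \<in> A \<and> y \<in> A")
            case True
            have "(\<lambda>i\<in>{..<d}. (1 - 1/2) * x i + 1/2 * y i) \<in> A"
              by (rule cvx[unfolded econvex_def, rule_format]) (use True in auto)
            also have "(\<lambda>i\<in>{..<d}. (1 - 1/2) * x i + 1/2 * y i) = ?z" by (auto simp: field_simps)
            finally have z: "?z \<in> A" .
            have "exp (- ?V x) * exp (\<epsilon> * f' x) * exp (- ?V y) = exp (\<epsilon> * f' x - ?V x - ?V y)"
              by (simp add: exp_add[symmetric] algebra_simps)
            also have "\<dots> \<le> exp (2 * (?E ?z - ?V ?z))" using pt[OF _ _ refl z] True by simp
            also have "\<dots> = (exp (- ?V ?z) * exp (?E ?z))\<^sup>2"
              by (simp add: power2_eq_square exp_add[symmetric] algebra_simps)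
            finally show ?thesis using True z by (simp add: ennreal_mult[symmetric] ennreal_power ennreal_leI)
          qed auto
        qed auto
        have bd: "\<bar>f' x\<bar> \<le> \<bar>B\<bar>" for x
          using fB[of x] by (cases "x \<in> A") (auto simp: f'_def)
        have e1: "exp (\<epsilon> * f' x) \<le> exp (\<epsilon> * \<bar>B\<bar>)" for x
          using bd[of x] elim by (auto intro!: mult_left_mono)
        have e2: "exp (?E x) \<le> exp (\<epsilon> * \<bar>B\<bar> / 2 + \<epsilon>\<^sup>2 * (q / 8 * (d * B\<^sup>2)))" for x
          using bd[of x] elim SB[of x] q0 by (auto intro!: mult_left_mono add_mono)
        have i1: "integrable \<mu> (\<lambda>x. exp (\<epsilon> * f' x))"
          by (rule integrable_const_bound[of _ "exp (\<epsilon> * \<bar>B\<bar>)"]) (use e1 in auto)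
        have i2: "integrable \<mu> (\<lambda>x. exp (?E x))"
          by (rule integrable_const_bound[of _ "exp (\<epsilon> * \<bar>B\<bar> / 2 + \<epsilon>\<^sup>2 * (q / 8 * (d * B\<^sup>2)))"]) (use e2 in auto)
        have "(\<integral>\<^sup>+x. exp (\<epsilon> * f' x) \<partial>\<mu>) * (\<integral>\<^sup>+x. 1 \<partial>\<mu>) \<le> (\<integral>\<^sup>+x. exp (?E x) \<partial>\<mu>)\<^sup>2"
          using PL unfolding mu by (simp add: nn_integral_density del: nn_integral_const)
        then have "ennreal (LINT x|\<mu>. exp (\<epsilon> * f' x)) * ennreal (measure \<mu> (space \<mu>)) \<le> ennreal (LINT x|\<mu>. exp (?E x)) ^ 2"
          using i1 i2 by (simp add: nn_integral_eq_integral emeasure_eq_measure)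
        then show ?case
          by (simp add: ennreal_mult[symmetric] ennreal_power integral_nonneg_AE)
      qed
    qed auto
    then show ?thesis by simp
  qed
  \<comment> \<open>The bound holds for all q above R^2 and is continuous in q.\<close>
  then have "(LINT x|\<mu>. (f' x)\<^sup>2) \<le> R\<^sup>2 * (LINT x|\<mu>. S x)"
    by (intro tendsto_lowerbound[of "\<lambda>q. q * (LINT x|\<mu>. S x)" _ "at_right (R\<^sup>2)"] tendsto_intros)
       (auto simp: eventually_at_filter)
  also have "(LINT x|\<mu>. S x) = (LINT x|\<mu>. ?S x)"
    by (rule integral_cong_AE) (use AEA in \<open>auto simp: S_def\<close>)
  also have "(LINT x|\<mu>. (f' x)\<^sup>2) = (LINT x|\<mu>. (f x)\<^sup>2)"
    by (rule integral_cong_AE) (use AEA in \<open>auto simp: f'_def\<close>)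
  finally show ?thesis .
qed

text \<open>As a function of c the right side is a quadratic polynomial with its minimum at the
  mean; the difference of the two sides is (c |A| - I)^2 / |A|. This exchanges the mean for the
  Gaussian weight against the Lebesgue mean.\<close>

lemma set_integral_diff_mean_le:
  fixes f :: "'a \<Rightarrow> real"
  assumes "set_integrable M A f" "set_integrable M A (\<lambda>x. (f x)\<^sup>2)" and A: "A \<in> sets M" "emeasure M A < \<infinity>"
  shows "(LINT x:A|M. (f x - (LINT x:A|M. f x) / measure M A)\<^sup>2) \<le> (LINT x:A|M. (f x - c)\<^sup>2)"
proof (cases "measure M A = 0")
  case True
  then have "A \<in> null_sets M" using A by (auto simp: null_sets_def measure_def enn2real_eq_0_iff)
  then have "AE x in M. x \<notin> A" by (rule AE_not_in)
  then have "(LINT x:A|M. u x) = 0" for u :: "'a \<Rightarrow> real"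
    unfolding set_lebesgue_integral_def by (intro integral_eq_zero_AE) auto
  then show ?thesis by simp
next
  case False
  define I J where "I = (LINT x:A|M. f x)" and "J = (LINT x:A|M. (f x)\<^sup>2)"
  have [simp]: "set_integrable M A (\<lambda>x. k)" for k :: real
    using A by (simp add: set_integrable_def)
  have *: "(LINT x:A|M. (f x - c)\<^sup>2) = J - 2 * c * I + c\<^sup>2 * measure M A" for c
  proof -
    have "(LINT x:A|M. (f x - c)\<^sup>2) = (LINT x:A|M. (f x)\<^sup>2 - 2 * c * f x + c\<^sup>2)"
      by (simp add: power2_eq_square algebra_simps)
    also have "\<dots> = (LINT x:A|M. (f x)\<^sup>2) - (LINT x:A|M. 2 * c * f x) + (LINT x:A|M. c\<^sup>2)"
      using assms by (subst set_integral_add set_integral_diff; simp)+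
    also have "(LINT x:A|M. 2 * c * f x) = 2 * c * I" by (simp add: I_def)
    also have "(LINT x:A|M. c\<^sup>2) = c\<^sup>2 * measure M A"
      using A by (simp add: set_lebesgue_integral_def)
    finally show ?thesis by (simp add: J_def)
  qed
  have "measure M A > 0" using False by (simp add: less_le)
  then have "0 \<le> (c * measure M A - I)\<^sup>2 / measure M A" by simp
  also have "(c * measure M A - I)\<^sup>2 / measure M A = (LINT x:A|M. (f x - c)\<^sup>2) - (LINT x:A|M. (f x - I / measure M A)\<^sup>2)"
    unfolding * using False by (simp add: power2_eq_square field_simps)
  finally show ?thesis by (simp add: I_def)
qed

text \<open>The weight is centred at a point of A. Its lower bound 1/2 on A is used for the left
  side and costs the factor 2, its upper bound 1 for the right side and costs nothing. The bounds B
  and K do not appear in the conclusion, so they may depend on the dimension.\<close>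

lemma poincare_convex_smooth:
  fixes f :: "(nat \<Rightarrow> real) \<Rightarrow> real" and g :: "nat \<Rightarrow> (nat \<Rightarrow> real) \<Rightarrow> real"
  assumes R: "R > 0" and A [measurable]: "A \<in> sets (lebP d)" and cvx: "econvex d A" and fin: "emeasure (lebP d) A < \<infinity>"
    and diam: "\<And>x y. x \<in> A \<Longrightarrow> y \<in> A \<Longrightarrow> edist d x y \<le> R"
    and fm [measurable]: "f \<in> borel_measurable (lebP d)" and gm [measurable]: "\<And>i. i < d \<Longrightarrow> g i \<in> borel_measurable (lebP d)"
    and fB: "\<And>x. x \<in> A \<Longrightarrow> \<bar>f x\<bar> \<le> B" and gB: "\<And>x i. x \<in> A \<Longrightarrow> i < d \<Longrightarrow> \<bar>g i x\<bar> \<le> B"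
    and taylor: "\<And>x y. x \<in> A \<Longrightarrow> y \<in> A \<Longrightarrow>
      f y \<le> f x + (\<Sum>i<d. g i x * (y i - x i)) + K * sqdist d y x"
  shows "(LINT x:A|lebP d. (f x - (LINT x:A|lebP d. f x) / measure (lebP d) A)\<^sup>2)
    \<le> 2 * R\<^sup>2 * (LINT x:A|lebP d. (\<Sum>i<d. (g i x)\<^sup>2))"
proof (cases "A = {}")
  case True then show ?thesis by (simp add: set_lebesgue_integral_def)
next
  case False
  then obtain c where c: "c \<in> A" by blast
  define w where "w = (\<lambda>x. exp (- sqdist d x c / (2 * R\<^sup>2)))"
  have [measurable]: "w \<in> borel_measurable (lebP d)" unfolding w_def by measurable
  have wpos: "w x > 0" for x by (simp add: w_def)
  have w1: "w x \<le> 1" for x by (simp add: w_def sum_nonneg)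
  have w2: "1 \<le> 2 * w x" if "x \<in> A" for x
  proof -
    have "sqdist d x c = (edist d x c)\<^sup>2" by (simp add: edist_def L2_set_def sum_nonneg)
    also have "\<dots> \<le> R\<^sup>2" using diam[OF that c] by (intro power_mono) (auto simp: edist_def)
    finally have "- sqdist d x c / (2 * R\<^sup>2) \<ge> - 1 / 2" using R by (simp add: field_simps)
    then have "exp (- 1 / 2) \<le> w x" by (simp add: w_def)
    \<comment> \<open>The tangent at 0 gives exp (-1/2) >= 1/2, the origin of the 2 in the
      conclusion.\<close>
    moreover have "1 \<le> 2 * exp (- 1 / 2 :: real)" using exp_ge_add_one_self[of "- 1 / 2 :: real"] by simp
    ultimately show ?thesis by linarith
  qed
  define \<mu> where "\<mu> = density (lebP d) (\<lambda>x. ennreal (indicator A x * w x))"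
  have I\<mu>: "(LINT x|\<mu>. u x) = (LINT x:A|lebP d. w x * u x)"
    if "u \<in> borel_measurable (lebP d)" for u :: "(nat \<Rightarrow> real) \<Rightarrow> real"
    unfolding \<mu>_def set_lebesgue_integral_def using that wpos
    by (subst integral_density) (auto simp: less_imp_le ac_simps)
  have bdi: "set_integrable (lebP d) A u"
    if "u \<in> borel_measurable (lebP d)" "\<And>x. x \<in> A \<Longrightarrow> \<bar>u x\<bar> \<le> k" for u :: "(nat \<Rightarrow> real) \<Rightarrow> real" and k
    unfolding set_integrable_def
    by (rule integrableI_bounded_set_indicator[where B = k]) (use that fin in auto)
  have wk: "\<bar>w x * u\<bar> \<le> k" if "\<bar>u\<bar> \<le> k" for x u k
    using mult_mono[OF w1[of x] that] wpos[of x] by (simp add: abs_mult less_imp_le)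
  \<comment> \<open>The mean with respect to \<open>\<mu>\<close>, because the Gaussian inequality
    requires a centred function; the Lebesgue mean returns by its minimality.\<close>
  define m where "m = (LINT x|\<mu>. f x) / (LINT x:A|lebP d. w x)"
  define h where "h = (\<lambda>x. f x - m)"
  have [measurable]: "h \<in> borel_measurable (lebP d)" unfolding h_def by measurable
  have h: "\<bar>h x\<bar> \<le> B + \<bar>m\<bar>" if "x \<in> A" for x using fB[OF that] by (simp add: h_def)
  define S where "S = (\<lambda>x. \<Sum>i<d. (g i x)\<^sup>2)"
  have [measurable]: "S \<in> borel_measurable (lebP d)" unfolding S_def by measurable
  have S0: "S x \<ge> 0" for x by (simp add: S_def sum_nonneg)
  have SB: "\<bar>S x\<bar> \<le> d * B\<^sup>2" if "x \<in> A" for x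
  proof -
    have "S x \<le> (\<Sum>i<d. B\<^sup>2)" unfolding S_def
      by (intro sum_mono) (use gB[OF that] in \<open>auto simp: abs_le_square_iff[symmetric] intro: order_trans[OF _ abs_ge_self]\<close>)
    then show ?thesis using S0 by simp
  qed
  have sq: "\<bar>(u::real)\<^sup>2\<bar> \<le> k\<^sup>2" if "\<bar>u\<bar> \<le> k" for u k
    using that by (simp add: abs_le_square_iff[symmetric])
  have ih: "set_integrable (lebP d) A (\<lambda>x. (h x)\<^sup>2)" by (rule bdi[of _ "(B + \<bar>m\<bar>)\<^sup>2"]) (use h sq in auto)
  have iwh: "set_integrable (lebP d) A (\<lambda>x. w x * (h x)\<^sup>2)" by (rule bdi[of _ "(B + \<bar>m\<bar>)\<^sup>2"]) (use h sq wk in auto)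
  have iS: "set_integrable (lebP d) A S" by (rule bdi[OF _ SB]) auto
  have iwS: "set_integrable (lebP d) A (\<lambda>x. w x * S x)" by (rule bdi[of _ "d * B\<^sup>2"]) (use SB wk in auto)
  have iff: "set_integrable (lebP d) A f" by (rule bdi[OF _ fB]) auto
  have iff2: "set_integrable (lebP d) A (\<lambda>x. (f x)\<^sup>2)" by (rule bdi[of _ "B\<^sup>2"]) (use fB sq in auto)
  have iw: "set_integrable (lebP d) A w" by (rule bdi[of _ 1]) (use w1 wpos in \<open>auto simp: less_imp_le\<close>)
  have iwf: "set_integrable (lebP d) A (\<lambda>x. w x * f x)" by (rule bdi[of _ B]) (use fB wk in auto)
  have mean: "(LINT x|\<mu>. h x) = 0"
  proof -
    have "(LINT x|\<mu>. h x) = (LINT x:A|lebP d. w x * f x - m * w x)"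
      by (simp add: I\<mu> h_def algebra_simps)
    also have "\<dots> = (LINT x:A|lebP d. w x * f x) - m * (LINT x:A|lebP d. w x)"
      using iwf iw by (subst set_integral_diff) auto
    also have "\<dots> = 0"
    \<comment> \<open>If the total weight is zero then A is a null set, because the weight is
      positive, and both integrals vanish.\<close>
    proof (cases "(LINT x:A|lebP d. w x) = 0")
      case True
      then have "AE x in lebP d. indicator A x * w x = 0"
        using iw wpos unfolding set_lebesgue_integral_def set_integrable_def
        by (subst integral_nonneg_eq_0_iff_AE[symmetric]) (auto simp: less_imp_le)
      then have "AE x in lebP d. x \<notin> A" using wpos by (auto simp: indicator_def split: if_splits elim!: eventually_mono) (metis less_irrefl)
      then show ?thesis unfolding set_lebesgue_integral_def
        by (subst (1 2) integral_eq_zero_AE) auto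
    next
      case False then show ?thesis by (simp add: m_def I\<mu>)
    qed
    finally show ?thesis .
  qed
  have G: "(LINT x|\<mu>. (h x)\<^sup>2) \<le> R\<^sup>2 * (LINT x|\<mu>. (\<Sum>i<d. (g i x)\<^sup>2))"
  proof (rule gaussian_poincare_convex[OF R A cvx fin, where B = "B + \<bar>m\<bar>"])
    show "\<mu> = density (lebP d) (\<lambda>x. ennreal (indicator A x * exp (- sqdist d x c / (2 * R\<^sup>2))))"
      by (simp add: \<mu>_def w_def)
    show "h y \<le> h x + (\<Sum>i<d. g i x * (y i - x i)) + K * sqdist d y x" if "x \<in> A" "y \<in> A" for x y
      using taylor[OF that] by (simp add: h_def)
    show "\<bar>g i x\<bar> \<le> B + \<bar>m\<bar>" if "x \<in> A" "i < d" for i x using gB[OF that] by simp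
  qed (use h mean in auto)
  have "(LINT x:A|lebP d. (f x - (LINT x:A|lebP d. f x) / measure (lebP d) A)\<^sup>2) \<le> (LINT x:A|lebP d. (h x)\<^sup>2)"
    unfolding h_def by (rule set_integral_diff_mean_le[OF iff iff2 A fin])
  also have "\<dots> \<le> (LINT x:A|lebP d. 2 * (w x * (h x)\<^sup>2))"
  proof (rule set_integral_mono[OF ih])
    show "(h x)\<^sup>2 \<le> 2 * (w x * (h x)\<^sup>2)" if "x \<in> A" for x
      using mult_right_mono[OF w2[OF that], of "(h x)\<^sup>2"] by simp
  qed (use iwh in simp)
  also have "\<dots> = 2 * (LINT x|\<mu>. (h x)\<^sup>2)" by (simp add: I\<mu>)
  also have "\<dots> \<le> 2 * (R\<^sup>2 * (LINT x|\<mu>. S x))" using G by (simp add: S_def)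
  also have "(LINT x|\<mu>. S x) \<le> (LINT x:A|lebP d. S x)"
    unfolding I\<mu>[OF \<open>S \<in> borel_measurable (lebP d)\<close>]
    by (rule set_integral_mono[OF iwS iS]) (use w1 S0 in \<open>auto simp: mult_left_le_one_le less_imp_le[OF wpos]\<close>)
  finally show ?thesis using R by (simp add: S_def)
qed

section \<open>Smooth bump functions and the mollification kernel\<close>

text \<open>The shape shared by all derivatives of the standard bump exp (-1 / (1 - x^2)):
  differentiation changes the polynomial and raises k by 2.\<close>

definition flat_bump :: "real poly \<Rightarrow> nat \<Rightarrow> real \<Rightarrow> real" where
  "flat_bump p k x = (if \<bar>x\<bar> < 1 then poly p x / (1 - x\<^sup>2) ^ k * exp (- 1 / (1 - x\<^sup>2)) else 0)"

text \<open>A single term of the exponential series at 1 / s suffices. This flatness makes the bump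
  smooth at the edge of its support.\<close>

lemma exp_neg_inverse_le_power:
  fixes s :: real assumes "s > 0"
  shows "exp (- 1 / s) \<le> fact n * s ^ n"
proof -
  have "(1 / s) ^ n / fact n \<le> exp (1 / s)"
    using exp_ge_one_plus_x_over_n_power_n[of n] assms sum_le_suminf[OF summable_exp_generic[of "1/s"], of "{n}"]
    by (simp add: exp_def divide_inverse mult.commute)
  then have "1 \<le> exp (1 / s) * (fact n * s ^ n)"
    using assms by (simp add: power_divide field_simps)
  then show ?thesis
    using assms by (simp add: exp_minus field_simps)
qed

lemma DERIV_zero_of_quadratic_bound:
  fixes f :: "real \<Rightarrow> real"
  assumes "\<And>y. \<bar>f y - f x\<bar> \<le> C * (y - x)\<^sup>2"
  shows "(f has_real_derivative 0) (at x)"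
  unfolding has_field_derivative_iff
proof (rule Lim_null_comparison)
  show "\<forall>\<^sub>F y in at x. norm ((f y - f x) / (y - x)) \<le> C * \<bar>y - x\<bar>"
    unfolding eventually_at_filter
    using assms by (auto simp: divide_le_eq power2_eq_square mult.assoc intro!: always_eventually)
  show "((\<lambda>y. C * \<bar>y - x\<bar>) \<longlongrightarrow> 0) (at x)"
    by (auto intro!: tendsto_eq_intros)
qed

text \<open>With s = 1 - y^2 the exponential beats the pole of order k with two powers of s to
  spare, and s = |x - y| |x + y| <= 2 |x - y|, whence the 4. The quadratic bound forces a zero
  derivative at the edge points.\<close>

lemma flat_bump_quadratic_bound:
  "\<exists>C. \<forall>x y. \<bar>x\<bar> = 1 \<longrightarrow> \<bar>flat_bump p k y\<bar> \<le> C * (y - x)\<^sup>2"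
proof -
  have "compact (poly p ` {-1..1})" by (intro compact_continuous_image continuous_intros) auto
  then have "bounded (poly p ` {-1..1})" by (rule compact_imp_bounded)
  then obtain P where P: "\<And>y. y \<in> {-1..1} \<Longrightarrow> \<bar>poly p y\<bar> \<le> P"
    unfolding bounded_iff real_norm_def by blast
  have P0: "P \<ge> 0" using P[of 0] by simp
  have "\<bar>flat_bump p k y\<bar> \<le> P * fact (k + 2) * 4 * (y - x)\<^sup>2" if x: "\<bar>x\<bar> = 1" for x y
  proof (cases "\<bar>y\<bar> < 1")
    case False
    then show ?thesis using P0 by (simp add: flat_bump_def)
  next
    case True
    define s where "s = 1 - y\<^sup>2"
    have s: "s > 0" using True by (simp add: s_def abs_square_less_1)
    have "s = \<bar>x - y\<bar> * \<bar>x + y\<bar>"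
    proof -
      have "x\<^sup>2 = 1" by (metis x power2_abs one_power2)
      then have "s = (x - y) * (x + y)" by (simp add: s_def power2_eq_square algebra_simps)
      then show ?thesis using s by (simp add: abs_mult[symmetric])
    qed
    also have "\<dots> \<le> \<bar>x - y\<bar> * 2" using x True by (intro mult_left_mono) auto
    finally have s2: "s\<^sup>2 \<le> (\<bar>x - y\<bar> * 2)\<^sup>2" using s by (intro power_mono) auto
    have "\<bar>flat_bump p k y\<bar> = \<bar>poly p y\<bar> / s ^ k * exp (- 1 / s)"
      using True s by (simp add: flat_bump_def s_def[symmetric] abs_mult)
    also have "\<dots> \<le> P / s ^ k * (fact (k + 2) * s ^ (k + 2))"
    proof (rule mult_mono)
      have "y \<in> {-1..1}" using True by auto
      then show "\<bar>poly p y\<bar> / s ^ k \<le> P / s ^ k" using P s by (intro divide_right_mono) auto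
    qed (use exp_neg_inverse_le_power[OF s, of "k + 2"] P0 s in auto)
    also have "\<dots> = P * fact (k + 2) * s\<^sup>2" using s by (simp add: power_add power2_eq_square)
    also have "\<dots> \<le> P * fact (k + 2) * (\<bar>x - y\<bar> * 2)\<^sup>2"
      using s2 P0 by (intro mult_left_mono) auto
    also have "\<dots> = P * fact (k + 2) * 4 * (y - x)\<^sup>2"
      by (simp add: power_mult_distrib power2_commute)
    finally show ?thesis .
  qed
  then show ?thesis by blast
qed

text \<open>\<open>[:1, 0, -1:]\<close> is 1 - x^2. Inside the interval the formula is the product
  rule over the common denominator (1 - x^2)^(k + 2); at the edge the quadratic bound replaces
  it.\<close>

lemma flat_bump_has_derivative:
  "(flat_bump p k has_real_derivative
     flat_bump (pderiv p * [:1, 0, -1:]\<^sup>2 + smult (2 * real k) ([:0, 1:] * p * [:1, 0, -1:]) - smult 2 ([:0, 1:] * p)) (k + 2) x) (at x)"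
  (is "(_ has_real_derivative flat_bump ?q _ x) _")
proof -
  consider "\<bar>x\<bar> < 1" | "\<bar>x\<bar> = 1" | "\<bar>x\<bar> > 1" by linarith
  then show ?thesis
  proof cases
    case 1
    have s: "1 - x\<^sup>2 > 0" using 1 by (simp add: abs_square_less_1)
    have q: "poly ?q x = poly (pderiv p) x * (1 - x\<^sup>2)\<^sup>2 + 2 * real k * x * poly p x * (1 - x\<^sup>2) - 2 * x * poly p x"
      by (simp add: power2_eq_square algebra_simps)
    have "((\<lambda>x. poly p x * inverse ((1 - x\<^sup>2) ^ k) * exp (- inverse (1 - x\<^sup>2))) has_real_derivative
      (poly (pderiv p) x * inverse ((1 - x\<^sup>2) ^ k) + poly p x * (inverse ((1 - x\<^sup>2) ^ k) * (real k * (1 - x\<^sup>2) ^ (k - 1) * (2 * x)) * inverse ((1 - x\<^sup>2) ^ k))) * exp (- inverse (1 - x\<^sup>2))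
        + poly p x * inverse ((1 - x\<^sup>2) ^ k) * (exp (- inverse (1 - x\<^sup>2)) * - (inverse (1 - x\<^sup>2) * (2 * x) * inverse (1 - x\<^sup>2)))) (at x)"
      using s by (auto intro!: derivative_eq_intros)
    also have "(poly (pderiv p) x * inverse ((1 - x\<^sup>2) ^ k) + poly p x * (inverse ((1 - x\<^sup>2) ^ k) * (real k * (1 - x\<^sup>2) ^ (k - 1) * (2 * x)) * inverse ((1 - x\<^sup>2) ^ k))) * exp (- inverse (1 - x\<^sup>2))
        + poly p x * inverse ((1 - x\<^sup>2) ^ k) * (exp (- inverse (1 - x\<^sup>2)) * - (inverse (1 - x\<^sup>2) * (2 * x) * inverse (1 - x\<^sup>2)))
        = flat_bump ?q (k + 2) x"
    proof -
      define s where "s = 1 - x\<^sup>2"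
      have s: "s > 0" using 1 by (simp add: s_def abs_square_less_1)
      have k: "real k * s ^ (k - 1) = real k * s ^ k / s" using s by (cases k) auto
      show ?thesis
        unfolding flat_bump_def q s_def[symmetric] k using s 1
        by (simp add: field_simps power_add power2_eq_square)
    qed
    finally have "((\<lambda>x. poly p x * inverse ((1 - x\<^sup>2) ^ k) * exp (- inverse (1 - x\<^sup>2))) has_real_derivative flat_bump ?q (k + 2) x) (at x)" .
    moreover have "open {-1<..<1::real}" "x \<in> {-1<..<1}" using 1 by auto
    ultimately show ?thesis
      by (rule has_field_derivative_transform_within_open) (auto simp: flat_bump_def divide_inverse)
  next
    case 2
    obtain C where "\<And>y. \<bar>flat_bump p k y\<bar> \<le> C * (y - x)\<^sup>2" using flat_bump_quadratic_bound 2 by blast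
    then have "(flat_bump p k has_real_derivative 0) (at x)"
      using 2 by (intro DERIV_zero_of_quadratic_bound[of _ _ C]) (simp add: flat_bump_def)
    then show ?thesis using 2 by (simp add: flat_bump_def)
  next
    case 3
    have "((\<lambda>_. 0) has_real_derivative 0) (at x)" by simp
    moreover have "open (- {-1..1::real})" "x \<in> - {-1..1}" using 3 by auto
    ultimately have "(flat_bump p k has_real_derivative 0) (at x)"
      by (rule has_field_derivative_transform_within_open) (auto simp: flat_bump_def)
    then show ?thesis using 3 by (simp add: flat_bump_def)
  qed
qed

text \<open>A concrete class of smooth functions that is closed under differentiation, so that all
  derivatives can be handled at once.\<close>

definition bumps :: "(real \<Rightarrow> real) set" where
  "bumps = {f. \<exists>p k a b c. f = (\<lambda>t. c * flat_bump p k (a * t + b))}"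

lemma bumps_deriv:
  assumes "f \<in> bumps" shows "deriv f \<in> bumps" "(f has_real_derivative deriv f t) (at t)"
proof -
  obtain p k a b c where f: "f = (\<lambda>t. c * flat_bump p k (a * t + b))"
    using assms by (auto simp: bumps_def)
  obtain q where q: "\<And>x. (flat_bump p k has_real_derivative flat_bump q (k + 2) x) (at x)"
    using flat_bump_has_derivative by blast
  have *: "(f has_real_derivative (c * a) * flat_bump q (k + 2) (a * t + b)) (at t)" for t
    unfolding f by (auto intro!: derivative_eq_intros DERIV_chain2[OF q])
  then have "deriv f = (\<lambda>t. (c * a) * flat_bump q (k + 2) (a * t + b))"
    by (auto intro!: DERIV_imp_deriv)
  then show "deriv f \<in> bumps" "(f has_real_derivative deriv f t) (at t)"
    using * unfolding bumps_def by (blast, simp)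
qed

lemma bumps_affine:
  assumes "f \<in> bumps" shows "(\<lambda>t. c * f (a * t + b)) \<in> bumps"
proof -
  obtain p k a' b' c' where f: "f = (\<lambda>t. c' * flat_bump p k (a' * t + b'))"
    using assms by (auto simp: bumps_def)
  have "(\<lambda>t. c * f (a * t + b)) = (\<lambda>t. (c * c') * flat_bump p k ((a' * a) * t + (a' * b + b')))"
    by (simp add: f algebra_simps)
  then show ?thesis unfolding bumps_def by blast
qed

lemma bumps_continuous: "f \<in> bumps \<Longrightarrow> continuous_on S f"
  by (meson DERIV_isCont bumps_deriv(2) continuous_at_imp_continuous_on)

lemma bumps_bounded:
  assumes "f \<in> bumps" shows "\<exists>B. \<forall>t. \<bar>f t\<bar> \<le> B"
proof -
  obtain p k a b c where f: "f = (\<lambda>t. c * flat_bump p k (a * t + b))"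
    using assms by (auto simp: bumps_def)
  have "continuous_on {-1..1} (flat_bump p k)"
    by (meson DERIV_isCont flat_bump_has_derivative continuous_at_imp_continuous_on)
  then have "bounded (flat_bump p k ` {-1..1})"
    by (intro compact_imp_bounded compact_continuous_image) auto
  then obtain P where P: "\<And>y. y \<in> {-1..1} \<Longrightarrow> \<bar>flat_bump p k y\<bar> \<le> P"
    unfolding bounded_iff real_norm_def by blast
  have "\<bar>flat_bump p k y\<bar> \<le> max P 0" for y
  proof (cases "\<bar>y\<bar> < 1")
    case True
    then have "y \<in> {-1..1}" by auto
    then show ?thesis by (metis P max.coboundedI1)
  qed (simp add: flat_bump_def)
  then have "\<bar>f t\<bar> \<le> \<bar>c\<bar> * max P 0" for t by (simp add: f abs_mult mult_left_mono)
  then show ?thesis by blast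
qed

text \<open>The mean value theorem for f combined with the Lipschitz bound for its derivative. One
  constant, at least 1, serves for all three estimates because powers of it occur in the product
  lemma.\<close>

lemma bumps_taylor:
  assumes "f \<in> bumps"
  shows "\<exists>B\<ge>1. \<forall>s t. \<bar>f t\<bar> \<le> B \<and> \<bar>deriv f t\<bar> \<le> B \<and> \<bar>f s - f t - deriv f t * (s - t)\<bar> \<le> B * (s - t)\<^sup>2"
proof -
  have f': "deriv f \<in> bumps" "deriv (deriv f) \<in> bumps" using assms bumps_deriv(1) by auto
  obtain B0 B1 B2 where B: "\<And>t. \<bar>f t\<bar> \<le> B0" "\<And>t. \<bar>deriv f t\<bar> \<le> B1" "\<And>t. \<bar>deriv (deriv f) t\<bar> \<le> B2"
    using bumps_bounded assms f' by metis
  have lip: "\<bar>deriv f s - deriv f t\<bar> \<le> B2 * \<bar>s - t\<bar>" for s t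
    using field_differentiable_bound[of UNIV "deriv f" "deriv (deriv f)" B2 s t] B(3) bumps_deriv(2)[OF f'(1)]
    by (auto simp: has_field_derivative_at_within)
  have tay: "\<bar>f s - f t - deriv f t * (s - t)\<bar> \<le> B2 * (s - t)\<^sup>2" for s t
  proof -
    have "\<exists>x. \<bar>x - t\<bar> \<le> \<bar>s - t\<bar> \<and> f s - f t = deriv f x * (s - t)"
    proof (cases s t rule: linorder_cases)
      case less
      then obtain z where "s < z" "z < t" "f t - f s = (t - s) * deriv f z"
        using MVT2[of s t f "deriv f"] bumps_deriv(2)[OF assms] by blast
      then show ?thesis by (intro exI[of _ z]) (auto simp: algebra_simps)
    next
      case greater
      then obtain z where "t < z" "z < s" "f s - f t = (s - t) * deriv f z"
        using MVT2[of t s f "deriv f"] bumps_deriv(2)[OF assms] by blast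
      then show ?thesis by (intro exI[of _ z]) (auto simp: algebra_simps)
    qed auto
    then obtain x where x: "\<bar>x - t\<bar> \<le> \<bar>s - t\<bar>" "f s - f t = deriv f x * (s - t)" by blast
    have B20: "B2 \<ge> 0" using B(3)[of 0] by linarith
    have "f s - f t - deriv f t * (s - t) = (deriv f x - deriv f t) * (s - t)"
      using x(2) by (simp add: algebra_simps)
    then have "\<bar>f s - f t - deriv f t * (s - t)\<bar> = \<bar>deriv f x - deriv f t\<bar> * \<bar>s - t\<bar>" by (simp add: abs_mult)
    also have "\<dots> \<le> (B2 * \<bar>s - t\<bar>) * \<bar>s - t\<bar>"
      using lip[of x t] x(1) B20 by (intro mult_right_mono) (auto intro: order_trans mult_left_mono)
    finally show ?thesis by (simp add: power2_eq_square mult.assoc)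
  qed
  define B where "B = Max {1, B0, B1, B2}"
  have "B \<ge> 1" "B0 \<le> B" "B1 \<le> B" "B2 \<le> B" by (auto simp: B_def)
  then show ?thesis using B(1,2) tay
    by (intro exI[of _ B]) (meson order_trans mult_right_mono zero_le_power2)
qed

text \<open>One step of the induction multiplies a function of the first coordinates by a function of
  the next one; the cross term is controlled by the Lipschitz estimate.\<close>

lemma prod_taylor:
  fixes f f' :: "real \<Rightarrow> real" and n :: nat
  assumes B: "B \<ge> 1" "\<And>t. \<bar>f t\<bar> \<le> B" "\<And>t. \<bar>f' t\<bar> \<le> B" "\<And>s t. \<bar>f s - f t - f' t * (s - t)\<bar> \<le> B * (s - t)\<^sup>2"
    and lip: "\<And>s t. \<bar>f s - f t\<bar> \<le> B * \<bar>s - t\<bar>"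
  shows "\<exists>K\<ge>0. \<forall>a b :: nat \<Rightarrow> real. \<bar>(\<Prod>j<n. f (b j)) - (\<Prod>j<n. f (a j))\<bar> \<le> K * (\<Sum>i<n. \<bar>b i - a i\<bar>) \<and>
     \<bar>(\<Prod>j<n. f (b j)) - (\<Prod>j<n. f (a j)) - (\<Sum>i<n. (\<Prod>j<n. (if j = i then f' else f) (a j)) * (b i - a i))\<bar>
       \<le> K * (\<Sum>i<n. (b i - a i)\<^sup>2)"
proof (induction n)
  case 0 show ?case by auto
next
  case (Suc n)
  then obtain K where K: "K \<ge> 0"
    "\<And>a b. \<bar>(\<Prod>j<n. f (b j)) - (\<Prod>j<n. f (a j))\<bar> \<le> K * (\<Sum>i<n. \<bar>b i - a i\<bar>)"
    "\<And>a b. \<bar>(\<Prod>j<n. f (b j)) - (\<Prod>j<n. f (a j)) - (\<Sum>i<n. (\<Prod>j<n. (if j = i then f' else f) (a j)) * (b i - a i))\<bar>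
       \<le> K * (\<Sum>i<n. (b i - a i)\<^sup>2)" by blast
  \<comment> \<open>The n covers the square of the new increment, which appears once in each of n
    mixed terms; the 2 covers the old squares, which appear in the old remainder and again in the
    mixed terms; B^n * B is the remainder of the new factor.\<close>
  define K' where "K' = K * B * (n + 2) + B^n * B"
  have KB: "K * B \<le> K'" "B^n * B \<le> K'" "K' \<ge> 0" using K(1) B(1) by (auto simp: K'_def algebra_simps)
  have Pb: "\<bar>\<Prod>j<n. f (a j)\<bar> \<le> B^n" for a :: "nat \<Rightarrow> real"
    unfolding abs_prod using prod_mono[of "{..<n}" "\<lambda>j. \<bar>f (a j)\<bar>" "\<lambda>_. B"] B(2) by simp
  show ?case
  proof (intro exI[of _ K'] conjI allI)
    fix a b :: "nat \<Rightarrow> real"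
    let ?P = "\<lambda>a. \<Prod>j<n. f (a j)"
    let ?D = "\<Sum>i<n. (\<Prod>j<n. (if j = i then f' else f) (a j)) * (b i - a i)"
    let ?\<delta> = "b n - a n"
    have "\<bar>?P b * f (b n) - ?P a * f (a n)\<bar> = \<bar>(?P b - ?P a) * f (b n) + ?P a * (f (b n) - f (a n))\<bar>"
      by (simp add: algebra_simps)
    also have "\<dots> \<le> \<bar>?P b - ?P a\<bar> * \<bar>f (b n)\<bar> + \<bar>?P a\<bar> * \<bar>f (b n) - f (a n)\<bar>"
      by (simp add: abs_mult[symmetric] abs_triangle_ineq)
    also have "\<dots> \<le> (K * (\<Sum>i<n. \<bar>b i - a i\<bar>)) * B + B^n * (B * \<bar>?\<delta>\<bar>)"
      using K(1) B Pb lip by (intro add_mono mult_mono K(2) mult_nonneg_nonneg sum_nonneg) auto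
    also have "\<dots> \<le> K' * (\<Sum>i<n. \<bar>b i - a i\<bar>) + K' * \<bar>?\<delta>\<bar>"
      using mult_right_mono[OF KB(1), of "\<Sum>i<n. \<bar>b i - a i\<bar>"] mult_right_mono[OF KB(2), of "\<bar>?\<delta>\<bar>"]
      by (simp add: sum_nonneg ac_simps)
    finally show "\<bar>(\<Prod>j<Suc n. f (b j)) - (\<Prod>j<Suc n. f (a j))\<bar> \<le> K' * (\<Sum>i<Suc n. \<bar>b i - a i\<bar>)"
      by (simp add: algebra_simps)
    have D: "(\<Sum>i<Suc n. (\<Prod>j<Suc n. (if j = i then f' else f) (a j)) * (b i - a i)) = ?D * f (a n) + ?P a * f' (a n) * ?\<delta>"
    proof -
      have "(\<Prod>j<n. (if j = n then f' else f) (a j)) = ?P a" by (rule prod.cong) auto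
      then show ?thesis by (simp add: sum_distrib_left mult_ac)
    qed
    \<comment> \<open>Three contributions: the remainder of the first n factors, the product of both
      increments, and the remainder of the last factor.\<close>
    have "\<bar>?P b * f (b n) - ?P a * f (a n) - (?D * f (a n) + ?P a * f' (a n) * ?\<delta>)\<bar>
       = \<bar>(?P b - ?P a - ?D) * f (a n) + (?P b - ?P a) * (f (b n) - f (a n)) + ?P a * (f (b n) - f (a n) - f' (a n) * ?\<delta>)\<bar>"
      by (simp add: algebra_simps)
    also have "\<dots> \<le> \<bar>?P b - ?P a - ?D\<bar> * \<bar>f (a n)\<bar> + \<bar>?P b - ?P a\<bar> * \<bar>f (b n) - f (a n)\<bar> + \<bar>?P a\<bar> * \<bar>f (b n) - f (a n) - f' (a n) * ?\<delta>\<bar>"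
      unfolding abs_mult[symmetric] by (rule order_trans[OF abs_triangle_ineq] add_mono abs_triangle_ineq order_refl)+
    also have "\<dots> \<le> (K * (\<Sum>i<n. (b i - a i)\<^sup>2)) * B + (K * (\<Sum>i<n. \<bar>b i - a i\<bar>)) * (B * \<bar>?\<delta>\<bar>) + B^n * (B * ?\<delta>\<^sup>2)"
      using K(1) B Pb lip by (intro add_mono mult_mono K(2,3) mult_nonneg_nonneg sum_nonneg) auto
    also have "(K * (\<Sum>i<n. \<bar>b i - a i\<bar>)) * (B * \<bar>?\<delta>\<bar>) = K * B * (\<Sum>i<n. \<bar>b i - a i\<bar> * \<bar>?\<delta>\<bar>)"
      by (simp add: sum_distrib_right[symmetric] ac_simps)
    \<comment> \<open>The mixed terms become squares by |u| |v| <= u^2 + v^2.\<close>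
    also have "\<dots> \<le> K * B * (\<Sum>i<n. (b i - a i)\<^sup>2 + ?\<delta>\<^sup>2)"
    proof (intro mult_left_mono sum_mono)
      fix i
      have "0 \<le> (\<bar>b i - a i\<bar> - \<bar>?\<delta>\<bar>)\<^sup>2" by simp
      then have "2 * (\<bar>b i - a i\<bar> * \<bar>?\<delta>\<bar>) \<le> (b i - a i)\<^sup>2 + ?\<delta>\<^sup>2" by (simp add: power2_diff)
      moreover have "0 \<le> \<bar>b i - a i\<bar> * \<bar>?\<delta>\<bar>" by simp
      ultimately show "\<bar>b i - a i\<bar> * \<bar>?\<delta>\<bar> \<le> (b i - a i)\<^sup>2 + ?\<delta>\<^sup>2" by linarith
    qed (use K(1) B(1) in auto)
    finally have "\<bar>?P b * f (b n) - ?P a * f (a n) - (?D * f (a n) + ?P a * f' (a n) * ?\<delta>)\<bar>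
      \<le> 2 * (K * B) * (\<Sum>i<n. (b i - a i)\<^sup>2) + (K * B * n + B^n * B) * ?\<delta>\<^sup>2"
      by (simp add: sum.distrib algebra_simps)
    also have "\<dots> \<le> K' * (\<Sum>i<n. (b i - a i)\<^sup>2) + K' * ?\<delta>\<^sup>2"
      using K(1) B(1) by (intro add_mono mult_right_mono sum_nonneg) (auto simp: K'_def algebra_simps)
    finally show "\<bar>(\<Prod>j<Suc n. f (b j)) - (\<Prod>j<Suc n. f (a j)) - (\<Sum>i<Suc n. (\<Prod>j<Suc n. (if j = i then f' else f) (a j)) * (b i - a i))\<bar>
       \<le> K' * (\<Sum>i<Suc n. (b i - a i)\<^sup>2)"
      unfolding D by (simp add: algebra_simps)
  qed (rule KB)
qed

lemma pderiv_at_prod: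
  assumes "\<And>j. j < d \<Longrightarrow> F j \<in> bumps" "i < d"
  shows "(\<lambda>t. \<Prod>j<d. F j ((x(i := t)) j)) differentiable at t"
    and "pderiv_at i (\<lambda>x. \<Prod>j<d. F j (x j)) = (\<lambda>x. \<Prod>j<d. (if j = i then deriv (F j) else F j) (x j))"
proof -
  have split: "(\<Prod>j<d. G j) = G i * (\<Prod>j\<in>{..<d} - {i}. G j)" for G :: "nat \<Rightarrow> real"
    using assms(2) by (intro prod.remove) auto
  have eq: "(\<Prod>j<d. F j ((x(i := t)) j)) = F i t * (\<Prod>j\<in>{..<d} - {i}. F j (x j))" for x t
    by (subst split) (auto intro!: arg_cong2[where f = times] prod.cong)
  have D: "((\<lambda>t. \<Prod>j<d. F j ((x(i := t)) j)) has_real_derivative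
      deriv (F i) t * (\<Prod>j\<in>{..<d} - {i}. F j (x j))) (at t)" for x t
    unfolding eq by (intro DERIV_cmult_right bumps_deriv(2) assms)
  show "(\<lambda>t. \<Prod>j<d. F j ((x(i := t)) j)) differentiable at t"
    using D by (auto simp: real_differentiable_def)
  show "pderiv_at i (\<lambda>x. \<Prod>j<d. F j (x j)) = (\<lambda>x. \<Prod>j<d. (if j = i then deriv (F j) else F j) (x j))"
  proof
    fix x
    have "pderiv_at i (\<lambda>x. \<Prod>j<d. F j (x j)) x = deriv (F i) (x i) * (\<Prod>j\<in>{..<d} - {i}. F j (x j))"
      unfolding pderiv_at_def by (rule DERIV_imp_deriv[OF D])
    also have "\<dots> = (\<Prod>j<d. (if j = i then deriv (F j) else F j) (x j))"
      by (subst split) (auto intro!: arg_cong2[where f = times] prod.cong)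
    finally show "pderiv_at i (\<lambda>x. \<Prod>j<d. F j (x j)) x = \<dots>" .
  qed
qed

text \<open>Induction over all families at once: a partial derivative replaces one factor by its
  derivative, which belongs to \<open>bumps\<close> again.\<close>

lemma C_k_prod_bumps:
  assumes "\<And>j. j < d \<Longrightarrow> F j \<in> bumps"
  shows "C_k d k (\<lambda>x. \<Prod>j<d. F j (x j))"
  using assms
proof (induction k arbitrary: F)
  have cont: "continuous_map (euclid d) euclideanreal (\<lambda>x. \<Prod>j<d. F j (x j))"
    if F: "\<And>j. j < d \<Longrightarrow> F j \<in> bumps" for F
  proof (intro continuous_map_prod)
    fix j assume j: "j \<in> {..<d}"
    have "continuous_map (euclid d) euclideanreal (\<lambda>x. x j)"
      unfolding euclid_def using j by (rule continuous_map_product_projection)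
    moreover have "continuous_map euclideanreal euclideanreal (F j)"
      using bumps_continuous[OF F] j by simp
    ultimately show "continuous_map (euclid d) euclideanreal (\<lambda>x. F j (x j))"
      using continuous_map_compose[of _ _ "\<lambda>x. x j" _ "F j"] by (simp add: o_def)
  qed simp
  case 0
  then show ?case using cont by simp
  case (Suc k)
  show ?case
  proof (simp only: C_k.simps, intro conjI allI impI ballI)
    show "continuous_map (euclid d) euclideanreal (\<lambda>x. \<Prod>j<d. F j (x j))" using cont Suc.prems by blast
    fix i assume i: "i < d"
    have "C_k d k (\<lambda>x. \<Prod>j<d. (if j = i then deriv (F j) else F j) (x j))"
      by (rule Suc.IH) (use Suc.prems bumps_deriv(1) in auto)
    then show "C_k d k (pderiv_at i (\<lambda>x. \<Prod>j<d. F j (x j)))"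
      by (subst pderiv_at_prod(2)) (use Suc.prems i in auto)
    show "(\<lambda>t. \<Prod>j<d. F j ((x(i := t)) j)) differentiable at (x i)" for x
      by (rule pderiv_at_prod(1)[OF Suc.prems i])
  qed
qed

lemma compactin_box: "compactin (euclid d) (PiE {..<d} (\<lambda>j. {a j..b j :: real}))"
  unfolding euclid_def by (auto simp: compactin_PiE)

lemma Hausdorff_euclid: "Hausdorff_space (euclid d)"
  unfolding euclid_def by (simp add: Hausdorff_space_product_topology)

lemma test_function_prod_bumps:
  assumes F: "\<And>j. j < d \<Longrightarrow> F j \<in> bumps"
    and supp: "\<And>j t. j < d \<Longrightarrow> t \<notin> {a j..b j} \<Longrightarrow> F j t = 0"
    and sub: "PiE {..<d} (\<lambda>j. {a j..b j}) \<subseteq> \<Omega>"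
  shows "test_function d \<Omega> (\<lambda>x. \<Prod>j<d. F j (x j))"
proof -
  let ?B = "PiE {..<d} (\<lambda>j. {a j..b j})"
  let ?S = "{x \<in> topspace (euclid d). (\<Prod>j<d. F j (x j)) \<noteq> 0}"
  have "?S \<subseteq> ?B"
  proof
    fix x assume "x \<in> ?S"
    then have "x \<in> extensional {..<d}" "\<And>j. j < d \<Longrightarrow> F j (x j) \<noteq> 0" by (auto simp: topspace_euclid)
    then show "x \<in> ?B" using supp by (auto simp: PiE_def Pi_def)
  qed
  moreover have cl: "closedin (euclid d) ?B"
    by (rule compactin_imp_closedin[OF Hausdorff_euclid compactin_box])
  ultimately have sub': "euclid d closure_of ?S \<subseteq> ?B" by (rule closure_of_minimal)
  then have "compactin (euclid d) (euclid d closure_of ?S)"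
    by (rule closed_compactin[OF compactin_box]) simp
  then show ?thesis unfolding test_function_def Let_def
    using C_k_prod_bumps[OF F] sub sub' by auto
qed

definition rho_mass :: real where "rho_mass = (LINT t|lborel. flat_bump 1 0 t)"
definition rho :: "real \<Rightarrow> real" where "rho t = flat_bump 1 0 t / rho_mass"

lemma flat_bump_1_0: "flat_bump 1 0 t \<ge> 0" "flat_bump 1 0 t \<le> 1" "flat_bump 1 0 \<in> bumps"
  "flat_bump 1 0 \<in> borel_measurable borel" "integrable lborel (flat_bump 1 0)" "rho_mass > 0"
proof -
  show 1: "flat_bump 1 0 t \<ge> 0" for t by (simp add: flat_bump_def)
  show 2: "flat_bump 1 0 t \<le> 1" for t by (simp add: flat_bump_def abs_square_less_1 less_imp_le)
  have "flat_bump 1 0 = (\<lambda>t. 1 * flat_bump 1 0 (1 * t + 0))" by simp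
  then show b: "flat_bump 1 0 \<in> bumps" unfolding bumps_def by blast
  show m [measurable]: "flat_bump 1 0 \<in> borel_measurable borel"
    by (rule borel_measurable_continuous_onI[OF bumps_continuous[OF b]])
  show i: "integrable lborel (flat_bump 1 0)"
    by (rule integrableI_bounded_set[where A = "{-1..1}" and B = 1])
       (use 1 2 in \<open>auto simp: flat_bump_def\<close>)
  \<comment> \<open>On [-1/2, 1/2], an interval of length 1, the exponent -1 / (1 - t^2) stays above
    -2.\<close>
  have "0 < exp (- 2 :: real) * measure lborel {-1/2..1/2::real}" by simp
  also have "\<dots> = (LINT t|lborel. exp (- 2) * indicator {-1/2..1/2::real} t)" by simp
  also have "\<dots> \<le> rho_mass" unfolding rho_mass_def
  proof (rule integral_mono[OF _ i])
    fix t :: real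
    show "exp (- 2) * indicator {-1/2..1/2::real} t \<le> flat_bump 1 0 t"
    proof (cases "t \<in> {-1/2..1/2}")
      case True
      then have "\<bar>t\<bar> \<le> 1/2" by auto
      then have "t\<^sup>2 \<le> (1/2)\<^sup>2" using power_mono[of "\<bar>t\<bar>" "1/2" 2] by simp
      then have "t\<^sup>2 \<le> 1/4" by (simp add: power2_eq_square)
      then have "1 / (1 - t\<^sup>2) \<le> 2" by (simp add: divide_simps)
      then show ?thesis using True by (auto simp: flat_bump_def abs_if)
    qed (simp add: 1)
  qed (auto intro!: integrable_mult_right integrable_real_indicator)
  finally show "rho_mass > 0" .
qed

lemma rho_bumps: "rho \<in> bumps"
  using bumps_affine[OF flat_bump_1_0(3), of "1 / rho_mass" 1 0] by (simp add: rho_def[abs_def])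

lemma rho_measurable [measurable]: "rho \<in> borel_measurable borel" "deriv rho \<in> borel_measurable borel"
  using borel_measurable_continuous_onI bumps_continuous rho_bumps bumps_deriv(1) by blast+

lemma rho_nonneg: "rho t \<ge> 0"
  using flat_bump_1_0 by (simp add: rho_def less_imp_le)

lemma rho_eq_0: "\<bar>t\<bar> \<ge> 1 \<Longrightarrow> rho t = 0"
  by (simp add: rho_def flat_bump_def)

lemma rho_nn_integral: "(\<integral>\<^sup>+t. ennreal (rho t) \<partial>lborel) = 1"
proof -
  have "integrable lborel rho" "(LINT t|lborel. rho t) = 1"
    using flat_bump_1_0(5,6) by (auto simp: rho_def[abs_def] rho_mass_def)
  then show ?thesis using rho_nonneg by (subst nn_integral_eq_integral) auto
qed

lemma rho_scaled_nn_integral: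
  assumes "e > 0"
  shows "(\<integral>\<^sup>+t. ennreal (rho ((z - t) / e) / e) \<partial>lborel) = 1" "(\<integral>\<^sup>+t. ennreal (rho ((t - z) / e) / e) \<partial>lborel) = 1"
proof -
  \<comment> \<open>One affine substitution, with \<open>c\<close> equal to \<open>e\<close> or to
    \<open>- e\<close>, serves both orientations of the kernel.\<close>
  have *: "(\<integral>\<^sup>+t. ennreal (rho ((t - z) / c) / e) \<partial>lborel) = 1" if "\<bar>c\<bar> = e" for c
  proof -
    have c: "c \<noteq> 0" using that assms by auto
    have "(\<integral>\<^sup>+t. ennreal (rho ((t - z) / c) / e) \<partial>lborel) = ennreal \<bar>c\<bar> * (\<integral>\<^sup>+t. ennreal (rho ((z + c * t - z) / c) / e) \<partial>lborel)"
      by (rule nn_integral_real_affine[OF _ c]) measurable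
    also have "\<dots> = (\<integral>\<^sup>+t. ennreal \<bar>c\<bar> * ennreal (rho t / e) \<partial>lborel)"
      using c by (subst nn_integral_cmult) auto
    also have "\<dots> = (\<integral>\<^sup>+t. ennreal (rho t) \<partial>lborel)"
      using assms that rho_nonneg by (simp add: ennreal_mult[symmetric])
    finally show ?thesis by (simp add: rho_nn_integral)
  qed
  show "(\<integral>\<^sup>+t. ennreal (rho ((t - z) / e) / e) \<partial>lborel) = 1" using *[of e] assms by simp
  have "(t - z) / - e = (z - t) / e" for t using assms by (simp add: divide_simps)
  then show "(\<integral>\<^sup>+t. ennreal (rho ((z - t) / e) / e) \<partial>lborel) = 1" using *[of "- e"] assms by simp
qed

text \<open>A tensor product of one-dimensional mollifiers instead of a radial one: its integrals
  factor over the coordinates and its support is a cube, which fits the product topology.\<close>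

definition kern :: "nat \<Rightarrow> real \<Rightarrow> (nat \<Rightarrow> real) \<Rightarrow> (nat \<Rightarrow> real) \<Rightarrow> real" where
  "kern d e z y = (\<Prod>j<d. rho ((z j - y j) / e) / e)"

text \<open>The partial derivative of \<open>kern\<close> in the coordinate \<open>z i\<close>; the
  last division by e is the chain rule.\<close>

definition dkern :: "nat \<Rightarrow> real \<Rightarrow> nat \<Rightarrow> (nat \<Rightarrow> real) \<Rightarrow> (nat \<Rightarrow> real) \<Rightarrow> real" where
  "dkern d e i z y = (\<Prod>j<d. (if j = i then deriv rho else rho) ((z j - y j) / e) / e) / e"

lemma kern_measurable [measurable]:
  "(\<lambda>p. kern d e (fst p) (snd p)) \<in> borel_measurable (lebP d \<Otimes>\<^sub>M lebP d)"
  "(\<lambda>p. dkern d e i (fst p) (snd p)) \<in> borel_measurable (lebP d \<Otimes>\<^sub>M lebP d)"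
  "(\<lambda>p. kern d e (snd p) (fst p)) \<in> borel_measurable (lebP d \<Otimes>\<^sub>M lebP d)"
  "kern d e z \<in> borel_measurable (lebP d)" "(\<lambda>z. kern d e z y) \<in> borel_measurable (lebP d)"
  "dkern d e i z \<in> borel_measurable (lebP d)"
  unfolding kern_def[abs_def] dkern_def[abs_def] if_distribR by measurable

lemma kern_nonneg: "e > 0 \<Longrightarrow> kern d e z y \<ge> 0"
  unfolding kern_def by (intro prod_nonneg) (auto simp: rho_nonneg less_imp_le)

lemma kern_eq_0: "e > 0 \<Longrightarrow> j < d \<Longrightarrow> \<bar>z j - y j\<bar> \<ge> e \<Longrightarrow> kern d e z y = 0"
  unfolding kern_def by (intro prod_zero) (auto simp: rho_eq_0 field_simps intro!: bexI[of _ j])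

lemma kern_nn_integral:
  assumes "e > 0"
  shows "(\<integral>\<^sup>+y. ennreal (kern d e z y) \<partial>lebP d) = 1" "(\<integral>\<^sup>+z. ennreal (kern d e z y) \<partial>lebP d) = 1"
proof -
  interpret product_sigma_finite "\<lambda>_::nat. lborel :: real measure" ..
  have "(\<integral>\<^sup>+y. ennreal (kern d e z y) \<partial>lebP d) = (\<integral>\<^sup>+y. (\<Prod>j<d. ennreal (rho ((z j - y j) / e) / e)) \<partial>lebP d)"
    unfolding kern_def using assms rho_nonneg by (simp add: prod_ennreal less_imp_le)
  also have "\<dots> = (\<Prod>j<d. (\<integral>\<^sup>+t. ennreal (rho ((z j - t) / e) / e) \<partial>lborel))"
    by (rule product_nn_integral_prod) auto
  finally show "(\<integral>\<^sup>+y. ennreal (kern d e z y) \<partial>lebP d) = 1" using assms by (simp add: rho_scaled_nn_integral)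
  have "(\<integral>\<^sup>+z. ennreal (kern d e z y) \<partial>lebP d) = (\<integral>\<^sup>+z. (\<Prod>j<d. ennreal (rho ((z j - y j) / e) / e)) \<partial>lebP d)"
    unfolding kern_def using assms rho_nonneg by (simp add: prod_ennreal less_imp_le)
  also have "\<dots> = (\<Prod>j<d. (\<integral>\<^sup>+t. ennreal (rho ((t - y j) / e) / e) \<partial>lborel))"
    by (rule product_nn_integral_prod) auto
  finally show "(\<integral>\<^sup>+z. ennreal (kern d e z y) \<partial>lebP d) = 1" using assms by (simp add: rho_scaled_nn_integral)
qed

text \<open>Taylor estimates for the one-dimensional mollifier, multiplied together. The constant
  may grow with d and with 1 / e, since it will enter only the bounds B and K of
  \<open>poincare_convex_smooth\<close>; the quadratic estimate provides the Taylor hypothesis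
  there.\<close>

lemma kern_bounds:
  assumes "e > 0"
  obtains K where "K \<ge> 0" "\<And>z y. \<bar>kern d e z y\<bar> \<le> K" "\<And>i z y. \<bar>dkern d e i z y\<bar> \<le> K"
    "\<And>z z' y. \<bar>kern d e z' y - kern d e z y - (\<Sum>i<d. dkern d e i z y * (z' i - z i))\<bar> \<le> K * sqdist d z' z"
proof -
  obtain B where B: "B \<ge> 1" "\<And>t. \<bar>rho t\<bar> \<le> B" "\<And>t. \<bar>deriv rho t\<bar> \<le> B"
    "\<And>s t. \<bar>rho s - rho t - deriv rho t * (s - t)\<bar> \<le> B * (s - t)\<^sup>2"
    using bumps_taylor[OF rho_bumps] by metis
  have lip: "\<bar>rho s - rho t\<bar> \<le> B * \<bar>s - t\<bar>" for s t
    using field_differentiable_bound[of UNIV rho "deriv rho" B s t] B(3) bumps_deriv(2)[OF rho_bumps]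
    by (auto simp: has_field_derivative_at_within)
  obtain K where K: "K \<ge> 0" "\<And>a b. \<bar>(\<Prod>j<d. rho (b j)) - (\<Prod>j<d. rho (a j)) - (\<Sum>i<d. (\<Prod>j<d. (if j = i then deriv rho else rho) (a j)) * (b i - a i))\<bar>
       \<le> K * sqdist d b a"
    using prod_taylor[OF B lip, of d] by blast
  have kern: "kern d e z y = (\<Prod>j<d. rho ((z j - y j) / e)) / e ^ d" for z y
    by (simp add: kern_def prod_dividef)
  have dkern: "dkern d e i z y = (\<Prod>j<d. (if j = i then deriv rho else rho) ((z j - y j) / e)) / e ^ d / e" for i z y
    by (simp add: dkern_def prod_dividef)
  have 1: "\<bar>kern d e z y\<bar> \<le> B ^ d / e ^ d" for z y
    unfolding kern abs_divide abs_prod using assms B(2) prod_mono[of "{..<d}" "\<lambda>j. \<bar>rho ((z j - y j) / e)\<bar>" "\<lambda>_. B"]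
    by (simp add: divide_right_mono)
  have 2: "\<bar>dkern d e i z y\<bar> \<le> B ^ d / e ^ d / e" for i z y
    unfolding dkern abs_divide abs_prod
    using assms B(2,3) prod_mono[of "{..<d}" "\<lambda>j. \<bar>(if j = i then deriv rho else rho) ((z j - y j) / e)\<bar>" "\<lambda>_. B"]
    by (simp add: divide_right_mono)
  have 3: "\<bar>kern d e z' y - kern d e z y - (\<Sum>i<d. dkern d e i z y * (z' i - z i))\<bar> \<le> K / e ^ d / e\<^sup>2 * sqdist d z' z" for z z' y
  proof -
    let ?a = "\<lambda>j. (z j - y j) / e" and ?b = "\<lambda>j. (z' j - y j) / e"
    have d: "?b i - ?a i = (z' i - z i) / e" for i using assms by (simp add: field_simps)
    have eq: "kern d e z' y - kern d e z y - (\<Sum>i<d. dkern d e i z y * (z' i - z i))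
      = ((\<Prod>j<d. rho (?b j)) - (\<Prod>j<d. rho (?a j)) - (\<Sum>i<d. (\<Prod>j<d. (if j = i then deriv rho else rho) (?a j)) * (?b i - ?a i))) / e ^ d"
    proof -
      have "(\<Sum>i<d. dkern d e i z y * (z' i - z i)) = (\<Sum>i<d. (\<Prod>j<d. (if j = i then deriv rho else rho) (?a j)) * ((z' i - z i) / e)) / e ^ d"
        unfolding dkern sum_divide_distrib by (rule sum.cong) (simp_all add: ac_simps)
      then show ?thesis unfolding kern d by (simp only: diff_divide_distrib)
    qed
    have "\<bar>kern d e z' y - kern d e z y - (\<Sum>i<d. dkern d e i z y * (z' i - z i))\<bar> \<le> K * sqdist d ?b ?a / e ^ d"
      unfolding eq abs_divide using K(2)[of ?b ?a] assms by (simp add: divide_right_mono)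
    also have "sqdist d ?b ?a = sqdist d z' z / e\<^sup>2"
      unfolding d by (simp add: power_divide sum_divide_distrib)
    finally show ?thesis by (simp add: ac_simps)
  qed
  define L where "L = Max {0, B ^ d / e ^ d, B ^ d / e ^ d / e, K / e ^ d / e\<^sup>2}"
  have L: "L \<ge> 0" "B ^ d / e ^ d \<le> L" "B ^ d / e ^ d / e \<le> L" "K / e ^ d / e\<^sup>2 \<le> L"
    unfolding L_def by (auto intro!: Max_ge)
  show thesis
  proof (rule that[OF L(1)])
    fix z z' y :: "nat \<Rightarrow> real" and i
    show "\<bar>kern d e z y\<bar> \<le> L" "\<bar>dkern d e i z y\<bar> \<le> L" using 1 2 L by (meson order_trans)+
    show "\<bar>kern d e z' y - kern d e z y - (\<Sum>i<d. dkern d e i z y * (z' i - z i))\<bar> \<le> L * sqdist d z' z"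
      using 3[of z' y z] mult_right_mono[OF L(4), of "\<Sum>i<d. (z' i - z i)\<^sup>2"] by (meson order_trans sum_nonneg zero_le_power2)
  qed
qed

text \<open>Makes the kernel admissible in the definition of weak derivatives. The sign arises
  because a test function is differentiated in y, \<open>dkern\<close> in z.\<close>

lemma kern_test_function:
  assumes e: "e > 0" and box: "cube d z e \<subseteq> \<Omega>"
  shows "test_function d \<Omega> (kern d e z)"
    and "i < d \<Longrightarrow> pderiv_at i (kern d e z) y = - dkern d e i z y"
proof -
  define F where "F = (\<lambda>j t. rho ((z j - t) / e) / e)"
  have Feq: "F j = (\<lambda>t. (1 / e) * rho ((- 1 / e) * t + z j / e))" for j
  proof -
    have "(z j - t) / e = (- 1 / e) * t + z j / e" for t by (simp add: diff_divide_distrib)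
    then show ?thesis by (simp add: F_def)
  qed
  have Fb: "F j \<in> bumps" for j unfolding Feq by (rule bumps_affine[OF rho_bumps])
  have k: "kern d e z = (\<lambda>y. \<Prod>j<d. F j (y j))" by (simp add: kern_def F_def fun_eq_iff)
  show "test_function d \<Omega> (kern d e z)" unfolding k
  proof (rule test_function_prod_bumps[OF Fb _ box])
    fix j t assume "t \<notin> {z j - e..z j + e}"
    then have "\<bar>(z j - t) / e\<bar> \<ge> 1" using e by (auto simp: field_simps abs_if)
    then show "F j t = 0" by (simp add: F_def rho_eq_0)
  qed
  assume i: "i < d"
  have dF: "deriv (F j) = (\<lambda>t. - (deriv rho ((z j - t) / e) / e) / e)" for j
  proof
    fix t
    have "(F j has_real_derivative - (deriv rho ((z j - t) / e) / e) / e) (at t)"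
      unfolding F_def using e
      by (auto intro!: derivative_eq_intros DERIV_chain2[OF bumps_deriv(2)[OF rho_bumps]])
    then show "deriv (F j) t = - (deriv rho ((z j - t) / e) / e) / e" by (rule DERIV_imp_deriv)
  qed
  have split: "(\<Prod>j<d. G j) = G i * (\<Prod>j\<in>{..<d} - {i}. G j)" for G :: "nat \<Rightarrow> real"
    using i by (intro prod.remove) auto
  have "pderiv_at i (kern d e z) y = (\<Prod>j<d. (if j = i then deriv (F j) else F j) (y j))"
    unfolding k using pderiv_at_prod(2)[OF Fb i] by simp
  also have "\<dots> = deriv (F i) (y i) * (\<Prod>j\<in>{..<d} - {i}. F j (y j))"
    by (subst split) (auto intro!: arg_cong2[where f = times] prod.cong)
  also have "\<dots> = - dkern d e i z y"
    unfolding dkern_def dF by (subst split) (auto simp: F_def intro!: arg_cong2[where f = times] prod.cong)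
  finally show "pderiv_at i (kern d e z) y = - dkern d e i z y" .
qed

section \<open>Mollification as a contraction in the mean and in the square mean\<close>

definition moll :: "nat \<Rightarrow> real \<Rightarrow> ((nat \<Rightarrow> real) \<Rightarrow> real) \<Rightarrow> (nat \<Rightarrow> real) \<Rightarrow> real" where
  "moll d e u z = (LINT y|lebP d. u y * kern d e z y)"

lemma sigma_finite_lebP: "sigma_finite_measure (lebP d)"
proof -
  interpret product_sigma_finite "\<lambda>_::nat. lborel :: real measure" ..
  show ?thesis by (rule sigma_finite) simp
qed

lemma pair_sigma_finite_lebP: "pair_sigma_finite (lebP d) (lebP d)"
  by (simp add: pair_sigma_finite_def sigma_finite_lebP)

lemma moll_measurable [measurable]:
  assumes [measurable]: "u \<in> borel_measurable (lebP d)"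
  shows "moll d e u \<in> borel_measurable (lebP d)"
proof -
  interpret sigma_finite_measure "lebP d" by (rule sigma_finite_lebP)
  show ?thesis unfolding moll_def[abs_def]
    by (rule borel_measurable_lebesgue_integral) (simp add: case_prod_unfold)
qed

lemma integrable_mult_bounded:
  fixes u k :: "'a \<Rightarrow> real"
  assumes "integrable M u" and [measurable]: "k \<in> borel_measurable M" and "\<And>y. y \<in> space M \<Longrightarrow> \<bar>k y\<bar> \<le> B"
  shows "integrable M (\<lambda>y. u y * k y)"
proof (rule Bochner_Integration.integrable_bound)
  show "integrable M (\<lambda>y. B * \<bar>u y\<bar>)" using assms(1) by simp
  show "AE y in M. norm (u y * k y) \<le> norm (B * \<bar>u y\<bar>)"
  proof (rule AE_I2)
    fix y assume "y \<in> space M"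
    then have "\<bar>u y\<bar> * \<bar>k y\<bar> \<le> \<bar>u y\<bar> * \<bar>B\<bar>"
      using assms(3)[of y] by (intro mult_left_mono) auto
    then show "norm (u y * k y) \<le> norm (B * \<bar>u y\<bar>)" by (simp add: abs_mult mult.commute)
  qed
qed (use assms in auto)

lemma moll_integrable_kern:
  assumes "e > 0" "integrable (lebP d) u"
  shows "integrable (lebP d) (\<lambda>y. u y * kern d e z y)"
    and "i < d \<Longrightarrow> integrable (lebP d) (\<lambda>y. u y * dkern d e i z y)"
proof -
  obtain K where K: "\<And>z y. \<bar>kern d e z y\<bar> \<le> K" "\<And>i z y. \<bar>dkern d e i z y\<bar> \<le> K"
    by (rule kern_bounds[OF assms(1), of d]) blast
  show "integrable (lebP d) (\<lambda>y. u y * kern d e z y)"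
    by (rule integrable_mult_bounded[OF assms(2)]) (use K in auto)
  show "integrable (lebP d) (\<lambda>y. u y * dkern d e i z y)" if "i < d"
    by (rule integrable_mult_bounded[OF assms(2)]) (use K(2) in auto)
qed

lemma kern_integral:
  assumes "e > 0"
  shows "integrable (lebP d) (kern d e z)" "(LINT y|lebP d. kern d e z y) = 1"
proof -
  show "integrable (lebP d) (kern d e z)"
    by (rule integrableI_nonneg) (use kern_nonneg[OF assms] kern_nn_integral(1)[OF assms] in auto)
  show "(LINT y|lebP d. kern d e z y) = 1"
    using integral_eq_nn_integral[of "kern d e z" "lebP d"] kern_nonneg[OF assms] kern_nn_integral(1)[OF assms, of d z] by simp
qed

lemma moll_diff:
  assumes "e > 0" "integrable (lebP d) u" "integrable (lebP d) v"
  shows "moll d e (\<lambda>x. u x - v x) z = moll d e u z - moll d e v z"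
  unfolding moll_def using moll_integrable_kern(1)[OF assms(1)] assms
  by (simp add: left_diff_distrib)

lemma moll_add:
  assumes "e > 0" "integrable (lebP d) u" "integrable (lebP d) v"
  shows "moll d e (\<lambda>x. u x + v x) z = moll d e u z + moll d e v z"
  unfolding moll_def using moll_integrable_kern(1)[OF assms(1)] assms
  by (simp add: distrib_right)

text \<open>Tonelli and the unit mass of the kernel in its first argument. Both contraction
  estimates for mollification rest on this identity.\<close>

lemma nn_integral_kern_swap:
  assumes e: "e > 0" and [measurable]: "w \<in> borel_measurable (lebP d)"
  shows "(\<integral>\<^sup>+z. \<integral>\<^sup>+y. w y * ennreal (kern d e z y) \<partial>lebP d \<partial>lebP d) = (\<integral>\<^sup>+y. w y \<partial>lebP d)"
proof -
  interpret pair_sigma_finite "lebP d" "lebP d" by (rule pair_sigma_finite_lebP)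
  have "(\<integral>\<^sup>+z. \<integral>\<^sup>+y. w y * ennreal (kern d e z y) \<partial>lebP d \<partial>lebP d)
    = (\<integral>\<^sup>+y. \<integral>\<^sup>+z. w y * ennreal (kern d e z y) \<partial>lebP d \<partial>lebP d)"
    by (rule Fubini') (simp add: case_prod_unfold)
  also have "\<dots> = (\<integral>\<^sup>+y. w y * (\<integral>\<^sup>+z. ennreal (kern d e z y) \<partial>lebP d) \<partial>lebP d)"
    by (intro nn_integral_cong nn_integral_cmult) simp
  finally show ?thesis using e by (simp add: kern_nn_integral)
qed

lemma moll_L1:
  assumes e: "e > 0" and u: "integrable (lebP d) u"
  shows "integrable (lebP d) (moll d e u)" "(LINT z|lebP d. \<bar>moll d e u z\<bar>) \<le> (LINT z|lebP d. \<bar>u z\<bar>)"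
proof -
  have [measurable]: "u \<in> borel_measurable (lebP d)" using u by simp
  have "(\<integral>\<^sup>+z. ennreal \<bar>moll d e u z\<bar> \<partial>lebP d) \<le> (\<integral>\<^sup>+z. \<integral>\<^sup>+y. ennreal \<bar>u y\<bar> * ennreal (kern d e z y) \<partial>lebP d \<partial>lebP d)"
  proof (rule nn_integral_mono)
    fix z
    have "ennreal (norm (moll d e u z)) \<le> (\<integral>\<^sup>+y. ennreal (norm (u y * kern d e z y)) \<partial>lebP d)"
      unfolding moll_def by (rule integral_norm_bound_ennreal[OF moll_integrable_kern(1)[OF e u]])
    also have "\<dots> = (\<integral>\<^sup>+y. ennreal \<bar>u y\<bar> * ennreal (kern d e z y) \<partial>lebP d)"
      using kern_nonneg[OF e] by (simp add: abs_mult ennreal_mult)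
    finally show "ennreal \<bar>moll d e u z\<bar> \<le> (\<integral>\<^sup>+y. ennreal \<bar>u y\<bar> * ennreal (kern d e z y) \<partial>lebP d)" by simp
  qed
  also have "\<dots> = (\<integral>\<^sup>+y. ennreal \<bar>u y\<bar> \<partial>lebP d)"
    by (rule nn_integral_kern_swap[OF e]) simp
  also have "\<dots> = ennreal (LINT y|lebP d. \<bar>u y\<bar>)"
    using u by (intro nn_integral_eq_integral) auto
  finally have le: "(\<integral>\<^sup>+z. ennreal \<bar>moll d e u z\<bar> \<partial>lebP d) \<le> ennreal (LINT y|lebP d. \<bar>u y\<bar>)" .
  show i: "integrable (lebP d) (moll d e u)"
    by (rule integrableI_bounded) (use le in \<open>auto simp: le_less_trans[OF le]\<close>)
  then have "(\<integral>\<^sup>+z. ennreal \<bar>moll d e u z\<bar> \<partial>lebP d) = ennreal (LINT z|lebP d. \<bar>moll d e u z\<bar>)"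
    by (intro nn_integral_eq_integral) auto
  with le show "(LINT z|lebP d. \<bar>moll d e u z\<bar>) \<le> (LINT z|lebP d. \<bar>u z\<bar>)"
    by (simp add: ennreal_le_iff)
qed

text \<open>Jensen's inequality for the probability density \<open>kern d e z\<close>, obtained by
  expanding the nonnegative integral of (u - a)^2 against it with a =
  \<open>moll d e u z\<close>.\<close>

lemma moll_L2:
  assumes e: "e > 0" and u: "integrable (lebP d) u" and u2: "integrable (lebP d) (\<lambda>x. (u x)\<^sup>2)"
  shows "(\<integral>\<^sup>+z. ennreal ((moll d e u z)\<^sup>2) \<partial>lebP d) \<le> ennreal (LINT z|lebP d. (u z)\<^sup>2)"
proof -
  have [measurable]: "u \<in> borel_measurable (lebP d)" using u by simp
  have "(\<integral>\<^sup>+z. ennreal ((moll d e u z)\<^sup>2) \<partial>lebP d) \<le> (\<integral>\<^sup>+z. \<integral>\<^sup>+y. ennreal ((u y)\<^sup>2) * ennreal (kern d e z y) \<partial>lebP d \<partial>lebP d)"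
  proof (rule nn_integral_mono)
    fix z
    define a where "a = moll d e u z"
    note i = moll_integrable_kern(1)[OF e u2, of z] moll_integrable_kern(1)[OF e u, of z] kern_integral[OF e, of d z]
    have "0 \<le> (LINT y|lebP d. (u y - a)\<^sup>2 * kern d e z y)"
      using kern_nonneg[OF e] by (intro integral_nonneg_AE) auto
    also have "\<dots> = (LINT y|lebP d. (u y)\<^sup>2 * kern d e z y - 2 * a * (u y * kern d e z y) + a\<^sup>2 * kern d e z y)"
      by (simp add: power2_eq_square algebra_simps)
    also have "\<dots> = (LINT y|lebP d. (u y)\<^sup>2 * kern d e z y) - a\<^sup>2"
      using i by (simp add: a_def moll_def power2_eq_square)
    finally have "ennreal (a\<^sup>2) \<le> ennreal (LINT y|lebP d. (u y)\<^sup>2 * kern d e z y)"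
      by (intro ennreal_leI) simp
    also have "\<dots> = (\<integral>\<^sup>+y. ennreal ((u y)\<^sup>2 * kern d e z y) \<partial>lebP d)"
      using i kern_nonneg[OF e] by (intro nn_integral_eq_integral[symmetric]) auto
    also have "\<dots> = (\<integral>\<^sup>+y. ennreal ((u y)\<^sup>2) * ennreal (kern d e z y) \<partial>lebP d)"
      using kern_nonneg[OF e] by (simp add: ennreal_mult)
    finally show "ennreal ((moll d e u z)\<^sup>2) \<le> (\<integral>\<^sup>+y. ennreal ((u y)\<^sup>2) * ennreal (kern d e z y) \<partial>lebP d)"
      by (simp add: a_def)
  qed
  also have "\<dots> = (\<integral>\<^sup>+y. ennreal ((u y)\<^sup>2) \<partial>lebP d)"
    by (rule nn_integral_kern_swap[OF e]) simp
  also have "\<dots> = ennreal (LINT y|lebP d. (u y)\<^sup>2)"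
    using u2 by (intro nn_integral_eq_integral) auto
  finally show ?thesis .
qed

section \<open>Convergence of mollifications in the mean\<close>

definition moll_tendsto :: "nat \<Rightarrow> (nat \<Rightarrow> real) \<Rightarrow> ((nat \<Rightarrow> real) \<Rightarrow> real) \<Rightarrow> bool" where
  "moll_tendsto d e u \<longleftrightarrow> integrable (lebP d) u \<and> (\<lambda>n. LINT z|lebP d. \<bar>moll d (e n) u z - u z\<bar>) \<longlonglongrightarrow> 0"

text \<open>Mollification does not increase the L1 norm, so replacing u by v costs at most twice the
  distance of u and v, uniformly in n.\<close>

lemma moll_tendsto_closed:
  assumes e: "\<And>n. e n > 0" and u: "integrable (lebP d) u"
    and appr: "\<And>\<delta>. \<delta> > 0 \<Longrightarrow> \<exists>v. moll_tendsto d e v \<and> (LINT z|lebP d. \<bar>u z - v z\<bar>) \<le> \<delta>"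
  shows "moll_tendsto d e u"
  unfolding moll_tendsto_def
proof (intro conjI u LIMSEQ_I)
  fix r :: real assume "r > 0"
  then obtain v where v: "moll_tendsto d e v" "(LINT z|lebP d. \<bar>u z - v z\<bar>) \<le> r / 4"
    using appr[of "r / 4"] by auto
  then have iv: "integrable (lebP d) v" by (simp add: moll_tendsto_def)
  have "\<forall>\<^sub>F n in sequentially. (LINT z|lebP d. \<bar>moll d (e n) v z - v z\<bar>) < r / 4"
    using v(1) \<open>r > 0\<close> unfolding moll_tendsto_def by (intro order_tendstoD(2)) auto
  then obtain N where N: "\<And>n. n \<ge> N \<Longrightarrow> (LINT z|lebP d. \<bar>moll d (e n) v z - v z\<bar>) < r / 4"
    unfolding eventually_sequentially by blast
  show "\<exists>no. \<forall>n\<ge>no. norm ((LINT z|lebP d. \<bar>moll d (e n) u z - u z\<bar>) - 0) < r"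
  proof (intro exI[of _ N] allI impI)
    fix n assume n: "N \<le> n"
    let ?w = "\<lambda>x. u x - v x"
    have iw: "integrable (lebP d) ?w" using u iv by simp
    note ints = moll_L1(1)[OF e[of n] u] moll_L1(1)[OF e[of n] iv] moll_L1(1)[OF e[of n] iw] u iv iw
    have "(LINT z|lebP d. \<bar>moll d (e n) u z - u z\<bar>)
        \<le> (LINT z|lebP d. \<bar>moll d (e n) ?w z\<bar> + \<bar>moll d (e n) v z - v z\<bar> + \<bar>?w z\<bar>)"
      by (rule integral_mono) (use ints in \<open>auto simp: moll_diff[OF e u iv]\<close>)
    also have "\<dots> = (LINT z|lebP d. \<bar>moll d (e n) ?w z\<bar>) + (LINT z|lebP d. \<bar>moll d (e n) v z - v z\<bar>) + (LINT z|lebP d. \<bar>?w z\<bar>)"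
      using ints by simp
    also have "\<dots> < r / 4 + r / 4 + r / 4 + r / 4"
      using moll_L1(2)[OF e[of n] iw] N[OF n] v(2) \<open>r > 0\<close> by linarith
    finally show "norm ((LINT z|lebP d. \<bar>moll d (e n) u z - u z\<bar>) - 0) < r"
      by (simp add: integral_nonneg_AE)
  qed
qed

lemma moll_tendsto_add:
  assumes e: "\<And>n. e n > 0" and "moll_tendsto d e u" "moll_tendsto d e v"
  shows "moll_tendsto d e (\<lambda>x. u x + v x)"
proof -
  have i: "integrable (lebP d) u" "integrable (lebP d) v" using assms by (auto simp: moll_tendsto_def)
  have "(\<lambda>n. (LINT z|lebP d. \<bar>moll d (e n) u z - u z\<bar>) + (LINT z|lebP d. \<bar>moll d (e n) v z - v z\<bar>)) \<longlonglongrightarrow> 0 + 0"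
    using assms by (intro tendsto_add) (auto simp: moll_tendsto_def)
  then have lim: "(\<lambda>n. (LINT z|lebP d. \<bar>moll d (e n) u z - u z\<bar>) + (LINT z|lebP d. \<bar>moll d (e n) v z - v z\<bar>)) \<longlonglongrightarrow> 0" by simp
  have "(\<lambda>n. LINT z|lebP d. \<bar>moll d (e n) (\<lambda>x. u x + v x) z - (u z + v z)\<bar>) \<longlonglongrightarrow> 0"
  proof (rule tendsto_sandwich[OF _ _ tendsto_const lim])
    have "(LINT z|lebP d. \<bar>moll d (e n) (\<lambda>x. u x + v x) z - (u z + v z)\<bar>)
      \<le> (LINT z|lebP d. \<bar>moll d (e n) u z - u z\<bar> + \<bar>moll d (e n) v z - v z\<bar>)" for n
      by (rule integral_mono) (use i moll_L1(1)[OF e] in \<open>auto simp: moll_add[OF e i]\<close>)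
    then show "\<forall>\<^sub>F n in sequentially. (LINT z|lebP d. \<bar>moll d (e n) (\<lambda>x. u x + v x) z - (u z + v z)\<bar>)
      \<le> (LINT z|lebP d. \<bar>moll d (e n) u z - u z\<bar>) + (LINT z|lebP d. \<bar>moll d (e n) v z - v z\<bar>)"
      using i moll_L1(1)[OF e] by simp
  qed (auto intro!: always_eventually integral_nonneg_AE)
  with i show ?thesis by (simp add: moll_tendsto_def)
qed

lemma moll_tendsto_cmult:
  assumes "moll_tendsto d e u"
  shows "moll_tendsto d e (\<lambda>x. c * u x)"
proof -
  have "moll d (e n) (\<lambda>x. c * u x) z = c * moll d (e n) u z" for n z
    by (simp add: moll_def mult.assoc)
  then have "(LINT z|lebP d. \<bar>moll d (e n) (\<lambda>x. c * u x) z - c * u z\<bar>) = \<bar>c\<bar> * (LINT z|lebP d. \<bar>moll d (e n) u z - u z\<bar>)" for n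
    by (simp add: abs_mult[symmetric] right_diff_distrib flip: integral_mult_right_zero)
  moreover have "(\<lambda>n. \<bar>c\<bar> * (LINT z|lebP d. \<bar>moll d (e n) u z - u z\<bar>)) \<longlonglongrightarrow> \<bar>c\<bar> * 0"
    using assms by (intro tendsto_intros) (auto simp: moll_tendsto_def)
  ultimately show ?thesis using assms by (simp add: moll_tendsto_def)
qed

text \<open>Mollification preserves the integral, so the mass that leaves \<open>G\<close> equals the mass missing
  inside \<open>G\<close>, and only pointwise convergence at interior points is needed.\<close>

lemma moll_tendsto_indicator_open:
  assumes e: "\<And>n. e n > 0" "e \<longlonglongrightarrow> 0"
    and F: "\<And>j. j < d \<Longrightarrow> open (F j)" and G: "G = PiE {..<d} F" and fin: "emeasure (lebP d) G < \<infinity>"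
  shows "moll_tendsto d e (indicator G)"
proof -
  have Gs [measurable]: "G \<in> sets (lebP d)" unfolding G using F by (intro sets_PiM_I_finite) auto
  let ?m = "\<lambda>n. moll d (e n) (indicator G :: _ \<Rightarrow> real)"
  have iG: "integrable (lebP d) (indicator G :: _ \<Rightarrow> real)" using fin by (intro integrable_real_indicator) auto
  have m0: "0 \<le> ?m n z" for n z unfolding moll_def using kern_nonneg[OF e(1)] by (intro integral_nonneg_AE) auto
  have m1: "?m n z \<le> 1" for n z
  proof -
    have "?m n z \<le> (LINT y|lebP d. kern d (e n) z y)" unfolding moll_def
      by (rule integral_mono[OF moll_integrable_kern(1)[OF e(1) iG] kern_integral(1)[OF e(1)]])
         (use kern_nonneg[OF e(1)] in \<open>auto simp: indicator_def\<close>)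
    then show ?thesis using kern_integral(2)[OF e(1)] by simp
  qed
  \<comment> \<open>At a point of G the value is exactly 1 as soon as the kernel cube fits into the
    intervals around its finitely many coordinates.\<close>
  have ptw: "(\<lambda>n. ?m n z) \<longlonglongrightarrow> 1" if z: "z \<in> G" for z
  proof (rule tendsto_eventually)
    have "\<exists>r>0. ball (z j) r \<subseteq> F j" if "j < d" for j
      using F[OF that] z that open_contains_ball[of "F j"] by (auto simp: G)
    then obtain r where r: "\<And>j. j < d \<Longrightarrow> r j > 0 \<and> ball (z j) (r j) \<subseteq> F j" by metis
    have "\<forall>\<^sub>F n in sequentially. \<forall>j\<in>{..<d}. e n < r j"
      using r order_tendstoD(2)[OF e(2)] by (intro eventually_ball_finite) auto
    then show "\<forall>\<^sub>F n in sequentially. ?m n z = 1"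
    proof eventually_elim
      case (elim n)
      have "indicator G y * kern d (e n) z y = kern d (e n) z y" if y: "y \<in> space (lebP d)" for y
      proof (cases "\<forall>j<d. \<bar>z j - y j\<bar> < e n")
        case True
        have "y j \<in> F j" if "j < d" for j
        proof -
          have "\<bar>z j - y j\<bar> < r j" using True elim that by force
          then show ?thesis using r[OF that] by (auto simp: dist_real_def)
        qed
        then have "y \<in> G" using y by (auto simp: G space_PiM PiE_def)
        then show ?thesis by simp
      next
        case False
        then obtain j where "j < d" "e n \<le> \<bar>z j - y j\<bar>" by (auto simp: not_less)
        then have "kern d (e n) z y = 0" by (rule kern_eq_0[OF e(1)])
        then show ?thesis by simp
      qed
      then have "?m n z = (LINT y|lebP d. kern d (e n) z y)"
        unfolding moll_def by (intro Bochner_Integration.integral_cong) auto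
      then show ?case using kern_integral(2)[OF e(1)] by simp
    qed
  qed
  have tot: "(LINT z|lebP d. ?m n z) = measure (lebP d) G" for n
  proof -
    have "ennreal (LINT z|lebP d. ?m n z) = (\<integral>\<^sup>+z. ennreal (?m n z) \<partial>lebP d)"
      using m0 moll_L1(1)[OF e(1) iG] by (intro nn_integral_eq_integral[symmetric]) auto
    also have "\<dots> = (\<integral>\<^sup>+z. \<integral>\<^sup>+y. indicator G y * ennreal (kern d (e n) z y) \<partial>lebP d \<partial>lebP d)"
    proof (rule nn_integral_cong)
      fix z
      have "ennreal (?m n z) = (\<integral>\<^sup>+y. ennreal (indicator G y * kern d (e n) z y) \<partial>lebP d)"
        unfolding moll_def using kern_nonneg[OF e(1)] moll_integrable_kern(1)[OF e(1) iG]
        by (intro nn_integral_eq_integral[symmetric]) auto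
      then show "ennreal (?m n z) = (\<integral>\<^sup>+y. indicator G y * ennreal (kern d (e n) z y) \<partial>lebP d)"
        by (simp add: ennreal_mult' ennreal_indicator)
    qed
    also have "\<dots> = emeasure (lebP d) G"
      by (subst nn_integral_kern_swap[OF e(1)]) auto
    also have "\<dots> = ennreal (measure (lebP d) G)" using fin by (simp add: emeasure_eq_ennreal_measure top.not_eq_extremum)
    finally show ?thesis using m0 by (simp add: integral_nonneg_AE)
  qed
  have eq: "(LINT z|lebP d. \<bar>?m n z - indicator G z\<bar>) = (LINT z|lebP d. 2 * (indicator G z * (1 - ?m n z)))" for n
  proof -
    have i: "integrable (lebP d) (\<lambda>z. indicator G z * ?m n z)"
      using integrable_mult_bounded[OF moll_L1(1)[OF e(1) iG], of "indicator G" 1 n] by (simp add: mult.commute)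
    have "(LINT z|lebP d. \<bar>?m n z - indicator G z\<bar>) = (LINT z|lebP d. ?m n z + indicator G z - 2 * (indicator G z * ?m n z))"
      using m0 m1 by (intro Bochner_Integration.integral_cong) (auto simp: indicator_def)
    also have "\<dots> = 2 * measure (lebP d) G - 2 * (LINT z|lebP d. indicator G z * ?m n z)"
      using i iG moll_L1(1)[OF e(1) iG] tot by simp
    also have "\<dots> = (LINT z|lebP d. 2 * (indicator G z * (1 - ?m n z)))"
      using i iG by (simp add: right_diff_distrib)
    finally show ?thesis .
  qed
  have "(\<lambda>n. LINT z|lebP d. 2 * (indicator G z * (1 - ?m n z))) \<longlonglongrightarrow> (LINT z|lebP d. 0)"
  proof (rule integral_dominated_convergence[where w = "\<lambda>z. 2 * indicator G z"])
    show "AE z in lebP d. (\<lambda>n. 2 * (indicator G z * (1 - ?m n z))) \<longlonglongrightarrow> 0"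
    proof (rule AE_I2)
      fix z
      show "(\<lambda>n. 2 * (indicator G z * (1 - ?m n z))) \<longlonglongrightarrow> 0"
        using ptw[of z] by (cases "z \<in> G") (auto intro!: tendsto_eq_intros)
    qed
    show "AE z in lebP d. norm (2 * (indicator G z * (1 - ?m n z))) \<le> 2 * indicator G z" for n
      using m0[of n] m1[of n] by (intro AE_I2) (simp add: indicator_def)
  qed (use iG in auto)
  then show ?thesis unfolding moll_tendsto_def eq using iG by simp
qed

text \<open>A Dynkin argument over products of open sets. Complements leave the integrable
  indicators, so the induction runs on the intersections with a fixed bounded cube; the set itself
  is then an increasing union.\<close>

lemma moll_tendsto_indicator:
  assumes e: "\<And>n. e n > 0" "e \<longlonglongrightarrow> 0" and A: "A \<in> sets (lebP d)" "emeasure (lebP d) A < \<infinity>"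
  shows "moll_tendsto d e (indicator A)"
proof -
  let ?E = "\<lambda>_::nat. Collect open :: real set set"
  define P where "P = {PiE {..<d} F | F. \<forall>i\<in>{..<d}. F i \<in> ?E i}"
  \<comment> \<open>The half-width m + 1 makes the open interval contain every t with |t| <= m,
    including the endpoints.\<close>
  define U where "U = (\<lambda>m::nat. PiE {..<d} (\<lambda>_. {- real m - 1<..<real m + 1}))"
  interpret product_sigma_finite "\<lambda>_::nat. lborel :: real measure" ..
  have Us [measurable]: "U m \<in> sets (lebP d)" for m unfolding U_def by (intro sets_PiM_I_finite) auto
  have Ufin: "emeasure (lebP d) (U m) < \<infinity>" for m
  proof -
    have "emeasure (lebP d) (U m) = (\<Prod>j<d. emeasure lborel {- real m - 1<..<real m + 1})"
      unfolding U_def by (rule emeasure_PiM) auto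
    also have "emeasure lborel {- real m - 1<..<real m + 1} = ennreal (2 * real m + 2)"
      by (subst emeasure_lborel_Ioo) (auto simp: algebra_simps)
    finally show ?thesis by (simp add: ennreal_power del: ennreal_plus)
  qed
  have Psub: "P \<subseteq> Pow (space (lebP d))" by (auto simp: P_def space_PiM PiE_def)
  have gen: "sets (lebP d) = sigma_sets (space (lebP d)) P"
  proof -
    have "sets (lebP d) = sets (Pi\<^sub>M {..<d} (\<lambda>_. sigma UNIV (Collect open :: real set set)))"
      by (rule sets_PiM_cong) (auto simp: borel_def)
    also have "\<dots> = sets (sigma (\<Pi>\<^sub>E i\<in>{..<d}. UNIV)
        {{f \<in> (\<Pi>\<^sub>E i\<in>{..<d}. UNIV). \<forall>i\<in>j. f i \<in> A i} | A j. j \<in> {{..<d}} \<and> A \<in> Pi j (\<lambda>_. Collect open)})"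
      by (rule sets_PiM_sigma) (auto intro!: exI[of _ "{UNIV}"])
    also have "{{f \<in> (\<Pi>\<^sub>E i\<in>{..<d}. UNIV). \<forall>i\<in>j. f i \<in> A i} | A j. j \<in> {{..<d}} \<and> A \<in> Pi j (\<lambda>_. Collect open)} = P"
    proof -
      have "{f \<in> (\<Pi>\<^sub>E i\<in>{..<d}. UNIV). \<forall>i\<in>{..<d}. f i \<in> A i} = PiE {..<d} A" for A :: "nat \<Rightarrow> real set"
        by auto
      then show ?thesis unfolding P_def by (auto simp: Pi_iff)
    qed
    also have "sets (sigma (\<Pi>\<^sub>E i\<in>{..<d}. UNIV) P) = sigma_sets (space (lebP d)) P"
      using Psub by (simp add: space_PiM)
    finally show ?thesis .
  qed
  have Istab: "Int_stable P"
  proof (rule Int_stableI)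
    fix A B assume "A \<in> P" "B \<in> P"
    then obtain F G where "A = PiE {..<d} F" "B = PiE {..<d} G" "\<And>i. i < d \<Longrightarrow> open (F i) \<and> open (G i)"
      by (auto simp: P_def)
    then show "A \<inter> B \<in> P" unfolding P_def by (auto simp: PiE_Int intro!: exI[of _ "\<lambda>i. F i \<inter> G i"])
  qed
  have Um: "moll_tendsto d e (indicator (U m))" for m
    by (rule moll_tendsto_indicator_open[OF e _ U_def[THEN fun_cong] Ufin]) simp
  \<comment> \<open>The L1 distance of the indicators of nested sets is the measure of the
    difference, which tends to 0 because \<open>Z\<close> has finite measure.\<close>
  have increasing: "moll_tendsto d e (indicator Z)"
    if Y: "\<And>k. Y k \<in> sets (lebP d)" "\<And>k. Y k \<subseteq> Z" "(\<Union>k. Y k) = Z" "incseq Y" "\<And>k. moll_tendsto d e (indicator (Y k))"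
      and Z: "Z \<in> sets (lebP d)" "emeasure (lebP d) Z < \<infinity>" for Y :: "nat \<Rightarrow> (nat \<Rightarrow> real) set" and Z
  proof (rule moll_tendsto_closed[OF e(1)])
    show "integrable (lebP d) (indicator Z :: _ \<Rightarrow> real)" using Z by (intro integrable_real_indicator) auto
    fix \<delta> :: real assume "\<delta> > 0"
    have "(\<lambda>k. measure (lebP d) (Y k)) \<longlonglongrightarrow> measure (lebP d) (\<Union>k. Y k)"
      by (rule Lim_measure_incseq) (use Y Z in auto)
    then have "(\<lambda>k. measure (lebP d) (Y k)) \<longlonglongrightarrow> measure (lebP d) Z" using Y(3) by simp
    from order_tendstoD(1)[OF this, of "measure (lebP d) Z - \<delta>"] \<open>\<delta> > 0\<close>
    obtain k where k: "measure (lebP d) Z - \<delta> < measure (lebP d) (Y k)"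
      by (auto simp: eventually_sequentially)
    have "(LINT z|lebP d. \<bar>indicator Z z - indicator (Y k) z :: real\<bar>) = (LINT z|lebP d. indicator (Z - Y k) z)"
      using Y(2)[of k] by (intro Bochner_Integration.integral_cong) (auto simp: indicator_def)
    also have "\<dots> = measure (lebP d) (Z - Y k)"
      using sets.sets_into_space[OF Z(1)] by (simp add: Int_absorb2 Diff_subset[THEN order_trans])
    also have "\<dots> = measure (lebP d) Z - measure (lebP d) (Y k)"
      using Y Z by (intro measure_Diff) auto
    finally show "\<exists>v. moll_tendsto d e v \<and> (LINT z|lebP d. \<bar>indicator Z z - v z\<bar>) \<le> \<delta>"
      using k Y(5)[of k] by (intro exI[of _ "indicator (Y k)"]) simp
  qed
  have bounded: "moll_tendsto d e (indicator (A \<inter> U m))" if "A \<in> sets (lebP d)" for A m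
    using Istab Psub that[unfolded gen]
  proof (induction rule: sigma_sets_induct_disjoint)
    case (basic X)
    then obtain F where F: "X = PiE {..<d} F" "\<And>i. i < d \<Longrightarrow> open (F i)" by (auto simp: P_def)
    show ?case
    proof (rule moll_tendsto_indicator_open[OF e, where F = "\<lambda>i. F i \<inter> {- real m - 1<..<real m + 1}"])
      show "X \<inter> U m = PiE {..<d} (\<lambda>i. F i \<inter> {- real m - 1<..<real m + 1})"
        unfolding F U_def by (simp add: PiE_Int)
      show "emeasure (lebP d) (X \<inter> U m) < \<infinity>"
        by (rule le_less_trans[OF emeasure_mono Ufin]) auto
    qed (use F in auto)
  next
    case empty
    then show ?case by (simp add: moll_tendsto_def moll_def)
  next
    case (compl X)
    have "U m \<subseteq> space (lebP d)" using sets.sets_into_space[OF Us] .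
    then have "indicator ((space (lebP d) - X) \<inter> U m) = (\<lambda>x. indicator (U m) x + - 1 * indicator (X \<inter> U m) x :: real)"
      by (auto simp: indicator_def fun_eq_iff)
    moreover have "moll_tendsto d e (\<lambda>x. indicator (U m) x + - 1 * indicator (X \<inter> U m) x)"
      by (rule moll_tendsto_add[OF e(1) Um moll_tendsto_cmult[OF compl.IH]])
    ultimately show ?case by simp
  next
    case (union X)
    have X [measurable]: "X i \<in> sets (lebP d)" for i using union.hyps(2) unfolding gen by blast
    define Y where "Y = (\<lambda>k. (\<Union>i<k. X i) \<inter> U m)"
    define Z where "Z = (\<Union>i. X i) \<inter> U m"
    have [measurable]: "Y k \<in> sets (lebP d)" "Z \<in> sets (lebP d)" for k by (auto simp: Y_def Z_def)
    have YZ: "Y k \<subseteq> Z" for k by (auto simp: Y_def Z_def)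
    have Yk: "moll_tendsto d e (indicator (Y k))" for k
    proof (induction k)
      case 0 then show ?case by (simp add: Y_def moll_tendsto_def moll_def)
    next
      case (Suc k)
      have "X k \<inter> X i = {}" if "i < k" for i using union.hyps(1) that by (auto simp: disjoint_family_on_def)
      then have "X k \<inter> (\<Union>i<k. X i) = {}" by blast
      then have "indicator (Y (Suc k)) = (\<lambda>x. indicator (Y k) x + indicator (X k \<inter> U m) x :: real)"
        by (auto simp: indicator_def fun_eq_iff Y_def lessThan_Suc)
      then show ?case using moll_tendsto_add[OF e(1) Suc union.IH] by simp
    qed
    have Zfin: "emeasure (lebP d) Z < \<infinity>" by (rule le_less_trans[OF emeasure_mono Ufin[of m]]) (auto simp: Z_def)
    have "moll_tendsto d e (indicator Z)"
    proof (rule increasing[OF _ YZ])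
      show "(\<Union>k. Y k) = Z" by (auto simp: Y_def Z_def)
      show "incseq Y" unfolding incseq_def Y_def by (intro allI impI Int_mono UN_mono) auto
    qed (use Yk Zfin in auto)
    then show ?case by (simp add: Z_def)
  qed
  have "moll_tendsto d e (indicator A)"
  proof (rule increasing[where Y = "\<lambda>m. A \<inter> U m"])
    show "(\<Union>m. A \<inter> U m) = A"
    proof -
      have "\<exists>m. x \<in> U m" if "x \<in> A" for x
      proof -
        obtain m :: nat where m: "(\<Sum>j<d. \<bar>x j\<bar>) \<le> m" using real_arch_simple by blast
        have "\<bar>x j\<bar> \<le> m" if "j < d" for j
          using m member_le_sum[of j "{..<d}" "\<lambda>j. \<bar>x j\<bar>"] that by auto
        then show ?thesis using sets.sets_into_space[OF A(1)] \<open>x \<in> A\<close>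
          by (intro exI[of _ m]) (fastforce simp: U_def space_PiM PiE_def abs_le_iff)
      qed
      then show ?thesis by blast
    qed
    show "incseq (\<lambda>m. A \<inter> U m)"
      unfolding incseq_def U_def by (intro allI impI Int_mono PiE_mono order_refl) auto
  qed (use A bounded in auto)
  then show ?thesis .
qed

theorem moll_tendsto_integrable:
  assumes e: "\<And>n. e n > 0" "e \<longlonglongrightarrow> 0" and u: "integrable (lebP d) u"
  shows "moll_tendsto d e u"
  using u
proof (induction rule: integrable_induct)
  case (base A c)
  then show ?case using moll_tendsto_cmult[OF moll_tendsto_indicator[OF e]] by (simp add: mult.commute)
next
  case (add f g)
  then show ?case by (intro moll_tendsto_add e) auto
next
  case (lim f s)
  have [measurable]: "integrable (lebP d) (s i)" for i by (rule lim.hyps)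
  show ?case
  proof (rule moll_tendsto_closed[OF e(1) lim.hyps(4)])
    fix \<delta> :: real assume "\<delta> > 0"
    have "(\<lambda>i. LINT z|lebP d. \<bar>f z - s i z\<bar>) \<longlonglongrightarrow> (LINT z|lebP d. 0)"
    \<comment> \<open>The simple functions from \<open>integrable_induct\<close> satisfy |s i| <= 2
      |f|, hence the 3.\<close>
    proof (rule integral_dominated_convergence[where w = "\<lambda>z. 3 * \<bar>f z\<bar>"])
      show "AE z in lebP d. (\<lambda>i. \<bar>f z - s i z\<bar>) \<longlonglongrightarrow> 0"
      proof (rule AE_I2)
        fix z assume "z \<in> space (lebP d)"
        then have "(\<lambda>i. \<bar>f z - s i z\<bar>) \<longlonglongrightarrow> \<bar>f z - f z\<bar>" using lim.hyps(2) by (intro tendsto_intros) auto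
        then show "(\<lambda>i. \<bar>f z - s i z\<bar>) \<longlonglongrightarrow> 0" by simp
      qed
      show "AE z in lebP d. norm \<bar>f z - s i z\<bar> \<le> 3 * \<bar>f z\<bar>" for i
        using lim.hyps(3)[of _ i] by (intro AE_I2) fastforce
    qed (use lim.hyps in auto)
    then obtain i where "(LINT z|lebP d. \<bar>f z - s i z\<bar>) < \<delta>"
      using order_tendstoD(2)[of _ 0 sequentially \<delta>] \<open>\<delta> > 0\<close> by (fastforce simp: eventually_sequentially)
    then show "\<exists>v. moll_tendsto d e v \<and> (LINT z|lebP d. \<bar>f z - v z\<bar>) \<le> \<delta>"
      using lim.IH by (intro exI[of _ "s i"]) auto
  qed
qed

section \<open>Weakly differentiable functions\<close>

lemma openin_euclid_box:
  assumes "openin (euclid d) S" "x \<in> S"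
  shows "\<exists>r>0. cube d x r \<subseteq> S"
proof -
  obtain U where U: "\<forall>i\<in>{..<d}. openin euclideanreal (U i)" "x \<in> PiE {..<d} U" "PiE {..<d} U \<subseteq> S"
    using assms unfolding euclid_def openin_product_topology_alt by metis
  have "\<exists>r>0. cball (x j) r \<subseteq> U j" if "j < d" for j
    using U that by (intro iffD1[OF open_contains_cball, rule_format]) auto
  then obtain r where r: "\<And>j. j < d \<Longrightarrow> r j > 0 \<and> cball (x j) (r j) \<subseteq> U j" by metis
  \<comment> \<open>The inserted 1 keeps the minimum meaningful when d = 0.\<close>
  define \<rho> where "\<rho> = Min (insert 1 (r ` {..<d}))"
  have "\<rho> > 0" unfolding \<rho>_def using r by (subst Min_gr_iff) auto
  have "{x j - \<rho>..x j + \<rho>} \<subseteq> U j" if "j < d" for j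
  proof
    fix t assume "t \<in> {x j - \<rho>..x j + \<rho>}"
    moreover have "\<rho> \<le> r j" unfolding \<rho>_def using that by (intro Min_le) auto
    ultimately have "\<bar>x j - t\<bar> \<le> r j" by auto
    then show "t \<in> U j" using r[OF that] by (auto simp: dist_real_def)
  qed
  then have "cube d x \<rho> \<subseteq> PiE {..<d} U" by (intro PiE_mono) auto
  from order_trans[OF this U(3)] \<open>\<rho> > 0\<close> show ?thesis by (intro exI[of _ \<rho>] conjI)
qed

text \<open>An open set is a union of boxes with rational corners, and these are countable in number
  because corners are extensional functions on a finite set. This links the product topology to the
  product sigma-algebra.\<close>

lemma openin_euclid_sets:
  assumes "openin (euclid d) U"
  shows "U \<in> sets (lebP d)"
proof -
  let ?Q = "PiE {..<d} (\<lambda>_. \<rat>) :: (nat \<Rightarrow> real) set"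
  let ?B = "\<lambda>p. PiE {..<d} (\<lambda>j. {fst p j<..<snd p j :: real})"
  have "countable ?Q" by (intro countable_PiE) (auto simp: countable_rat)
  then have cnt: "countable {p \<in> ?Q \<times> ?Q. ?B p \<subseteq> U}" by (intro countable_Collect) auto
  have "U = (\<Union>p\<in>{p \<in> ?Q \<times> ?Q. ?B p \<subseteq> U}. ?B p)"
  proof (intro equalityI subsetI)
    fix x assume x: "x \<in> U"
    then obtain r where r: "r > 0" "cube d x r \<subseteq> U"
      using openin_euclid_box[OF assms] by blast
    have ext: "x \<in> extensional {..<d}" using openin_subset[OF assms] x by (auto simp: topspace_euclid)
    have "\<exists>a\<in>\<rat>. x j - r < a \<and> a < x j" "\<exists>b\<in>\<rat>. x j < b \<and> b < x j + r" for j
      using r(1) by (auto intro!: Rats_dense_in_real)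
    then obtain a b where ab: "\<And>j. a j \<in> \<rat> \<and> x j - r < a j \<and> a j < x j" "\<And>j. b j \<in> \<rat> \<and> x j < b j \<and> b j < x j + r"
      by metis
    let ?p = "(restrict a {..<d}, restrict b {..<d})"
    have "?B ?p \<subseteq> cube d x r"
    proof (rule PiE_mono)
      fix j assume "j \<in> {..<d}"
      then show "{fst ?p j<..<snd ?p j} \<subseteq> {x j - r..x j + r}" using ab(1)[of j] ab(2)[of j] by auto
    qed
    then have "?B ?p \<subseteq> U" using r(2) by (rule order_trans)
    moreover have x': "x \<in> ?B ?p" using ext ab by (auto simp: PiE_def)
    moreover have "?p \<in> ?Q \<times> ?Q" using ab by auto
    ultimately have "?p \<in> {p \<in> ?Q \<times> ?Q. ?B p \<subseteq> U}" by (intro CollectI conjI)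
    then show "x \<in> (\<Union>p\<in>{p \<in> ?Q \<times> ?Q. ?B p \<subseteq> U}. ?B p)" using x' by (rule UN_I)
  qed auto
  also have "\<dots> \<in> sets (lebP d)"
    using cnt by (intro sets.countable_UN') (auto intro!: sets_PiM_I_finite)
  finally show ?thesis .
qed

text \<open>The erosion of the domain: at these points a mollifier of smaller radius sees only
  values from inside. Cubes are used because the kernel is supported in a cube.\<close>

definition inner_set :: "nat \<Rightarrow> (nat \<Rightarrow> real) set \<Rightarrow> real \<Rightarrow> (nat \<Rightarrow> real) set" where
  "inner_set d \<Omega> r = {x \<in> extensional {..<d}. open_cube d x r \<subseteq> \<Omega>}"

text \<open>By symmetry of the cube relation, a point fails to belong exactly when it lies in the
  open cube about some point outside the domain; the union of those cubes is open.\<close>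

lemma inner_set_sets: "inner_set d \<Omega> r \<in> sets (lebP d)"
proof -
  let ?W = "\<Union>y\<in>extensional {..<d} - \<Omega>. open_cube d y r"
  have "openin (euclid d) ?W"
    unfolding euclid_def by (intro openin_Union) (auto simp: openin_PiE)
  then have "extensional {..<d} - ?W \<in> sets (lebP d)"
    using sets.compl_sets[OF openin_euclid_sets] by (simp add: space_PiM PiE_def)
  also have "extensional {..<d} - ?W = inner_set d \<Omega> r"
  proof -
    have sym: "(y \<in> open_cube d x r) = (x \<in> open_cube d y r)"
      if "x \<in> extensional {..<d}" "y \<in> extensional {..<d}" for x y :: "nat \<Rightarrow> real"
    proof -
      have "y j \<in> {x j - r<..<x j + r} \<longleftrightarrow> x j \<in> {y j - r<..<y j + r}" for j by auto
      then show ?thesis using that by (simp only: PiE_iff)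
    qed
    show ?thesis
    proof (intro equalityI subsetI)
      fix x assume x: "x \<in> extensional {..<d} - ?W"
      have "y \<in> \<Omega>" if y: "y \<in> open_cube d x r" for y
      proof (rule ccontr)
        assume "y \<notin> \<Omega>"
        moreover have "y \<in> extensional {..<d}" using y by (simp add: PiE_def)
        ultimately show False using x y sym[of x y] by blast
      qed
      then show "x \<in> inner_set d \<Omega> r" using x by (auto simp: inner_set_def)
    next
      fix x assume x: "x \<in> inner_set d \<Omega> r"
      then show "x \<in> extensional {..<d} - ?W"
        using sym[of x] unfolding inner_set_def by blast
    qed
  qed
  finally show ?thesis .
qed

lemma inner_set_subset: "r > 0 \<Longrightarrow> inner_set d \<Omega> r \<subseteq> \<Omega>"
proof
  fix x assume "r > 0" "x \<in> inner_set d \<Omega> r"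
  moreover then have "x \<in> open_cube d x r" by (auto simp: inner_set_def PiE_def)
  ultimately show "x \<in> \<Omega>" by (auto simp: inner_set_def)
qed

text \<open>The offset of a point w from the centre z of its cube is added to x and to y. Both
  shifted points lie in the domain, and w is their convex combination.\<close>

lemma inner_set_econvex:
  assumes "econvex d \<Omega>"
  shows "econvex d (inner_set d \<Omega> r)"
  unfolding econvex_def
proof (intro ballI)
  fix x y t assume x: "x \<in> inner_set d \<Omega> r" and y: "y \<in> inner_set d \<Omega> r" and t: "t \<in> {0..1::real}"
  let ?z = "\<lambda>i\<in>{..<d}. (1 - t) * x i + t * y i"
  have "w \<in> \<Omega>" if w: "w \<in> open_cube d ?z r" for w
  proof -
    let ?p = "\<lambda>i\<in>{..<d}. x i + (w i - ?z i)" and ?q = "\<lambda>i\<in>{..<d}. y i + (w i - ?z i)"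
    have wb: "?z j - r < w j \<and> w j < ?z j + r" if "j < d" for j using w that by (auto simp: PiE_def Pi_iff)
    have "?p \<in> open_cube d x r" "?q \<in> open_cube d y r"
      using wb by (auto simp: PiE_def Pi_iff) (smt (verit))+
    moreover have "open_cube d x r \<subseteq> \<Omega>" "open_cube d y r \<subseteq> \<Omega>"
      using x y by (simp_all add: inner_set_def)
    ultimately have "?p \<in> \<Omega>" "?q \<in> \<Omega>" by blast+
    then have "(\<lambda>i\<in>{..<d}. (1 - t) * ?p i + t * ?q i) \<in> \<Omega>"
      using assms t unfolding econvex_def by blast
    also have "(\<lambda>i\<in>{..<d}. (1 - t) * ?p i + t * ?q i) = w"
    proof
      fix i show "(\<lambda>i\<in>{..<d}. (1 - t) * ?p i + t * ?q i) i = w i"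
        using w by (cases "i < d") (auto simp: algebra_simps PiE_def extensional_def)
    qed
    finally show ?thesis .
  qed
  then show "?z \<in> inner_set d \<Omega> r" by (auto simp: inner_set_def)
qed

text \<open>On the eroded sets \<open>A n\<close> the mollified function satisfies the Taylor
  estimate whose coefficients are the mollified \<open>g i\<close>, so the smooth inequality
  applies. The right side is bounded uniformly in n by L2 contraction, the left side passes to the
  limit by Fatou. Stated with \<open>ennreal\<close> values, the bound includes the square
  integrability of u - c on the domain.\<close>

lemma poincare_weak:
  fixes u :: "(nat \<Rightarrow> real) \<Rightarrow> real" and g :: "nat \<Rightarrow> (nat \<Rightarrow> real) \<Rightarrow> real"
  assumes R: "R > 0" and op: "openin (euclid d) \<Omega>" and cvx: "econvex d \<Omega>" and fin: "emeasure (lebP d) \<Omega> < \<infinity>"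
    and diam: "\<And>x y. x \<in> \<Omega> \<Longrightarrow> y \<in> \<Omega> \<Longrightarrow> edist d x y \<le> R"
    and u: "integrable (lebP d) u" and g: "\<And>i. i < d \<Longrightarrow> integrable (lebP d) (g i)"
    and g2: "\<And>i. i < d \<Longrightarrow> integrable (lebP d) (\<lambda>x. (g i x)\<^sup>2)"
    and weak: "\<And>e z i. e > 0 \<Longrightarrow> i < d \<Longrightarrow> cube d z e \<subseteq> \<Omega> \<Longrightarrow>
      (LINT y|lebP d. u y * dkern d e i z y) = (LINT y|lebP d. g i y * kern d e z y)"
  shows "\<exists>c. (\<integral>\<^sup>+x\<in>\<Omega>. ennreal ((u x - c)\<^sup>2) \<partial>lebP d) \<le> ennreal (2 * R\<^sup>2 * (\<Sum>i<d. LINT x|lebP d. (g i x)\<^sup>2))"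
proof (cases "measure (lebP d) \<Omega> = 0")
  case True
  have "\<Omega> \<in> null_sets (lebP d)"
    using True fin openin_euclid_sets[OF op] by (auto simp: null_sets_def measure_def enn2real_eq_0_iff)
  then have "AE x in lebP d. x \<notin> \<Omega>" by (rule AE_not_in)
  then have "(\<integral>\<^sup>+x\<in>\<Omega>. ennreal ((u x - 0)\<^sup>2) \<partial>lebP d) = (\<integral>\<^sup>+x. 0 \<partial>lebP d)"
    by (intro nn_integral_cong_AE) auto
  then show ?thesis by (intro exI[of _ 0]) simp
next
  case False
  have \<Omega>s [measurable]: "\<Omega> \<in> sets (lebP d)" by (rule openin_euclid_sets[OF op])
  have um [measurable]: "u \<in> borel_measurable (lebP d)" using u by simp
  have gm [measurable]: "g i \<in> borel_measurable (lebP d)" if "i < d" for i using g[OF that] by simp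
  define \<delta> where "\<delta> = (\<lambda>n::nat. 1 / real (Suc n))"
  \<comment> \<open>Strictly below \<open>\<delta> n\<close>, so that the closed support cube of the
    kernel fits into the open cube of \<open>inner_set\<close>.\<close>
  define e where "e = (\<lambda>n. \<delta> n / 2)"
  have \<delta>: "\<delta> n > 0" for n by (simp add: \<delta>_def)
  have e: "e n > 0" "e n < \<delta> n" for n using \<delta>[of n] by (auto simp: e_def)
  have \<delta>0: "\<delta> \<longlonglongrightarrow> 0" unfolding \<delta>_def by (rule LIMSEQ_inverse_real_of_nat[unfolded inverse_eq_divide])
  then have e0: "e \<longlonglongrightarrow> 0" unfolding e_def by (auto intro!: tendsto_eq_intros)
  define A where "A = (\<lambda>n. inner_set d \<Omega> (\<delta> n))"
  have As [measurable]: "A n \<in> sets (lebP d)" for n unfolding A_def by (rule inner_set_sets)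
  have A\<Omega>: "A n \<subseteq> \<Omega>" for n unfolding A_def by (rule inner_set_subset[OF \<delta>])
  have Afin: "emeasure (lebP d) (A n) < \<infinity>" for n by (rule le_less_trans[OF emeasure_mono[OF A\<Omega>] fin]) simp
  have Aev: "\<forall>\<^sub>F n in sequentially. x \<in> A n" if x: "x \<in> \<Omega>" for x
  proof -
    obtain r where r: "r > 0" "cube d x r \<subseteq> \<Omega>"
      using openin_euclid_box[OF op x] by blast
    have ext: "x \<in> extensional {..<d}" using openin_subset[OF op] x by (auto simp: topspace_euclid)
    have "\<forall>\<^sub>F n in sequentially. \<delta> n < r" using order_tendstoD(2)[OF \<delta>0 r(1)] .
    then show ?thesis
    proof eventually_elim
      case (elim n)
      have "open_cube d x (\<delta> n) \<subseteq> cube d x r"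
        using elim by (intro PiE_mono) auto
      then show ?case using r(2) ext by (auto simp: A_def inner_set_def)
    qed
  qed
  have Aind: "(\<lambda>n. indicator (A n) x :: real) \<longlonglongrightarrow> indicator \<Omega> x" for x
  proof (cases "x \<in> \<Omega>")
    case True
    show ?thesis
      by (rule tendsto_eventually, rule eventually_mono[OF Aev[OF True]]) (simp add: True)
  next
    case False
    then have "x \<notin> A n" for n using A\<Omega> by blast
    then show ?thesis using False by simp
  qed
  have box: "cube d z (e n) \<subseteq> \<Omega>" if "z \<in> A n" for z n
  proof -
    have "cube d z (e n) \<subseteq> open_cube d z (\<delta> n)"
      using e[of n] by (intro PiE_mono) auto
    then show ?thesis using that by (auto simp: A_def inner_set_def)
  qed
  define f where "f = (\<lambda>n. moll d (e n) u)"
  define h where "h = (\<lambda>n i. moll d (e n) (g i))"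
  have fm [measurable]: "f n \<in> borel_measurable (lebP d)" for n unfolding f_def by simp
  have hm [measurable]: "h n i \<in> borel_measurable (lebP d)" if "i < d" for n i unfolding h_def using gm[OF that] by simp
  define m where "m = (\<lambda>n. (LINT x:A n|lebP d. f n x) / measure (lebP d) (A n))"
  define T where "T = 2 * R\<^sup>2 * (\<Sum>i<d. LINT x|lebP d. (g i x)\<^sup>2)"
  have T0: "T \<ge> 0" unfolding T_def by (intro mult_nonneg_nonneg sum_nonneg) auto
  have h2: "integrable (lebP d) (\<lambda>x. (h n i x)\<^sup>2)" "(LINT x|lebP d. (h n i x)\<^sup>2) \<le> (LINT x|lebP d. (g i x)\<^sup>2)" if i: "i < d" for n i
  proof -
    have le: "(\<integral>\<^sup>+x. ennreal ((h n i x)\<^sup>2) \<partial>lebP d) \<le> ennreal (LINT x|lebP d. (g i x)\<^sup>2)"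
      unfolding h_def by (rule moll_L2[OF e(1) g[OF i] g2[OF i]])
    show "integrable (lebP d) (\<lambda>x. (h n i x)\<^sup>2)"
      by (rule integrableI_nonneg) (use le i in \<open>auto simp: le_less_trans[OF le]\<close>)
    then have "ennreal (LINT x|lebP d. (h n i x)\<^sup>2) \<le> ennreal (LINT x|lebP d. (g i x)\<^sup>2)"
      using le by (subst nn_integral_eq_integral[symmetric]) auto
    then show "(LINT x|lebP d. (h n i x)\<^sup>2) \<le> (LINT x|lebP d. (g i x)\<^sup>2)"
      by (simp add: ennreal_le_iff)
  qed
  have bound: "(\<integral>\<^sup>+x\<in>A n. ennreal ((f n x - m n)\<^sup>2) \<partial>lebP d) \<le> ennreal T" for n
  proof -
    obtain K where K: "K \<ge> 0" "\<And>z y. \<bar>kern d (e n) z y\<bar> \<le> K"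
      "\<And>z z' y. \<bar>kern d (e n) z' y - kern d (e n) z y - (\<Sum>i<d. dkern d (e n) i z y * (z' i - z i))\<bar> \<le> K * sqdist d z' z"
      by (rule kern_bounds[OF e(1)[of n], of d]) blast
    have mb: "\<bar>moll d (e n) w z\<bar> \<le> K * (LINT y|lebP d. \<bar>w y\<bar>)" if w: "integrable (lebP d) w" for w z
    proof -
      have "\<bar>moll d (e n) w z\<bar> \<le> (LINT y|lebP d. \<bar>w y * kern d (e n) z y\<bar>)"
        unfolding moll_def by (rule integral_abs_bound)
      also have "\<dots> \<le> (LINT y|lebP d. K * \<bar>w y\<bar>)"
      proof (rule integral_mono)
        show "\<bar>w y * kern d (e n) z y\<bar> \<le> K * \<bar>w y\<bar>" for y
          using mult_left_mono[OF K(2)[of z y], of "\<bar>w y\<bar>"] by (simp add: abs_mult mult.commute)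
      qed (use w moll_integrable_kern(1)[OF e(1) w] in auto)
      finally show ?thesis by simp
    qed
    define B where "B = K * (LINT y|lebP d. \<bar>u y\<bar>) + (\<Sum>i<d. K * (LINT y|lebP d. \<bar>g i y\<bar>))"
    have gnn: "0 \<le> K * (LINT y|lebP d. \<bar>w y\<bar>)" for w using K(1) by simp
    have fB: "\<bar>f n x\<bar> \<le> B" for x
    proof -
      have "0 \<le> (\<Sum>i<d. K * (LINT y|lebP d. \<bar>g i y\<bar>))" by (intro sum_nonneg gnn)
      then show ?thesis using mb[OF u, of x] unfolding f_def B_def by linarith
    qed
    have hB: "\<bar>h n i x\<bar> \<le> B" if "i < d" for i x
    proof -
      have "K * (LINT y|lebP d. \<bar>g i y\<bar>) \<le> (\<Sum>i<d. K * (LINT y|lebP d. \<bar>g i y\<bar>))"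
        by (rule member_le_sum) (use that gnn in auto)
      then show ?thesis using mb[OF g[OF that], of x] gnn[of u] unfolding h_def B_def by linarith
    qed
    \<comment> \<open>The quadratic estimate for the kernel, integrated against u. At a point of
      \<open>A n\<close> the kernel is an admissible test function, so \<open>weak\<close> shifts
      the derivative from the kernel to u and the coefficients become
      \<open>h n i x\<close>.\<close>
    have taylor: "f n y \<le> f n x + (\<Sum>i<d. h n i x * (y i - x i)) + (K * (LINT y|lebP d. \<bar>u y\<bar>)) * sqdist d y x"
      if x: "x \<in> A n" for x y
    proof -
      let ?r = "\<lambda>w. kern d (e n) y w - kern d (e n) x w - (\<Sum>i<d. dkern d (e n) i x w * (y i - x i))"
      note i1 = moll_integrable_kern(1)[OF e(1)[of n] u] and i2 = moll_integrable_kern(2)[OF e(1)[of n] u]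
      have eq: "u w * ?r w = u w * kern d (e n) y w - u w * kern d (e n) x w - (\<Sum>i<d. u w * dkern d (e n) i x w * (y i - x i))" for w
        by (simp add: right_diff_distrib sum_distrib_left mult.assoc)
      have i3: "integrable (lebP d) (\<lambda>w. u w * ?r w)"
        unfolding eq using i1 i2 by (intro Bochner_Integration.integrable_diff Bochner_Integration.integrable_sum integrable_mult_left) auto
      have "(LINT w|lebP d. u w * ?r w) = f n y - f n x - (\<Sum>i<d. (LINT w|lebP d. u w * dkern d (e n) i x w) * (y i - x i))"
        unfolding eq using i1 i2
        by (subst Bochner_Integration.integral_diff Bochner_Integration.integral_sum; (intro Bochner_Integration.integrable_diff Bochner_Integration.integrable_sum integrable_mult_left)?; simp add: f_def moll_def)+
      also have "(\<Sum>i<d. (LINT w|lebP d. u w * dkern d (e n) i x w) * (y i - x i)) = (\<Sum>i<d. h n i x * (y i - x i))"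
        using weak[OF e(1)[of n] _ box[OF x]] by (intro sum.cong) (auto simp: h_def moll_def)
      finally have "f n y - f n x - (\<Sum>i<d. h n i x * (y i - x i)) = (LINT w|lebP d. u w * ?r w)" by simp
      also have "\<dots> \<le> (LINT w|lebP d. \<bar>u w\<bar> * (K * sqdist d y x))"
      proof (rule integral_mono[OF i3])
        show "u w * ?r w \<le> \<bar>u w\<bar> * (K * sqdist d y x)" for w
          using mult_left_mono[OF K(3)[of y w x], of "\<bar>u w\<bar>"] abs_ge_self[of "u w * ?r w"] by (simp add: abs_mult)
      qed (use u in simp)
      finally show ?thesis by (simp add: algebra_simps)
    qed
    have cA: "econvex d (A n)" unfolding A_def by (rule inner_set_econvex[OF cvx])
    have dA: "edist d x y \<le> R" if "x \<in> A n" "y \<in> A n" for x y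
      using that A\<Omega> by (intro diam) auto
    have P: "(LINT x:A n|lebP d. (f n x - m n)\<^sup>2) \<le> 2 * R\<^sup>2 * (LINT x:A n|lebP d. (\<Sum>i<d. (h n i x)\<^sup>2))"
      unfolding m_def
      by (rule poincare_convex_smooth[OF R As cA Afin dA fm hm _ _ taylor, where B = B]) (use fB hB in auto)
    have iS: "integrable (lebP d) (\<lambda>x. \<Sum>i<d. (h n i x)\<^sup>2)"
      by (rule Bochner_Integration.integrable_sum) (use h2(1) in auto)
    have "(LINT x:A n|lebP d. (\<Sum>i<d. (h n i x)\<^sup>2)) \<le> (LINT x|lebP d. (\<Sum>i<d. (h n i x)\<^sup>2))"
      unfolding set_lebesgue_integral_def
      by (rule integral_mono[OF integrable_mult_indicator[OF As iS] iS]) (auto simp: indicator_def sum_nonneg)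
    also have "\<dots> = (\<Sum>i<d. LINT x|lebP d. (h n i x)\<^sup>2)"
      by (rule Bochner_Integration.integral_sum) (use h2(1) in auto)
    also have "\<dots> \<le> (\<Sum>i<d. LINT x|lebP d. (g i x)\<^sup>2)" by (rule sum_mono) (use h2(2) in auto)
    finally have "(LINT x:A n|lebP d. (f n x - m n)\<^sup>2) \<le> T"
      using P R unfolding T_def by (meson mult_left_mono order_trans zero_le_mult_iff zero_le_numeral zero_le_power2)
    moreover have "(\<integral>\<^sup>+x\<in>A n. ennreal ((f n x - m n)\<^sup>2) \<partial>lebP d) = ennreal (LINT x:A n|lebP d. (f n x - m n)\<^sup>2)"
    proof -
      have "(\<integral>\<^sup>+x\<in>A n. ennreal ((f n x - m n)\<^sup>2) \<partial>lebP d) = (\<integral>\<^sup>+x. ennreal (indicator (A n) x *\<^sub>R (f n x - m n)\<^sup>2) \<partial>lebP d)"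
        by (intro nn_integral_cong) (auto simp: indicator_def)
      also have "\<dots> = ennreal (LINT x:A n|lebP d. (f n x - m n)\<^sup>2)"
        unfolding set_lebesgue_integral_def
      proof (rule nn_integral_eq_integral)
        have "norm ((f n x - m n)\<^sup>2) \<le> (B + \<bar>m n\<bar>)\<^sup>2" for x
        proof -
          have "\<bar>f n x - m n\<bar> \<le> B + \<bar>m n\<bar>" using fB[of x] by linarith
          then have "\<bar>f n x - m n\<bar>\<^sup>2 \<le> (B + \<bar>m n\<bar>)\<^sup>2" by (intro power_mono) auto
          then show ?thesis by simp
        qed
        then show "integrable (lebP d) (\<lambda>x. indicator (A n) x *\<^sub>R (f n x - m n)\<^sup>2)"
          by (intro integrableI_bounded_set_indicator[where B = "(B + \<bar>m n\<bar>)\<^sup>2"]) (use Afin in auto)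
      qed auto
      finally show ?thesis .
    qed
    ultimately show ?thesis by (simp add: ennreal_leI)
  qed
  define c where "c = (LINT x:\<Omega>|lebP d. u x) / measure (lebP d) \<Omega>"
  have Q: "(\<lambda>n. LINT x|lebP d. \<bar>f n x - u x\<bar>) \<longlonglongrightarrow> 0"
    using moll_tendsto_integrable[OF e(1) e0 u] by (simp add: moll_tendsto_def f_def)
  have fi: "integrable (lebP d) (f n)" for n unfolding f_def by (rule moll_L1(1)[OF e(1) u])
  \<comment> \<open>The integrals converge because \<open>f n\<close> tends to u in the mean while
    the sets \<open>A n\<close> exhaust the domain; the measures converge as well, and their limit
    is not zero in this case.\<close>
  have mc: "m \<longlonglongrightarrow> c"
  proof -
    have ii: "integrable (lebP d) (\<lambda>x. indicator (A n) x * v x)" if "integrable (lebP d) v" for v :: "(nat \<Rightarrow> real) \<Rightarrow> real" and n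
      using integrable_mult_indicator[OF As that] by simp
    have "(\<lambda>n. LINT x|lebP d. indicator (A n) x * u x) \<longlonglongrightarrow> (LINT x|lebP d. indicator \<Omega> x * u x)"
    proof (rule integral_dominated_convergence[where w = "\<lambda>x. \<bar>u x\<bar>"])
      show "AE x in lebP d. (\<lambda>n. indicator (A n) x * u x) \<longlonglongrightarrow> indicator \<Omega> x * u x"
        by (intro AE_I2 tendsto_mult Aind tendsto_const)
    qed (use u in \<open>auto simp: indicator_def\<close>)
    moreover have "(\<lambda>n. (LINT x|lebP d. indicator (A n) x * f n x) - (LINT x|lebP d. indicator (A n) x * u x)) \<longlonglongrightarrow> 0"
    proof (rule Lim_null_comparison[OF _ Q])
      have "norm ((LINT x|lebP d. indicator (A n) x * f n x) - (LINT x|lebP d. indicator (A n) x * u x)) \<le> (LINT x|lebP d. \<bar>f n x - u x\<bar>)" for n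
      proof -
        have "(LINT x|lebP d. indicator (A n) x * f n x) - (LINT x|lebP d. indicator (A n) x * u x) = (LINT x|lebP d. indicator (A n) x * (f n x - u x))"
          using ii[OF fi] ii[OF u] by (simp add: right_diff_distrib)
        also have "norm \<dots> \<le> (LINT x|lebP d. \<bar>indicator (A n) x * (f n x - u x)\<bar>)"
          unfolding real_norm_def by (rule integral_abs_bound)
        also have "\<dots> \<le> (LINT x|lebP d. \<bar>f n x - u x\<bar>)"
          by (rule integral_mono) (use fi u ii in \<open>auto simp: indicator_def\<close>)
        finally show ?thesis .
      qed
      then show "\<forall>\<^sub>F n in sequentially. norm ((LINT x|lebP d. indicator (A n) x * f n x) - (LINT x|lebP d. indicator (A n) x * u x)) \<le> (LINT x|lebP d. \<bar>f n x - u x\<bar>)"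
        by simp
    qed
    ultimately have "(\<lambda>n. ((LINT x|lebP d. indicator (A n) x * f n x) - (LINT x|lebP d. indicator (A n) x * u x)) + (LINT x|lebP d. indicator (A n) x * u x))
      \<longlonglongrightarrow> 0 + (LINT x|lebP d. indicator \<Omega> x * u x)" by (intro tendsto_add)
    then have 1: "(\<lambda>n. LINT x:A n|lebP d. f n x) \<longlonglongrightarrow> (LINT x:\<Omega>|lebP d. u x)"
      by (simp add: set_lebesgue_integral_def)
    have "(\<lambda>n. LINT x|lebP d. indicator (A n) x) \<longlonglongrightarrow> (LINT x|lebP d. indicator \<Omega> x :: real)"
    proof (rule integral_dominated_convergence[where w = "indicator \<Omega>"])
      show "AE x in lebP d. norm (indicator (A n) x :: real) \<le> indicator \<Omega> x" for n
        using A\<Omega>[of n] by (auto simp: indicator_def)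
    qed (use Aind fin in \<open>auto intro!: integrable_real_indicator\<close>)
    then have 2: "(\<lambda>n. measure (lebP d) (A n)) \<longlonglongrightarrow> measure (lebP d) \<Omega>"
      using sets.sets_into_space[OF As] sets.sets_into_space[OF \<Omega>s] by (simp add: Int_absorb2)
    show ?thesis unfolding m_def c_def by (rule tendsto_divide[OF 1 2 False])
  qed
  \<comment> \<open>Convergence in the mean yields convergence almost everywhere along a
    subsequence, the pointwise input of Fatou's lemma.\<close>
  obtain r where r: "strict_mono r" "AE x in lebP d. (\<lambda>n. f (r n) x - u x) \<longlonglongrightarrow> 0"
    using tendsto_L1_AE_subseq[of "lebP d" "\<lambda>n x. f n x - u x"] fi u Q by auto
  have mr: "(\<lambda>n. m (r n)) \<longlonglongrightarrow> c" using LIMSEQ_subseq_LIMSEQ[OF mc r(1)] by (simp add: o_def)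
  have lim: "AE x in lebP d. (\<lambda>n. indicator (A (r n)) x * (f (r n) x - m (r n))\<^sup>2) \<longlonglongrightarrow> indicator \<Omega> x * (u x - c)\<^sup>2"
    using r(2)
  proof eventually_elim
    case (elim x)
    have "(\<lambda>n. f (r n) x - u x + u x) \<longlonglongrightarrow> 0 + u x" by (intro tendsto_add elim tendsto_const)
    then have "(\<lambda>n. f (r n) x) \<longlonglongrightarrow> u x" by simp
    moreover have "(\<lambda>n. indicator (A (r n)) x :: real) \<longlonglongrightarrow> indicator \<Omega> x"
      using LIMSEQ_subseq_LIMSEQ[OF Aind r(1)] by (simp add: o_def)
    ultimately show ?case using mr by (intro tendsto_intros)
  qed
  have "(\<integral>\<^sup>+x\<in>\<Omega>. ennreal ((u x - c)\<^sup>2) \<partial>lebP d) = (\<integral>\<^sup>+x. liminf (\<lambda>n. ennreal (indicator (A (r n)) x * (f (r n) x - m (r n))\<^sup>2)) \<partial>lebP d)"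
  proof (rule nn_integral_cong_AE)
    show "AE x in lebP d. ennreal ((u x - c)\<^sup>2) * indicator \<Omega> x = liminf (\<lambda>n. ennreal (indicator (A (r n)) x * (f (r n) x - m (r n))\<^sup>2))"
      using lim
    proof eventually_elim
      case (elim x)
      have "liminf (\<lambda>n. ennreal (indicator (A (r n)) x * (f (r n) x - m (r n))\<^sup>2)) = ennreal (indicator \<Omega> x * (u x - c)\<^sup>2)"
        by (rule lim_imp_Liminf) (use elim in \<open>auto intro!: tendsto_ennrealI\<close>)
      then show ?case by (auto simp: indicator_def)
    qed
  qed
  \<comment> \<open>Fatou's lemma; each of the integrals is at most \<open>T\<close>.\<close>
  also have "\<dots> \<le> liminf (\<lambda>n. \<integral>\<^sup>+x. ennreal (indicator (A (r n)) x * (f (r n) x - m (r n))\<^sup>2) \<partial>lebP d)"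
    by (rule nn_integral_liminf) measurable
  also have "\<dots> \<le> limsup (\<lambda>n. \<integral>\<^sup>+x. ennreal (indicator (A (r n)) x * (f (r n) x - m (r n))\<^sup>2) \<partial>lebP d)"
    by (rule Liminf_le_Limsup) simp
  also have "\<dots> \<le> ennreal T"
  proof (rule Limsup_bounded, rule always_eventually, rule allI)
    fix n
    have "(\<integral>\<^sup>+x. ennreal (indicator (A (r n)) x * (f (r n) x - m (r n))\<^sup>2) \<partial>lebP d) = (\<integral>\<^sup>+x\<in>A (r n). ennreal ((f (r n) x - m (r n))\<^sup>2) \<partial>lebP d)"
      by (intro nn_integral_cong) (auto simp: indicator_def)
    with bound[of "r n"] show "(\<integral>\<^sup>+x. ennreal (indicator (A (r n)) x * (f (r n) x - m (r n))\<^sup>2) \<partial>lebP d) \<le> ennreal T" by simp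
  qed
  finally show ?thesis unfolding T_def by blast
qed

lemma space_lebP: "space (lebP d) = extensional {..<d}"
  by (auto simp: space_PiM PiE_def)

lemma edist_coord: "i < d \<Longrightarrow> \<bar>x i - y i\<bar> \<le> edist d x y"
proof -
  assume "i < d"
  then have "\<bar>x i - y i\<bar> \<le> L2_set (\<lambda>i. \<bar>x i - y i\<bar>) {..<d}" by (intro member_le_L2_set) auto
  then show ?thesis by (simp add: edist_def L2_set_def)
qed

section \<open>Bounded convex domains with the completed Lebesgue measure\<close>

locale convex_domain =
  fixes d :: nat and \<Omega> :: "(nat \<Rightarrow> real) set"
  assumes dom: "bounded_convex_domain d \<Omega>"
begin

abbreviation "L \<equiv> leb_on d \<Omega>"

lemma openin_domain: "openin (euclid d) \<Omega>" and econvex_domain: "econvex d \<Omega>" and nonempty: "\<Omega> \<noteq> {}"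
  using dom by (auto simp: bounded_convex_domain_def)

lemma domain_ext: "x \<in> \<Omega> \<Longrightarrow> x \<in> extensional {..<d}"
  using openin_subset[OF openin_domain] by (auto simp: topspace_euclid)

lemma domain_sets [measurable]: "\<Omega> \<in> sets (lebP d)"
  by (rule openin_euclid_sets[OF openin_domain])

lemma bounded_coord: obtains B where "B > 0" "\<And>x i. x \<in> \<Omega> \<Longrightarrow> i < d \<Longrightarrow> \<bar>x i\<bar> < B"
proof -
  obtain c r where r: "\<And>y. y \<in> \<Omega> \<Longrightarrow> edist d c y \<le> r"
    using dom unfolding bounded_convex_domain_def ebounded_def by blast
  define B where "B = (\<Sum>i<d. \<bar>c i\<bar>) + \<bar>r\<bar> + 1"
  have "\<bar>x i\<bar> < B" if "x \<in> \<Omega>" "i < d" for x i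
  proof -
    have "\<bar>c i\<bar> \<le> (\<Sum>i<d. \<bar>c i\<bar>)" by (rule member_le_sum) (use that(2) in auto)
    then show ?thesis using edist_coord[OF that(2), of c x] r[OF that(1)] unfolding B_def by linarith
  qed
  moreover have "B > 0" unfolding B_def by (intro add_nonneg_pos add_nonneg_nonneg sum_nonneg) auto
  ultimately show ?thesis using that by blast
qed

lemma emeasure_finite: "emeasure (lebP d) \<Omega> < \<infinity>"
proof -
  interpret product_sigma_finite "\<lambda>_::nat. lborel :: real measure" ..
  obtain B where B: "B > 0" "\<And>x i. x \<in> \<Omega> \<Longrightarrow> i < d \<Longrightarrow> \<bar>x i\<bar> < B" by (rule bounded_coord) blast
  let ?U = "PiE {..<d} (\<lambda>_. {- B..B})"
  have "\<Omega> \<subseteq> ?U"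
  proof
    fix x assume x: "x \<in> \<Omega>"
    have "x i \<in> {-B..B}" if "i < d" for i using B(2)[OF x that] by auto
    then show "x \<in> ?U" using domain_ext[OF x] by (simp add: PiE_iff)
  qed
  then have "emeasure (lebP d) \<Omega> \<le> emeasure (lebP d) ?U"
    by (rule emeasure_mono) (auto intro: sets_PiM_I_finite)
  also have "\<dots> = (\<Prod>j<d. emeasure lborel {- B..B})" by (rule emeasure_PiM) auto
  also have "emeasure lborel {- B..B} = ennreal (2 * B)" using B(1) by simp
  also have "(\<Prod>j<d. ennreal (2 * B)) < \<infinity>" using B(1) by (simp add: ennreal_power)
  finally show ?thesis .
qed

lemma diameter_bound:
  assumes "x \<in> \<Omega>" "y \<in> \<Omega>" shows "edist d x y \<le> ediameter d \<Omega>"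
proof -
  obtain c r where r: "\<And>y. y \<in> \<Omega> \<Longrightarrow> edist d c y \<le> r"
    using dom unfolding bounded_convex_domain_def ebounded_def by blast
  have "edist d x y \<le> r + r" if "x \<in> \<Omega>" "y \<in> \<Omega>" for x y
  proof -
    have "edist d x y = L2_set (\<lambda>i. (x i - c i) + (c i - y i)) {..<d}" by (simp add: edist_def)
    also have "\<dots> \<le> edist d x c + edist d c y" unfolding edist_def by (rule L2_set_triangle_ineq)
    also have "edist d x c = edist d c x" by (simp add: edist_def L2_set_def power2_commute)
    finally show ?thesis using r[OF that(1)] r[OF that(2)] by linarith
  qed
  then have "bdd_above ((\<lambda>(x, y). edist d x y) ` (\<Omega> \<times> \<Omega>))" by (intro bdd_aboveI[of _ "r + r"]) auto
  then show ?thesis using assms nonempty unfolding ediameter_def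
    by (auto intro!: cSUP_upper2[of _ _ "(x, y)"])
qed

lemma diameter_pos: assumes "d \<ge> 1" shows "ediameter d \<Omega> > 0"
proof -
  obtain x where x: "x \<in> \<Omega>" using nonempty by blast
  obtain r where r: "r > 0" "cube d x r \<subseteq> \<Omega>"
    using openin_euclid_box[OF openin_domain x] by blast
  let ?y = "x(0 := x 0 + r)"
  have "?y \<in> cube d x r"
    using domain_ext[OF x] r(1) assms by (auto simp: PiE_iff extensional_def)
  then have "?y \<in> \<Omega>" using r(2) by blast
  then have "\<bar>x 0 - ?y 0\<bar> \<le> ediameter d \<Omega>"
    using edist_coord[of 0 d x ?y] diameter_bound[OF x, of ?y] assms by simp
  then show ?thesis using r(1) by simp
qed

lemma domain_leb: "\<Omega> \<inter> space (leb d) \<in> sets (leb d)"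
  by (simp add: leb_def)

lemma space_L: "space L = \<Omega>"
  using sets.sets_into_space[OF domain_sets] by (auto simp: leb_on_def leb_def space_restrict_space)

lemma measurable_L [measurable (raw)]: "f \<in> borel_measurable (lebP d) \<Longrightarrow> f \<in> borel_measurable L"
  unfolding leb_on_def leb_def by (intro measurable_restrict_space1 measurable_completion)

lemma AE_L_iff: "(AE x in L. P x) \<longleftrightarrow> (AE x in lebP d. x \<in> \<Omega> \<longrightarrow> P x)"
  unfolding leb_on_def AE_restrict_space_iff[OF domain_leb] unfolding leb_def by (rule AE_completion_iff)

lemma integral_L:
  fixes f :: "_ \<Rightarrow> real"
  assumes "f \<in> borel_measurable (lebP d)"
  shows "(LINT x|L. f x) = (LINT x:\<Omega>|lebP d. f x)"
  unfolding leb_on_def set_lebesgue_integral_def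
  by (subst integral_restrict_space[OF domain_leb]) (use assms in \<open>simp add: leb_def integral_completion\<close>)

lemma integrable_L:
  fixes f :: "_ \<Rightarrow> real"
  assumes "f \<in> borel_measurable (lebP d)"
  shows "integrable L f \<longleftrightarrow> set_integrable (lebP d) \<Omega> f"
  unfolding leb_on_def set_integrable_def
  by (subst integrable_restrict_space[OF domain_leb]) (use assms in \<open>simp add: leb_def integrable_completion\<close>)

lemma finite_measure_L: "finite_measure L"
proof (rule finite_measureI)
  have "emeasure L (space L) = emeasure (leb d) \<Omega>"
    unfolding space_L unfolding leb_on_def by (rule emeasure_restrict_space[OF domain_leb]) simp
  then show "emeasure L (space L) \<noteq> \<infinity>" using emeasure_finite by (simp add: leb_def)
qed

text \<open>A function measurable for the completion agrees almost everywhere with one measurable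
  for the product sigma-algebra, on which mollification is built. Making it vanish outside the
  domain lets integrals over the domain become integrals over the whole space.\<close>

lemma borel_representative:
  fixes v :: "_ \<Rightarrow> real"
  assumes "v \<in> borel_measurable L"
  obtains u where "u \<in> borel_measurable (lebP d)" "AE x in L. v x = u x" "\<And>x. x \<notin> \<Omega> \<Longrightarrow> u x = 0"
proof -
  have "(\<lambda>x. indicator \<Omega> x *\<^sub>R v x) \<in> borel_measurable (completion (lebP d))"
    using assms unfolding leb_on_def leb_def
    by (subst (asm) borel_measurable_restrict_space_iff[OF domain_leb[unfolded leb_def]])
  then obtain u where u: "u \<in> borel_measurable (lebP d)" "AE x in lebP d. indicator \<Omega> x *\<^sub>R v x = u x"
    using completion_ex_borel_measurable_real by blast
  show ?thesis
  proof (rule that[of "\<lambda>x. indicator \<Omega> x * u x"])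
    show "AE x in L. v x = indicator \<Omega> x * u x"
      unfolding AE_L_iff using u(2) by (rule eventually_mono) auto
  qed (use u(1) in auto)
qed

lemma integral_zero_outside:
  fixes f :: "_ \<Rightarrow> real"
  assumes "\<And>x. x \<in> extensional {..<d} \<Longrightarrow> x \<notin> \<Omega> \<Longrightarrow> f x = 0"
  shows "(LINT x:\<Omega>|lebP d. f x) = (LINT x|lebP d. f x)" "set_integrable (lebP d) \<Omega> f \<longleftrightarrow> integrable (lebP d) f"
proof -
  have "indicator \<Omega> x *\<^sub>R f x = f x" if "x \<in> space (lebP d)" for x
    using assms that by (auto simp: indicator_def space_lebP)
  then show "(LINT x:\<Omega>|lebP d. f x) = (LINT x|lebP d. f x)" "set_integrable (lebP d) \<Omega> f \<longleftrightarrow> integrable (lebP d) f"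
    unfolding set_lebesgue_integral_def set_integrable_def
    by (auto intro!: Bochner_Integration.integral_cong Bochner_Integration.integrable_cong)
qed

lemma L2_norm_sq: "(L2_norm d \<Omega> v)\<^sup>2 = (LINT x|L. (v x)\<^sup>2)"
  by (simp add: L2_norm_def)

lemma L2_representative:
  assumes "v \<in> L2_space d \<Omega>"
  obtains u where "u \<in> borel_measurable (lebP d)" "AE x in L. v x = u x" "\<And>x. x \<notin> \<Omega> \<Longrightarrow> u x = 0"
    "integrable (lebP d) u" "integrable (lebP d) (\<lambda>x. (u x)\<^sup>2)" "(L2_norm d \<Omega> v)\<^sup>2 = (LINT x|lebP d. (u x)\<^sup>2)"
proof -
  have vm: "v \<in> borel_measurable L" and v2: "integrable L (\<lambda>x. (v x)\<^sup>2)" using assms by (auto simp: L2_space_def)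
  obtain u where u: "u \<in> borel_measurable (lebP d)" "AE x in L. v x = u x" "\<And>x. x \<notin> \<Omega> \<Longrightarrow> u x = 0"
    using borel_representative[OF vm] by blast
  note [measurable] = u(1) vm
  have ae: "AE x in L. (v x)\<^sup>2 = (u x)\<^sup>2" using u(2) by (rule eventually_mono) simp
  have z: "\<And>x. x \<in> extensional {..<d} \<Longrightarrow> x \<notin> \<Omega> \<Longrightarrow> (u x)\<^sup>2 = 0" using u(3) by simp
  have "integrable L (\<lambda>x. (u x)\<^sup>2)"
    using v2 integrable_cong_AE[of "\<lambda>x. (v x)\<^sup>2" L "\<lambda>x. (u x)\<^sup>2"] ae by simp
  then have i2: "integrable (lebP d) (\<lambda>x. (u x)\<^sup>2)"
    by (subst (asm) integrable_L) (use integral_zero_outside(2)[OF z] in auto)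
  have "(L2_norm d \<Omega> v)\<^sup>2 = (LINT x|L. (u x)\<^sup>2)"
    unfolding L2_norm_sq by (rule integral_cong_AE) (use ae in auto)
  also have "\<dots> = (LINT x|lebP d. (u x)\<^sup>2)"
    by (subst integral_L) (use integral_zero_outside(1)[OF z] in auto)
  finally have n2: "(L2_norm d \<Omega> v)\<^sup>2 = (LINT x|lebP d. (u x)\<^sup>2)" .
  have "integrable (lebP d) u"
  proof (rule Bochner_Integration.integrable_bound)
    \<comment> \<open>Square integrable functions on a set of finite measure are integrable: 2 |u|
      <= 1 + u^2.\<close>
    show "integrable (lebP d) (\<lambda>x. indicator \<Omega> x + (u x)\<^sup>2)"
      using i2 emeasure_finite by (intro Bochner_Integration.integrable_add integrable_real_indicator) auto
    show "AE x in lebP d. norm (u x) \<le> norm (indicator \<Omega> x + (u x)\<^sup>2)"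
    proof (rule AE_I2)
      fix x
      have "2 * \<bar>u x\<bar> \<le> 1 + \<bar>u x\<bar>\<^sup>2" using zero_le_power2[of "\<bar>u x\<bar> - 1"] unfolding power2_diff by simp
      then show "norm (u x) \<le> norm (indicator \<Omega> x + (u x)\<^sup>2)"
        using u(3)[of x] by (cases "x \<in> \<Omega>") auto
    qed
  qed simp
  with u i2 n2 that show ?thesis by blast
qed

text \<open>The weak derivative identity, tested with mollification kernels only, survives the
  passage to Borel representatives because its integrals ignore null sets.\<close>

theorem poincare_L2:
  assumes d: "d \<ge> 1" and v: "v \<in> L2_space d \<Omega>"
    and w: "\<And>i. i < d \<Longrightarrow> has_weak_pderiv d \<Omega> i v (g i)" and g: "\<And>i. i < d \<Longrightarrow> g i \<in> L2_space d \<Omega>"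
  shows "\<exists>c. (L2_norm d \<Omega> (\<lambda>x. v x - c))\<^sup>2 \<le> 2 * (ediameter d \<Omega>)\<^sup>2 * (\<Sum>i<d. (L2_norm d \<Omega> (g i))\<^sup>2)"
proof -
  obtain u where u: "u \<in> borel_measurable (lebP d)" "AE x in L. v x = u x" "\<And>x. x \<notin> \<Omega> \<Longrightarrow> u x = 0"
    "integrable (lebP d) u" "integrable (lebP d) (\<lambda>x. (u x)\<^sup>2)"
    using L2_representative[OF v] by blast
  have "\<forall>i. \<exists>G. i < d \<longrightarrow> G \<in> borel_measurable (lebP d) \<and> (AE x in L. g i x = G x) \<and> (\<forall>x. x \<notin> \<Omega> \<longrightarrow> G x = 0) \<and>
    integrable (lebP d) G \<and> integrable (lebP d) (\<lambda>x. (G x)\<^sup>2) \<and> (L2_norm d \<Omega> (g i))\<^sup>2 = (LINT x|lebP d. (G x)\<^sup>2)"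
    (is "\<forall>i. \<exists>G. ?P i G")
  proof
    fix i
    show "\<exists>G. ?P i G"
    proof (cases "i < d")
      case True
      show ?thesis by (rule L2_representative[OF g[OF True]]) blast
    qed simp
  qed
  from choice[OF this] obtain G where "\<forall>i. ?P i (G i)" by (rule exE)
  then have G: "\<And>i. i < d \<Longrightarrow> G i \<in> borel_measurable (lebP d)" "\<And>i. i < d \<Longrightarrow> AE x in L. g i x = G i x"
    "\<And>i x. i < d \<Longrightarrow> x \<notin> \<Omega> \<Longrightarrow> G i x = 0" "\<And>i. i < d \<Longrightarrow> integrable (lebP d) (G i)"
    "\<And>i. i < d \<Longrightarrow> integrable (lebP d) (\<lambda>x. (G i x)\<^sup>2)" "\<And>i. i < d \<Longrightarrow> (L2_norm d \<Omega> (g i))\<^sup>2 = (LINT x|lebP d. (G i x)\<^sup>2)"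
    by simp_all
  note [measurable] = u(1) G(1)
  have vm [measurable]: "v \<in> borel_measurable L" using v by (simp add: L2_space_def)
  have gm [measurable]: "g i \<in> borel_measurable L" if "i < d" for i using g[OF that] by (simp add: L2_space_def)
  have tr: "(LINT x|L. a x * k x) = (LINT x|lebP d. b x * k x)"
    if "a \<in> borel_measurable L" "b \<in> borel_measurable (lebP d)" "AE x in L. a x = b x" "\<And>x. x \<notin> \<Omega> \<Longrightarrow> b x = 0"
      "k \<in> borel_measurable (lebP d)" for a b k :: "(nat \<Rightarrow> real) \<Rightarrow> real"
  proof -
    note [measurable] = that(1,2,5)
    have "(LINT x|L. a x * k x) = (LINT x|L. b x * k x)"
      by (rule integral_cong_AE) (use that(3) in auto)
    also have "\<dots> = (LINT x:\<Omega>|lebP d. b x * k x)" by (rule integral_L) simp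
    also have "\<dots> = (LINT x|lebP d. b x * k x)" by (rule integral_zero_outside(1)) (use that(4) in simp)
    finally show ?thesis .
  qed
  \<comment> \<open>The sign from differentiating the kernel in y cancels the sign in the definition
    of the weak derivative.\<close>
  have weak: "(LINT y|lebP d. u y * dkern d e i z y) = (LINT y|lebP d. G i y * kern d e z y)"
    if e: "e > 0" and i: "i < d" and box: "cube d z e \<subseteq> \<Omega>" for e z i
  proof -
    have "(LINT x|L. v x * pderiv_at i (kern d e z) x) = - (LINT x|L. g i x * kern d e z x)"
      using w[OF i] kern_test_function(1)[OF e box] unfolding has_weak_pderiv_def by blast
    then have "(LINT x|L. v x * - dkern d e i z x) = - (LINT x|L. g i x * kern d e z x)"
      using kern_test_function(2)[OF e box i] by simp
    then show ?thesis
      using tr[OF vm u(1,2,3), of "\<lambda>x. - dkern d e i z x"] tr[OF gm[OF i] G(1)[OF i] G(2)[OF i] G(3)[OF i], of "kern d e z"]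
      by simp
  qed
  obtain c where c: "(\<integral>\<^sup>+x\<in>\<Omega>. ennreal ((u x - c)\<^sup>2) \<partial>lebP d) \<le> ennreal (2 * (ediameter d \<Omega>)\<^sup>2 * (\<Sum>i<d. LINT x|lebP d. (G i x)\<^sup>2))"
    using poincare_weak[OF diameter_pos[OF d] openin_domain econvex_domain emeasure_finite diameter_bound u(4) G(4) G(5) weak] by blast
  have "(L2_norm d \<Omega> (\<lambda>x. v x - c))\<^sup>2 = (LINT x|L. (u x - c)\<^sup>2)"
    unfolding L2_norm_sq by (rule integral_cong_AE) (use u(2) in auto)
  also have "\<dots> = (LINT x:\<Omega>|lebP d. (u x - c)\<^sup>2)" by (rule integral_L) simp
  also have "\<dots> = enn2real (\<integral>\<^sup>+x\<in>\<Omega>. ennreal ((u x - c)\<^sup>2) \<partial>lebP d)"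
    unfolding set_lebesgue_integral_def
    by (subst integral_eq_nn_integral) (auto intro!: arg_cong[where f = enn2real] nn_integral_cong simp: indicator_def)
  also have "\<dots> \<le> 2 * (ediameter d \<Omega>)\<^sup>2 * (\<Sum>i<d. LINT x|lebP d. (G i x)\<^sup>2)"
    using c by (intro enn2real_leI mult_nonneg_nonneg sum_nonneg) auto
  also have "(\<Sum>i<d. LINT x|lebP d. (G i x)\<^sup>2) = (\<Sum>i<d. (L2_norm d \<Omega> (g i))\<^sup>2)"
    by (rule sum.cong) (use G(6) in auto)
  finally show ?thesis by blast
qed

end

lemma closedin_euclid_sets:
  assumes "closedin (euclid d) K" shows "K \<in> sets (lebP d)"
proof -
  have "openin (euclid d) (extensional {..<d} - K)" "K \<subseteq> extensional {..<d}"
    using assms by (auto simp: closedin_def topspace_euclid)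
  then have "extensional {..<d} - (extensional {..<d} - K) \<in> sets (lebP d)"
    using sets.compl_sets[OF openin_euclid_sets] by (simp add: space_lebP)
  then show ?thesis using \<open>K \<subseteq> extensional {..<d}\<close> by (simp add: double_diff)
qed

lemma continuous_map_euclid_measurable:
  assumes "continuous_map (euclid d) euclideanreal f"
  shows "f \<in> borel_measurable (lebP d)"
proof (rule borel_measurableI)
  fix S :: "real set" assume "open S"
  then have "openin (euclid d) {x \<in> topspace (euclid d). f x \<in> S}"
    using assms by (auto simp: continuous_map_def)
  from openin_euclid_sets[OF this] show "f -` S \<inter> space (lebP d) \<in> sets (lebP d)"
    by (simp add: topspace_euclid space_lebP vimage_def Collect_conj_eq Int_commute)
qed

text \<open>Formulated with \<open>x(i := 0)\<close> because in the application x is a point of the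
  product over the other coordinates.\<close>

lemma continuous_map_fun_upd_euclid:
  assumes "i < d" "x(i := 0) \<in> extensional {..<d}"
  shows "continuous_map euclideanreal (euclid d) (\<lambda>t. x(i := t))"
  unfolding euclid_def continuous_map_componentwise
proof (intro conjI ballI)
  show "(\<lambda>t. x(i := t)) ` topspace euclideanreal \<subseteq> extensional {..<d}"
    using assms by (auto simp: extensional_def)
  show "continuous_map euclideanreal euclideanreal (\<lambda>t. (x(i := t)) k)" for k
    by (cases "k = i") auto
qed

section \<open>Calculus of weak derivatives on a convex domain\<close>

context convex_domain
begin

lemma compactin_sets: "compactin (euclid d) K \<Longrightarrow> K \<in> sets (lebP d)"
  by (rule closedin_euclid_sets[OF compactin_imp_closedin[OF Hausdorff_euclid]])

lemma locally_integrable_mult: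
  assumes a: "locally_integrable d \<Omega> a" and K: "compactin (euclid d) K" "K \<subseteq> \<Omega>"
    and [measurable]: "k \<in> borel_measurable (lebP d)" and B: "\<And>x. x \<in> \<Omega> \<Longrightarrow> \<bar>k x\<bar> \<le> B"
    and 0: "\<And>x. x \<in> \<Omega> \<Longrightarrow> x \<notin> K \<Longrightarrow> k x = 0"
  shows "integrable L (\<lambda>x. a x * k x)"
proof -
  have "integrable L (\<lambda>x. indicator K x *\<^sub>R a x)"
    using a K unfolding locally_integrable_def set_integrable_def by blast
  then have "integrable L (\<lambda>x. (indicator K x *\<^sub>R a x) * k x)"
    by (rule integrable_mult_bounded) (use B space_L in auto)
  also have "?this \<longleftrightarrow> integrable L (\<lambda>x. a x * k x)"
    using 0 by (intro Bochner_Integration.integrable_cong) (auto simp: space_L indicator_def)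
  finally show ?thesis .
qed

text \<open>Off the compact support the function vanishes in a neighbourhood, so its partial
  derivative vanishes there too; on the support both are bounded by compactness.\<close>

lemma test_functionE:
  assumes t: "test_function d \<Omega> \<phi>" and i: "i < d"
  obtains K B where "compactin (euclid d) K" "K \<subseteq> \<Omega>"
    "\<And>x. x \<in> extensional {..<d} \<Longrightarrow> x \<notin> K \<Longrightarrow> \<phi> x = 0 \<and> pderiv_at i \<phi> x = 0"
    "\<And>x. x \<in> extensional {..<d} \<Longrightarrow> \<bar>\<phi> x\<bar> \<le> B \<and> \<bar>pderiv_at i \<phi> x\<bar> \<le> B"
    "continuous_map (euclid d) euclideanreal \<phi>" "continuous_map (euclid d) euclideanreal (pderiv_at i \<phi>)"
    "\<And>x. x \<in> extensional {..<d} \<Longrightarrow> ((\<lambda>t. \<phi> (x(i := t))) has_real_derivative pderiv_at i \<phi> x) (at (x i))"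
proof -
  define K where "K = euclid d closure_of {x \<in> topspace (euclid d). \<phi> x \<noteq> 0}"
  have K: "compactin (euclid d) K" "K \<subseteq> \<Omega>" and Ck: "\<And>k. C_k d k \<phi>"
    using t unfolding test_function_def Let_def K_def by auto
  have c: "continuous_map (euclid d) euclideanreal \<phi>" "continuous_map (euclid d) euclideanreal (pderiv_at i \<phi>)"
    and diff: "\<And>x. x \<in> topspace (euclid d) \<Longrightarrow> (\<lambda>t. \<phi> (x(i := t))) differentiable at (x i)"
    using Ck[of 1] i by (auto simp: numeral_eq_Suc)
  have der: "((\<lambda>t. \<phi> (x(i := t))) has_real_derivative pderiv_at i \<phi> x) (at (x i))" if "x \<in> extensional {..<d}" for x
    using diff[of x] that unfolding pderiv_at_def topspace_euclid
    by (metis DERIV_imp_deriv real_differentiable_def)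
  have "{x \<in> topspace (euclid d). \<phi> x \<noteq> 0} \<subseteq> K" unfolding K_def by (rule closure_of_subset) auto
  then have z: "\<phi> x = 0" if "x \<in> extensional {..<d}" "x \<notin> K" for x
    using that by (auto simp: topspace_euclid)
  have op': "openin (euclid d) (extensional {..<d} - K)"
    using compactin_imp_closedin[OF Hausdorff_euclid K(1)] by (simp add: closedin_def topspace_euclid)
  have z': "pderiv_at i \<phi> x = 0" if x: "x \<in> extensional {..<d}" "x \<notin> K" for x
  proof -
    obtain r where r: "r > 0" "cube d x r \<subseteq> extensional {..<d} - K"
      using openin_euclid_box[OF op', of x] x by blast
    have "((\<lambda>_. 0) has_real_derivative 0) (at (x i))" by simp
    moreover have "open {x i - r<..<x i + r}" "x i \<in> {x i - r<..<x i + r}" using r(1) by auto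
    moreover have "0 = \<phi> (x(i := t))" if t: "t \<in> {x i - r<..<x i + r}" for t
    proof -
      have "x(i := t) \<in> cube d x r"
        using t x(1) r(1) i by (auto simp: PiE_iff extensional_def)
      then have "x(i := t) \<in> extensional {..<d} - K" using r(2) by blast
      then show ?thesis using z by simp
    qed
    ultimately have "((\<lambda>t. \<phi> (x(i := t))) has_real_derivative 0) (at (x i))"
      by (rule has_field_derivative_transform_within_open)
    then show ?thesis unfolding pderiv_at_def by (rule DERIV_imp_deriv)
  qed
  have bd: "\<exists>B. \<forall>x\<in>K. \<bar>f x\<bar> \<le> B" if "continuous_map (euclid d) euclideanreal f" for f
  proof -
    have "compact (f ` K)" using image_compactin[OF K(1) that] by simp
    then have "bounded (f ` K)" by (rule compact_imp_bounded)
    then show ?thesis unfolding bounded_iff by auto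
  qed
  obtain B1 B2 where B: "\<And>x. x \<in> K \<Longrightarrow> \<bar>\<phi> x\<bar> \<le> B1" "\<And>x. x \<in> K \<Longrightarrow> \<bar>pderiv_at i \<phi> x\<bar> \<le> B2"
    using bd[OF c(1)] bd[OF c(2)] by blast
  define B where "B = max 0 (max B1 B2)"
  show ?thesis
  proof (rule that[OF K _ _ c der])
    show "\<phi> x = 0 \<and> pderiv_at i \<phi> x = 0" if "x \<in> extensional {..<d}" "x \<notin> K" for x using z z' that by blast
    show "\<bar>\<phi> x\<bar> \<le> B \<and> \<bar>pderiv_at i \<phi> x\<bar> \<le> B" if "x \<in> extensional {..<d}" for x
      using z[OF that] z'[OF that] B[of x] by (cases "x \<in> K") (auto simp: B_def)
  qed
qed

text \<open>The fundamental lemma of the calculus of variations on one cube. Both candidates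
  integrate equally against every kernel, so the mollified difference is zero on the inner cube, yet
  it converges in the mean to the difference. The doubled cube leaves room for the kernels.\<close>

lemma AE_eq_on_box:
  assumes g: "has_weak_pderiv d \<Omega> i v g1" "has_weak_pderiv d \<Omega> i v g2" and i: "i < d" and \<rho>: "\<rho> > 0"
    and sub: "cube d q (2 * \<rho>) \<subseteq> \<Omega>"
  shows "AE x in lebP d. x \<in> cube d q \<rho> \<longrightarrow> g1 x = g2 x"
proof -
  let ?K = "cube d q (2 * \<rho>)" and ?I = "cube d q \<rho>"
  have li: "locally_integrable d \<Omega> g1" "locally_integrable d \<Omega> g2" using g by (auto simp: has_weak_pderiv_def)
  have K: "compactin (euclid d) ?K" by (rule compactin_box)
  have [measurable]: "?I \<in> sets (lebP d)" by (intro sets_PiM_I_finite) auto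
  \<comment> \<open>\<open>g1\<close> and \<open>g2\<close> are only locally integrable; restriction
    to the compact cube makes their difference integrable and thus accessible to
    mollification.\<close>
  define F where "F = (\<lambda>x. indicator ?K x * (g1 x - g2 x))"
  have iF: "integrable L F"
  proof -
    have "set_integrable L ?K g1" "set_integrable L ?K g2" using li K sub by (auto simp: locally_integrable_def)
    then have "set_integrable L ?K (\<lambda>x. g1 x - g2 x)" by (rule set_integral_diff(1))
    then show ?thesis by (simp add: set_integrable_def F_def)
  qed
  then have Fm [measurable]: "F \<in> borel_measurable L" by simp
  obtain W where W: "W \<in> borel_measurable (lebP d)" "AE x in L. F x = W x" "\<And>x. x \<notin> \<Omega> \<Longrightarrow> W x = 0"
    using borel_representative[OF Fm] by blast
  note [measurable] = W(1)
  have iW: "integrable (lebP d) W"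
  proof -
    have "integrable L W" using iF integrable_cong_AE[of F L W] W(2) by simp
    then show ?thesis using integrable_L[OF W(1)] integral_zero_outside(2)[of W] W(3) by simp
  qed
  have zero: "moll d e W z = 0" if e: "0 < e" "e < \<rho>" and z: "z \<in> ?I" for e z
  proof -
    have zj: "\<bar>z j - q j\<bar> \<le> \<rho>" if "j < d" for j
    proof -
      have "z j \<in> {q j - \<rho>..q j + \<rho>}" using z that by (auto simp: PiE_iff)
      then show ?thesis by auto
    qed
    have "cube d z e \<subseteq> ?K"
    proof (rule PiE_mono)
      fix j assume "j \<in> {..<d}"
      then show "{z j - e..z j + e} \<subseteq> {q j - 2 * \<rho>..q j + 2 * \<rho>}" using zj[of j] e by (auto simp: abs_le_iff)
    qed
    then have tf: "test_function d \<Omega> (kern d e z)"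
      using sub e(1) by (intro kern_test_function(1)) auto
    have k0: "kern d e z y = 0" if y: "y \<in> \<Omega>" "y \<notin> ?K" for y
    proof -
      have "y \<in> extensional {..<d}" using y domain_ext by blast
      then obtain j where j: "j < d" "y j \<notin> {q j - 2 * \<rho>..q j + 2 * \<rho>}" using y(2) by (auto simp: PiE_iff)
      then have "e \<le> \<bar>z j - y j\<bar>" using zj[OF j(1)] e(2) by (auto simp: abs_le_iff)
      then show ?thesis by (rule kern_eq_0[OF e(1) j(1)])
    qed
    obtain B where B: "\<And>y. \<bar>kern d e z y\<bar> \<le> B" by (rule kern_bounds[OF e(1), of d]) blast
    have "moll d e W z = (LINT y:\<Omega>|lebP d. W y * kern d e z y)"
      unfolding moll_def by (rule integral_zero_outside(1)[symmetric]) (simp add: W(3))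
    also have "\<dots> = (LINT y|L. W y * kern d e z y)" by (rule integral_L[symmetric]) simp
    also have "\<dots> = (LINT y|L. F y * kern d e z y)"
      by (rule integral_cong_AE) (use W(2) in auto)
    also have "\<dots> = (LINT y|L. g1 y * kern d e z y - g2 y * kern d e z y)"
      using k0 by (intro Bochner_Integration.integral_cong) (auto simp: space_L F_def indicator_def left_diff_distrib)
    also have "\<dots> = (LINT y|L. g1 y * kern d e z y) - (LINT y|L. g2 y * kern d e z y)"
      by (intro Bochner_Integration.integral_diff locally_integrable_mult[OF li(1) K sub _ B k0] locally_integrable_mult[OF li(2) K sub _ B k0]) auto
    also have "\<dots> = 0" using g tf unfolding has_weak_pderiv_def by auto
    finally show ?thesis .
  qed
  \<comment> \<open>The double successor makes the radius strictly smaller than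
    \<open>\<rho>\<close> already for n = 0.\<close>
  define e where "e = (\<lambda>n::nat. \<rho> / real (Suc (Suc n)))"
  have e: "e n > 0" "e n < \<rho>" for n using \<rho> by (auto simp: e_def field_simps intro: add_pos_nonneg)
  have "(\<lambda>n. \<rho> * inverse (real (Suc n))) \<longlonglongrightarrow> \<rho> * 0" by (intro tendsto_mult tendsto_const LIMSEQ_inverse_real_of_nat)
  from LIMSEQ_Suc[OF this] have e0: "e \<longlonglongrightarrow> 0" by (simp add: e_def divide_inverse)
  have Q: "(\<lambda>n. LINT z|lebP d. \<bar>moll d (e n) W z - W z\<bar>) \<longlonglongrightarrow> 0"
    using moll_tendsto_integrable[OF e(1) e0 iW] by (simp add: moll_tendsto_def)
  have iI: "integrable (lebP d) (\<lambda>z. indicator ?I z * \<bar>W z\<bar>)"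
    using integrable_mult_indicator[of ?I "lebP d" "\<lambda>z. \<bar>W z\<bar>"] iW by simp
  \<comment> \<open>On the inner cube the mollification vanishes, so |W| is itself the approximation
    error there.\<close>
  have "(LINT z|lebP d. indicator ?I z * \<bar>W z\<bar>) \<le> (LINT z|lebP d. \<bar>moll d (e n) W z - W z\<bar>)" for n
    by (rule integral_mono) (use iI iW moll_L1(1)[OF e(1) iW] zero[OF e] in \<open>auto simp: indicator_def\<close>)
  then have "(LINT z|lebP d. indicator ?I z * \<bar>W z\<bar>) \<le> 0"
    by (intro tendsto_lowerbound[OF Q]) auto
  moreover have "(LINT z|lebP d. indicator ?I z * \<bar>W z\<bar>) \<ge> 0" by (intro integral_nonneg_AE) auto
  ultimately have "AE z in lebP d. indicator ?I z * \<bar>W z\<bar> = 0"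
    using integral_nonneg_eq_0_iff_AE[OF iI] by auto
  moreover have "AE z in lebP d. z \<in> \<Omega> \<longrightarrow> F z = W z" using W(2) by (simp add: AE_L_iff)
  ultimately show ?thesis
  proof eventually_elim
    case (elim z)
    have "?I \<subseteq> ?K" using \<rho> by (intro PiE_mono) auto
    show ?case
    proof
      assume z: "z \<in> ?I"
      then have "z \<in> ?K" using \<open>?I \<subseteq> ?K\<close> by (rule subsetD[rotated])
      moreover from this have "z \<in> \<Omega>" using sub by (rule subsetD[rotated])
      ultimately have "F z = g1 z - g2 z" "F z = W z" using elim(2) by (simp_all add: F_def)
      moreover have "W z = 0" using elim(1) z by simp
      ultimately show "g1 z = g2 z" by simp
    qed
  qed
qed

text \<open>Countably many rational cubes cover the domain, so the exceptional null sets add up to a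
  null set. Uniqueness is what identifies the derivative picked by \<open>SOME\<close> in
  \<open>weak_pderiv\<close> with an explicit one.\<close>

lemma weak_pderiv_unique:
  assumes g: "has_weak_pderiv d \<Omega> i v g1" "has_weak_pderiv d \<Omega> i v g2" and i: "i < d"
  shows "AE x in L. g1 x = g2 x"
proof -
  let ?Q = "PiE {..<d} (\<lambda>_. \<rat>) :: (nat \<Rightarrow> real) set"
  let ?I = "{p \<in> ?Q \<times> \<rat>. snd p > 0 \<and> cube d (fst p) (2 * snd p) \<subseteq> \<Omega>}"
  have "countable ?Q" by (intro countable_PiE) (auto simp: countable_rat)
  then have "countable ?I" by (intro countable_Collect countable_SIGMA) (auto simp: countable_rat)
  then have ae: "AE x in lebP d. \<forall>p\<in>?I. x \<in> cube d (fst p) (snd p) \<longrightarrow> g1 x = g2 x"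
    by (rule AE_ball_countable'[rotated]) (intro AE_eq_on_box[OF g i], auto)
  have cover: "\<exists>p\<in>?I. x \<in> cube d (fst p) (snd p)" if x: "x \<in> \<Omega>" for x
  proof -
    obtain r where r: "r > 0" "cube d x r \<subseteq> \<Omega>"
      using openin_euclid_box[OF openin_domain x] by blast
    \<comment> \<open>The centre is taken within r / 8 of x. The half-width exceeds r / 8, so the
      cube contains x, and the doubled cube reaches at most r / 8 + r / 2 < r from x.\<close>
    obtain \<rho> where \<rho>: "\<rho> \<in> \<rat>" "r / 8 < \<rho>" "\<rho> < r / 4" using Rats_dense_in_real[of "r / 8" "r / 4"] r(1) by auto
    have "\<exists>a\<in>\<rat>. x j - r / 8 < a \<and> a < x j" for j using r(1) by (intro Rats_dense_in_real) auto
    then obtain a where a: "\<And>j. a j \<in> \<rat>" "\<And>j. x j - r / 8 < a j" "\<And>j. a j < x j" by metis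
    let ?p = "(restrict a {..<d}, \<rho>)"
    have "cube d (fst ?p) (2 * snd ?p) \<subseteq> cube d x r"
    proof (rule PiE_mono)
      fix j assume "j \<in> {..<d}"
      then show "{fst ?p j - 2 * snd ?p..fst ?p j + 2 * snd ?p} \<subseteq> {x j - r..x j + r}"
        using a(2,3)[of j] \<rho> r(1) by auto
    qed
    then have "cube d (fst ?p) (2 * snd ?p) \<subseteq> \<Omega>" using r(2) by (rule order_trans)
    then have "?p \<in> ?I" using a(1) \<rho> r(1) by (intro CollectI conjI) auto
    moreover have "x \<in> cube d (fst ?p) (snd ?p)"
    proof -
      have "x j \<in> {a j - \<rho>..a j + \<rho>}" for j using a(2,3)[of j] \<rho> by auto
      then show ?thesis using domain_ext[OF x] by (auto simp: PiE_iff)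
    qed
    ultimately show ?thesis by (rule bexI[rotated])
  qed
  show ?thesis unfolding AE_L_iff using ae
  proof eventually_elim
    case (elim x)
    then show ?case using cover[of x] by blast
  qed
qed

lemma affine_bounded: obtains P where "\<And>x. x \<in> \<Omega> \<Longrightarrow> \<bar>b + (\<Sum>j<d. a j * x j)\<bar> \<le> P"
proof -
  obtain B where B: "B > 0" "\<And>x i. x \<in> \<Omega> \<Longrightarrow> i < d \<Longrightarrow> \<bar>x i\<bar> < B" by (rule bounded_coord) blast
  have "\<bar>b + (\<Sum>j<d. a j * x j)\<bar> \<le> \<bar>b\<bar> + (\<Sum>j<d. \<bar>a j\<bar> * B)" if "x \<in> \<Omega>" for x
  proof -
    have "\<bar>\<Sum>j<d. a j * x j\<bar> \<le> (\<Sum>j<d. \<bar>a j * x j\<bar>)" by (rule sum_abs)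
    also have "\<dots> \<le> (\<Sum>j<d. \<bar>a j\<bar> * B)"
      using B(2)[OF that] by (intro sum_mono) (auto simp: abs_mult less_imp_le intro!: mult_left_mono)
    finally show ?thesis by linarith
  qed
  then show ?thesis using that by blast
qed

text \<open>The integrand moved to one side is the i-th partial derivative of the affine function
  times the test function. By Fubini it is integrated along lines parallel to the i-th axis, where
  the fundamental theorem of calculus gives zero.\<close>

lemma integral_affine_by_parts:
  assumes t: "test_function d \<Omega> \<phi>" and i: "i < d"
  shows "(LINT x|L. (b + (\<Sum>j<d. a j * x j)) * pderiv_at i \<phi> x) = - (LINT x|L. a i * \<phi> x)"
proof -
  obtain K B where K: "compactin (euclid d) K" "K \<subseteq> \<Omega>"
    "\<And>x. x \<in> extensional {..<d} \<Longrightarrow> x \<notin> K \<Longrightarrow> \<phi> x = 0 \<and> pderiv_at i \<phi> x = 0"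
    and B: "\<And>x. x \<in> extensional {..<d} \<Longrightarrow> \<bar>\<phi> x\<bar> \<le> B \<and> \<bar>pderiv_at i \<phi> x\<bar> \<le> B"
    and c: "continuous_map (euclid d) euclideanreal \<phi>" "continuous_map (euclid d) euclideanreal (pderiv_at i \<phi>)"
    and der: "\<And>x. x \<in> extensional {..<d} \<Longrightarrow> ((\<lambda>t. \<phi> (x(i := t))) has_real_derivative pderiv_at i \<phi> x) (at (x i))"
    by (rule test_functionE[OF t i]) blast
  note [measurable] = continuous_map_euclid_measurable[OF c(1)] continuous_map_euclid_measurable[OF c(2)]
  let ?p = "\<lambda>x. b + (\<Sum>j<d. a j * x j)"
  have pm [measurable]: "?p \<in> borel_measurable (lebP d)" by measurable
  obtain P where P: "\<And>x. x \<in> \<Omega> \<Longrightarrow> \<bar>?p x\<bar> \<le> P" by (rule affine_bounded[of b a]) blast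
  obtain T where T: "T > 0" "\<And>x i. x \<in> \<Omega> \<Longrightarrow> i < d \<Longrightarrow> \<bar>x i\<bar> < T" by (rule bounded_coord) blast
  let ?D = "\<lambda>x. ?p x * pderiv_at i \<phi> x + a i * \<phi> x"
  have [measurable]: "?D \<in> borel_measurable (lebP d)" by measurable
  have D0: "?D x = 0" if "x \<in> extensional {..<d}" "x \<notin> \<Omega>" for x
  proof -
    have "x \<notin> K" using K(2) that(2) by blast
    then show ?thesis using K(3)[OF that(1)] by simp
  qed
  interpret fL: finite_measure L by (rule finite_measure_L)
  have i1: "integrable L (\<lambda>x. ?p x * pderiv_at i \<phi> x)"
  proof (rule fL.integrable_const_bound[where B = "P * B"])
    show "AE x in L. norm (?p x * pderiv_at i \<phi> x) \<le> P * B"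
    proof (rule AE_I2)
      fix x assume "x \<in> space L"
      then have x: "x \<in> \<Omega>" by (simp add: space_L)
      have "\<bar>?p x\<bar> * \<bar>pderiv_at i \<phi> x\<bar> \<le> P * B"
        using P[OF x] B[OF domain_ext[OF x]] abs_ge_zero[of "?p x"] by (intro mult_mono) linarith+
      then show "norm (?p x * pderiv_at i \<phi> x) \<le> P * B" by (simp add: abs_mult)
    qed
  qed simp
  have i2: "integrable L (\<lambda>x. a i * \<phi> x)"
    by (rule fL.integrable_const_bound[where B = "\<bar>a i\<bar> * B"])
       (use B domain_ext in \<open>auto simp: space_L abs_mult intro!: AE_I2 mult_left_mono\<close>)
  have iD: "integrable (lebP d) ?D"
  proof -
    have "integrable L ?D" using i1 i2 by (rule Bochner_Integration.integrable_add)
    then have "set_integrable (lebP d) \<Omega> ?D" by (subst (asm) integrable_L) auto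
    then show ?thesis by (subst (asm) integral_zero_outside(2)[OF D0])
  qed
  have "(LINT x|L. ?p x * pderiv_at i \<phi> x) + (LINT x|L. a i * \<phi> x) = (LINT x|L. ?D x)"
    by (rule Bochner_Integration.integral_add[OF i1 i2, symmetric])
  also have "\<dots> = (LINT x:\<Omega>|lebP d. ?D x)" by (rule integral_L) simp
  also have "\<dots> = (LINT x|lebP d. ?D x)" by (rule integral_zero_outside(1)[OF D0])
  also have "\<dots> = 0"
  proof -
    interpret product_sigma_finite "\<lambda>_::nat. lborel :: real measure" ..
    define I where "I = {..<d} - {i}"
    have ins: "{..<d} = insert i I" "i \<notin> I" "finite I" using i by (auto simp: I_def)
    have inner: "(LINT t|lborel. ?D (x(i := t))) = 0" if x: "x \<in> extensional I" for x
    proof -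
      have ext: "x(i := t) \<in> extensional {..<d}" for t using x unfolding ins(1) by (auto simp: extensional_def)
      \<comment> \<open>T strictly bounds all coordinates on the domain, so at T and -T the line is
        outside it and the boundary terms vanish.\<close>
      have out: "x(i := t) \<notin> \<Omega>" if "\<bar>t\<bar> \<ge> T" for t using T(2)[of "x(i := t)" i] i that by auto
      have p: "?p (x(i := t)) = (b + (\<Sum>j\<in>I. a j * x j)) + a i * t" for t
      proof -
        have "(\<Sum>j\<in>I. a j * (x(i := t)) j) = (\<Sum>j\<in>I. a j * x j)" by (rule sum.cong) (use ins(2) in auto)
        then show ?thesis unfolding ins(1) using ins(2,3) by simp
      qed
      have d\<phi>: "((\<lambda>t. \<phi> (x(i := t))) has_real_derivative pderiv_at i \<phi> (x(i := t))) (at t)" for t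
        using der[OF ext[of t]] by simp
      have d\<psi>: "((\<lambda>t. ?p (x(i := t)) * \<phi> (x(i := t))) has_real_derivative ?D (x(i := t))) (at t)" for t
        unfolding p by (auto intro!: derivative_eq_intros d\<phi>)
      have cm: "continuous_map euclideanreal (euclid d) (\<lambda>t. x(i := t))"
        by (rule continuous_map_fun_upd_euclid[OF i ext])
      have "continuous_map euclideanreal euclideanreal (\<lambda>t. pderiv_at i \<phi> (x(i := t)))"
        using continuous_map_compose[OF cm c(2)] by (simp add: o_def)
      then have "isCont (\<lambda>t. pderiv_at i \<phi> (x(i := t))) t" for t
        by (simp add: continuous_on_eq_continuous_at)
      then have cD: "isCont (\<lambda>t. ?D (x(i := t))) t" for t
        unfolding p by (intro continuous_intros DERIV_isCont[OF d\<phi>])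
      have "has_bochner_integral lborel (\<lambda>t. ?D (x(i := t)) * indicator {- T..T} t)
        (?p (x(i := T)) * \<phi> (x(i := T)) - ?p (x(i := - T)) * \<phi> (x(i := - T)))"
        by (rule has_bochner_integral_FTC_Icc_real[OF _ d\<psi> cD]) (use T(1) in simp)
      also have "(\<lambda>t. ?D (x(i := t)) * indicator {- T..T} t) = (\<lambda>t. ?D (x(i := t)))"
      proof
        fix t show "?D (x(i := t)) * indicator {- T..T} t = ?D (x(i := t))"
        proof (cases "t \<in> {- T..T}")
          case False
          then have "?D (x(i := t)) = 0" by (intro D0 ext out) auto
          then show ?thesis by simp
        qed simp
      qed
      finally have "(LINT t|lborel. ?D (x(i := t))) = ?p (x(i := T)) * \<phi> (x(i := T)) - ?p (x(i := - T)) * \<phi> (x(i := - T))"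
        by (rule has_bochner_integral_integral_eq)
      moreover have "\<phi> (x(i := T)) = 0" "\<phi> (x(i := - T)) = 0"
        using K(2) K(3)[OF ext] out T(1) by (metis abs_ge_self abs_minus_cancel subsetD)+
      ultimately show ?thesis by simp
    qed
    have "(LINT x|lebP d. ?D x) = (LINT x|Pi\<^sub>M I (\<lambda>_. lborel). LINT t|lborel. ?D (x(i := t)))"
      using product_integral_insert[OF ins(3,2), of ?D] iD unfolding ins(1)[symmetric] by simp
    also have "\<dots> = (LINT x|Pi\<^sub>M I (\<lambda>_. lborel :: real measure). 0)"
      using inner by (intro Bochner_Integration.integral_cong) (auto simp: space_PiM PiE_def)
    finally show ?thesis by simp
  qed
  finally show ?thesis by simp
qed

text \<open>Linearity plus integration by parts for the affine function. The compact support of the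
  test function makes each product integrable, so that the integrals may be split.\<close>

lemma has_weak_pderiv_diff_affine:
  assumes w: "has_weak_pderiv d \<Omega> i v g" and i: "i < d"
  shows "has_weak_pderiv d \<Omega> i (\<lambda>x. v x - (b + (\<Sum>j<d. a j * x j))) (\<lambda>x. g x - a i)"
  unfolding has_weak_pderiv_def
proof (intro conjI allI impI)
  let ?p = "\<lambda>x. b + (\<Sum>j<d. a j * x j)"
  interpret fL: finite_measure L by (rule finite_measure_L)
  have li: "locally_integrable d \<Omega> v" "locally_integrable d \<Omega> g" using w by (auto simp: has_weak_pderiv_def)
  have bdd: "locally_integrable d \<Omega> k" if [measurable]: "k \<in> borel_measurable (lebP d)" and P: "\<And>x. x \<in> \<Omega> \<Longrightarrow> \<bar>k x\<bar> \<le> P" for k P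
    unfolding locally_integrable_def set_integrable_def
  proof (intro allI impI)
    fix K assume "compactin (euclid d) K \<and> K \<subseteq> \<Omega>"
    then have [measurable]: "K \<in> sets (lebP d)" using compactin_sets by blast
    show "integrable L (\<lambda>x. indicator K x *\<^sub>R k x)"
    proof (rule fL.integrable_const_bound[where B = "\<bar>P\<bar>"])
      show "AE x in L. norm (indicator K x *\<^sub>R k x) \<le> \<bar>P\<bar>"
      proof (rule AE_I2)
        fix x assume "x \<in> space L"
        then have "\<bar>k x\<bar> \<le> P" using P by (simp add: space_L)
        then show "norm (indicator K x *\<^sub>R k x) \<le> \<bar>P\<bar>" by (auto simp: indicator_def)
      qed
    qed (rule measurable_L, measurable)
  qed
  have diff: "locally_integrable d \<Omega> (\<lambda>x. f x - k x)" if "locally_integrable d \<Omega> f" "locally_integrable d \<Omega> k" for f k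
    using that unfolding locally_integrable_def by (intro allI impI set_integral_diff(1)) auto
  have pm [measurable]: "?p \<in> borel_measurable (lebP d)" by measurable
  obtain P where P: "\<And>x. x \<in> \<Omega> \<Longrightarrow> \<bar>?p x\<bar> \<le> P" by (rule affine_bounded[of b a]) blast
  have lp: "locally_integrable d \<Omega> ?p" by (rule bdd[OF pm P])
  have lc: "locally_integrable d \<Omega> (\<lambda>x. a i)" by (rule bdd[of _ "\<bar>a i\<bar>"]) auto
  show "locally_integrable d \<Omega> (\<lambda>x. v x - ?p x)" by (rule diff[OF li(1) lp])
  show "locally_integrable d \<Omega> (\<lambda>x. g x - a i)" by (rule diff[OF li(2) lc])
  fix \<phi> assume t: "test_function d \<Omega> \<phi>"
  obtain K B where K: "compactin (euclid d) K" "K \<subseteq> \<Omega>"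
    "\<And>x. x \<in> extensional {..<d} \<Longrightarrow> x \<notin> K \<Longrightarrow> \<phi> x = 0 \<and> pderiv_at i \<phi> x = 0"
    and B: "\<And>x. x \<in> extensional {..<d} \<Longrightarrow> \<bar>\<phi> x\<bar> \<le> B \<and> \<bar>pderiv_at i \<phi> x\<bar> \<le> B"
    and c: "continuous_map (euclid d) euclideanreal \<phi>" "continuous_map (euclid d) euclideanreal (pderiv_at i \<phi>)"
    by (rule test_functionE[OF t i]) blast
  have int: "integrable L (\<lambda>x. f x * \<phi> x)" "integrable L (\<lambda>x. f x * pderiv_at i \<phi> x)" if "locally_integrable d \<Omega> f" for f
    by (rule locally_integrable_mult[OF that K(1,2) continuous_map_euclid_measurable[OF c(1)], of B];
        use K(3) B domain_ext in blast)
       (rule locally_integrable_mult[OF that K(1,2) continuous_map_euclid_measurable[OF c(2)], of B];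
        use K(3) B domain_ext in blast)
  have "(LINT x|L. (v x - ?p x) * pderiv_at i \<phi> x) = (LINT x|L. v x * pderiv_at i \<phi> x) - (LINT x|L. ?p x * pderiv_at i \<phi> x)"
    unfolding left_diff_distrib by (rule Bochner_Integration.integral_diff[OF int(2)[OF li(1)] int(2)[OF lp]])
  also have "(LINT x|L. v x * pderiv_at i \<phi> x) = - (LINT x|L. g x * \<phi> x)"
    using w t by (simp add: has_weak_pderiv_def)
  also have "(LINT x|L. ?p x * pderiv_at i \<phi> x) = - (LINT x|L. a i * \<phi> x)"
    by (rule integral_affine_by_parts[OF t i])
  also have "- (LINT x|L. g x * \<phi> x) - - (LINT x|L. a i * \<phi> x) = - ((LINT x|L. g x * \<phi> x) - (LINT x|L. a i * \<phi> x))" by simp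
  also have "(LINT x|L. g x * \<phi> x) - (LINT x|L. a i * \<phi> x) = (LINT x|L. (g x - a i) * \<phi> x)"
    unfolding left_diff_distrib by (rule Bochner_Integration.integral_diff[OF int(1)[OF li(2)] int(1)[OF lc], symmetric])
  finally show "(LINT x|L. (v x - ?p x) * pderiv_at i \<phi> x) = - (LINT x|L. (g x - a i) * \<phi> x)" .
qed

lemma L2_space_diff_bounded:
  assumes v: "v \<in> L2_space d \<Omega>" and [measurable]: "k \<in> borel_measurable (lebP d)" and P: "\<And>x. x \<in> \<Omega> \<Longrightarrow> \<bar>k x\<bar> \<le> P"
  shows "(\<lambda>x. v x - k x) \<in> L2_space d \<Omega>"
proof -
  interpret fL: finite_measure L by (rule finite_measure_L)
  have [measurable]: "v \<in> borel_measurable L" and v2: "integrable L (\<lambda>x. (v x)\<^sup>2)" using v by (auto simp: L2_space_def)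
  have "integrable L (\<lambda>x. (v x - k x)\<^sup>2)"
  proof (rule Bochner_Integration.integrable_bound)
    show "integrable L (\<lambda>x. 2 * (v x)\<^sup>2 + 2 * P\<^sup>2)" using v2 by simp
    show "AE x in L. norm ((v x - k x)\<^sup>2) \<le> norm (2 * (v x)\<^sup>2 + 2 * P\<^sup>2)"
    proof (rule AE_I2)
      fix x assume "x \<in> space L"
      then have "\<bar>k x\<bar>\<^sup>2 \<le> P\<^sup>2" using P by (intro power_mono) (auto simp: space_L)
      moreover have "(v x - k x)\<^sup>2 \<le> 2 * (v x)\<^sup>2 + 2 * (k x)\<^sup>2"
        using zero_le_power2[of "v x + k x"] by (simp add: power2_sum power2_diff)
      ultimately have "(v x - k x)\<^sup>2 \<le> 2 * (v x)\<^sup>2 + 2 * P\<^sup>2" by simp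
      then show "norm ((v x - k x)\<^sup>2) \<le> norm (2 * (v x)\<^sup>2 + 2 * P\<^sup>2)" by simp
    qed
  qed simp
  then show ?thesis by (simp add: L2_space_def)
qed

text \<open>An inequality, since measurability of f is not among the assumptions: if its square is
  not integrable, the Bochner integral has the default value 0 and the bound still holds.\<close>

lemma L2_norm_le_AE:
  assumes "AE x in L. f x = h x" "h \<in> borel_measurable L"
  shows "(L2_norm d \<Omega> f)\<^sup>2 \<le> (L2_norm d \<Omega> h)\<^sup>2"
proof (cases "integrable L (\<lambda>x. (f x)\<^sup>2)")
  case True
  have "(LINT x|L. (f x)\<^sup>2) = (LINT x|L. (h x)\<^sup>2)"
    by (rule integral_cong_AE) (use True assms in \<open>auto elim: eventually_mono\<close>)
  then show ?thesis by (simp add: L2_norm_sq)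
next
  case False
  then show ?thesis by (simp add: L2_norm_sq not_integrable_integral_eq)
qed

end

lemma H_seminorm_sq_nonneg: "H_seminorm_sq d \<Omega> k v \<ge> 0"
  by (induction k arbitrary: v) (auto intro: sum_nonneg)

text \<open>The same affine function serves for both values of j, and the infimum is bounded by the
  value there.\<close>

theorem lemma4p4:
  "\<exists>C::real. C > 0 \<and>
     (\<forall>d\<ge>1. \<forall>\<Omega>. bounded_convex_domain d \<Omega> \<longrightarrow>
        (\<forall>v\<in>sobolev_H d \<Omega> 2. \<forall>j\<in>{0, 1::nat}.
           (INF p\<in>P1 d. H_seminorm d \<Omega> j (\<lambda>x. v x - p x))
             \<le> C * ediameter d \<Omega> ^ (2 - j) * H_seminorm d \<Omega> 2 v))"
proof (intro exI[of _ 2] conjI allI impI ballI)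
  fix d \<Omega> v and j :: nat
  assume d: "1 \<le> d" and dom: "bounded_convex_domain d \<Omega>" and v: "v \<in> sobolev_H d \<Omega> 2" and j: "j \<in> {0, 1}"
  interpret convex_domain d \<Omega> by unfold_locales (rule dom)
  let ?R = "ediameter d \<Omega>"
  define w where "w = (\<lambda>i. weak_pderiv d \<Omega> i v)"
  define H where "H = H_seminorm_sq d \<Omega> 2 v"
  have R: "?R > 0" by (rule diameter_pos[OF d])
  have H0: "H \<ge> 0" unfolding H_def by (rule H_seminorm_sq_nonneg)
  have v2: "v \<in> L2_space d \<Omega>" and wex: "\<And>i. i < d \<Longrightarrow> \<exists>g. has_weak_pderiv d \<Omega> i v g"
    and wH: "\<And>i. i < d \<Longrightarrow> w i \<in> sobolev_H d \<Omega> 1"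
    using v by (auto simp: numeral_2_eq_2 w_def)
  have wd: "has_weak_pderiv d \<Omega> i v (w i)" if "i < d" for i
    unfolding w_def weak_pderiv_def by (rule someI_ex[OF wex[OF that]])
  have w2: "w i \<in> L2_space d \<Omega>" if "i < d" for i using wH[OF that] by simp
  have wd2: "has_weak_pderiv d \<Omega> k (w i) (weak_pderiv d \<Omega> k (w i))" "weak_pderiv d \<Omega> k (w i) \<in> L2_space d \<Omega>"
    if "i < d" "k < d" for i k
  proof -
    have ex: "\<exists>g. has_weak_pderiv d \<Omega> k (w i) g" and m: "weak_pderiv d \<Omega> k (w i) \<in> L2_space d \<Omega>"
      using wH[OF that(1)] that(2) by simp_all
    from someI_ex[OF ex] show "has_weak_pderiv d \<Omega> k (w i) (weak_pderiv d \<Omega> k (w i))"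
      unfolding weak_pderiv_def .
    show "weak_pderiv d \<Omega> k (w i) \<in> L2_space d \<Omega>" by (rule m)
  qed
  have "\<forall>i. \<exists>c. i < d \<longrightarrow> (L2_norm d \<Omega> (\<lambda>x. w i x - c))\<^sup>2 \<le> 2 * ?R\<^sup>2 * (\<Sum>k<d. (L2_norm d \<Omega> (weak_pderiv d \<Omega> k (w i)))\<^sup>2)"
    using poincare_L2[OF d w2 wd2] by blast
  from choice[OF this] obtain a where a: "\<And>i. i < d \<Longrightarrow>
      (L2_norm d \<Omega> (\<lambda>x. w i x - a i))\<^sup>2 \<le> 2 * ?R\<^sup>2 * (\<Sum>k<d. (L2_norm d \<Omega> (weak_pderiv d \<Omega> k (w i)))\<^sup>2)" by blast
  define S where "S = (\<Sum>i<d. (L2_norm d \<Omega> (\<lambda>x. w i x - a i))\<^sup>2)"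
  have S: "S \<le> 2 * ?R\<^sup>2 * H"
    unfolding S_def H_def numeral_2_eq_2 H_seminorm_sq.simps sum_distrib_left
    using sum_mono[of "{..<d}", OF a] by (simp add: w_def sum_distrib_left numeral_2_eq_2)
  \<comment> \<open>The leading 0 gives \<open>l\<close> the form b + sum for which the affine
    lemmas are stated.\<close>
  define l where "l = (\<lambda>x. 0 + (\<Sum>i<d. a i * x i))"
  have lm: "l \<in> borel_measurable (lebP d)" unfolding l_def by measurable
  obtain P where P: "\<And>x. x \<in> \<Omega> \<Longrightarrow> \<bar>l x\<bar> \<le> P" unfolding l_def by (rule affine_bounded[of 0 a]) blast
  have "\<exists>c. (L2_norm d \<Omega> (\<lambda>x. (v x - l x) - c))\<^sup>2 \<le> 2 * ?R\<^sup>2 * S"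
    unfolding S_def
  proof (rule poincare_L2[OF d L2_space_diff_bounded[OF v2 lm P]])
    show "has_weak_pderiv d \<Omega> i (\<lambda>x. v x - l x) (\<lambda>x. w i x - a i)" if "i < d" for i
      unfolding l_def by (rule has_weak_pderiv_diff_affine[OF wd[OF that] that])
    show "(\<lambda>x. w i x - a i) \<in> L2_space d \<Omega>" if "i < d" for i
      by (rule L2_space_diff_bounded[OF w2[OF that], of _ "\<bar>a i\<bar>"]) auto
  qed
  then obtain b where b: "(L2_norm d \<Omega> (\<lambda>x. (v x - l x) - b))\<^sup>2 \<le> 2 * ?R\<^sup>2 * S" by blast
  define p where "p = (\<lambda>x. b + (\<Sum>i<d. a i * x i))"
  have p: "p \<in> P1 d" unfolding P1_def p_def by blast
  \<comment> \<open>An infimum of reals lies below its members only if the set is bounded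
    below.\<close>
  have bdd: "bdd_below ((\<lambda>p. H_seminorm d \<Omega> j (\<lambda>x. v x - p x)) ` P1 d)"
    by (rule bdd_belowI[of _ 0]) (auto simp: H_seminorm_def H_seminorm_sq_nonneg)
  \<comment> \<open>For j = 0 two applications give 2 R^2 * 2 R^2 * H, which is exactly the right
    side. For j = 1 one application gives 2 R^2 * H, which is less than (2 R)^2 * H unless H =
    0.\<close>
  have "H_seminorm_sq d \<Omega> j (\<lambda>x. v x - p x) \<le> (2 * ?R ^ (2 - j))\<^sup>2 * H"
  proof (cases "j = 0")
    case True
    have "(\<lambda>x. (v x - l x) - b) = (\<lambda>x. v x - p x)" by (auto simp: l_def p_def)
    then have "H_seminorm_sq d \<Omega> j (\<lambda>x. v x - p x) \<le> 2 * ?R\<^sup>2 * S" using b True by simp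
    also have "\<dots> \<le> 2 * ?R\<^sup>2 * (2 * ?R\<^sup>2 * H)" using S by (intro mult_left_mono) auto
    also have "\<dots> = (2 * ?R ^ (2 - j))\<^sup>2 * H" using True by (simp add: power2_eq_square)
    finally show ?thesis .
  next
    case False
    then have j1: "j = 1" using j by simp
    \<comment> \<open>The derivative chosen by \<open>weak_pderiv\<close> for v - p is known only up
      to null sets; uniqueness compares it with \<open>w i x - a i\<close>.\<close>
    have le: "(L2_norm d \<Omega> (weak_pderiv d \<Omega> i (\<lambda>x. v x - p x)))\<^sup>2 \<le> (L2_norm d \<Omega> (\<lambda>x. w i x - a i))\<^sup>2" if i: "i < d" for i
    proof (rule L2_norm_le_AE)
      have *: "has_weak_pderiv d \<Omega> i (\<lambda>x. v x - p x) (\<lambda>x. w i x - a i)"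
        unfolding p_def by (rule has_weak_pderiv_diff_affine[OF wd[OF i] i])
      then have "\<exists>g. has_weak_pderiv d \<Omega> i (\<lambda>x. v x - p x) g" by blast
      from someI_ex[OF this] have "has_weak_pderiv d \<Omega> i (\<lambda>x. v x - p x) (weak_pderiv d \<Omega> i (\<lambda>x. v x - p x))"
        unfolding weak_pderiv_def .
      then show "AE x in L. weak_pderiv d \<Omega> i (\<lambda>x. v x - p x) x = w i x - a i"
        by (rule weak_pderiv_unique[OF _ * i])
      show "(\<lambda>x. w i x - a i) \<in> borel_measurable L"
        using w2[OF i] by (auto simp: L2_space_def)
    qed
    have "H_seminorm_sq d \<Omega> j (\<lambda>x. v x - p x) \<le> S"
      unfolding j1 One_nat_def H_seminorm_sq.simps S_def by (rule sum_mono) (use le in auto)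
    also have "\<dots> \<le> 2 * ?R\<^sup>2 * H" by (rule S)
    also have "\<dots> \<le> (2 * ?R ^ (2 - j))\<^sup>2 * H"
      using H0 by (intro mult_right_mono) (auto simp: j1 power_mult_distrib)
    finally show ?thesis .
  qed
  then have "H_seminorm d \<Omega> j (\<lambda>x. v x - p x) \<le> sqrt ((2 * ?R ^ (2 - j))\<^sup>2 * H)"
    unfolding H_seminorm_def by (rule real_sqrt_le_mono)
  also have "\<dots> = 2 * ?R ^ (2 - j) * H_seminorm d \<Omega> 2 v"
    unfolding H_seminorm_def H_def real_sqrt_mult[of _ "H_seminorm_sq d \<Omega> 2 v"] real_sqrt_abs using R by simp
  finally show "(INF p\<in>P1 d. H_seminorm d \<Omega> j (\<lambda>x. v x - p x)) \<le> 2 * ?R ^ (2 - j) * H_seminorm d \<Omega> 2 v"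
    using cINF_lower[OF bdd p] by (rule order_trans[rotated])
qed simp

end
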